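(* Let $E\xrightarrow{\pi}M$ and $\bar E\xrightarrow{\bar\pi}M$ be principal $S^1$-bundles over a smooth manifold $M$, with connection 1-forms $\theta,\bar\theta$ and curvature closed 2-forms $F,\bar F\in\Omega^2M$ respectively (so $d\theta=\pi^*F$, $d\bar\theta=\bar\pi^*\bar F$). Let $\eta\in\Omega^3_{\mathrm{cl}}(E)^{S^1}$ and $\bar\eta\in\Omega^3_{\mathrm{cl}}(\bar E)^{S^1}$ be $S^1$-invariant closed 3-forms such that, for a 3-form $H$ on $M$, $$\eta=\pi^*H+\theta\wedge\pi^*\bar F,\qquad \bar\eta=\bar\pi^*H+\bar\theta\wedge\bar\pi^*F .$$ Then the map $$\Gamma(TE\oplus T^*E)^{S^1}\to\Gamma(T\bar E\oplus T^*\bar E)^{S^1},\qquad X+f\,\partial_\theta+C+g\,\theta\ \mapsto\ X+g\,\partial_{\bar\theta}+C+f\,\bar\theta$$ (with $X\in\mathfrak XM$, $f,g\in C^\infty M$, $C\in\Omega^1M$) induces an isomorphism of Courant algebroids $$(\Gamma(TE\oplus T^*E)^{S^1},[\,,]_\eta)\cong(\Gamma(T\bar E\oplus T^*\bar E)^{S^1},[\,,]_{\bar\eta}).$$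
   Context: $\partial_\theta$ and $\partial_{\bar\theta}$ are the vector fields generating the circle actions on $E$ and $\bar E$, with $\theta(\partial_\theta)=1=\bar\theta(\partial_{\bar\theta})$. The choice of connections gives isomorphisms $(TE)/S^1\cong TM\oplus\langle\partial_\theta\rangle$ and $(T^*E)/S^1\cong T^*M\oplus\langle\theta\rangle$ (vector fields $X$ on $M$ are identified with their horizontal lifts, forms and functions on $M$ with their pullbacks), and similarly for $\bar E$; so every $S^1$-invariant section of $TE\oplus T^*E$ is uniquely of the form $X+f\partial_\theta+C+g\theta$. The $\eta$-twisted Courant–Dorfman bracket is $$[U+\xi,V+\zeta]_\eta=[U,V]+\mathcal L_U\zeta-\iota_Vd\xi-\iota_V\iota_U\eta$$ for vector fields $U,V$ and 1-forms $\xi,\zeta$; it restricts to invariant sections. The Courant algebroid structure on $(TE\oplus T^*E)/S^1$ over $M$ consists of this bracket on invariant sections, the pairing $\langle U+\xi,V+\zeta\rangle=\zeta(U)+\xi(V)$, and the anchor to $TM$ induced by $d\pi$; similarly for $\bar E$. *)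

theory Defs
  imports "HOL-Analysis.Analysis"
begin

section \<open>Smooth manifolds\<close>

primrec Ck_on :: "nat \<Rightarrow> ('a::real_normed_vector \<Rightarrow> 'b::real_normed_vector) \<Rightarrow> 'a set \<Rightarrow> bool" where
  "Ck_on 0 f S \<longleftrightarrow> continuous_on S f"
| "Ck_on (Suc k) f S \<longleftrightarrow>
     (\<exists>f'. (\<forall>x\<in>S. (f has_derivative f' x) (at x)) \<and> (\<forall>v. Ck_on k (\<lambda>x. f' x v) S))"

text \<open>Only used for open \<open>S\<close> in a finite-dimensional space, where continuity of all iterated
  directional derivatives is the usual notion of smoothness.\<close>

definition smooth_on :: "('a::real_normed_vector \<Rightarrow> 'b::real_normed_vector) \<Rightarrow> 'a set \<Rightarrow> bool" where
  "smooth_on f S \<longleftrightarrow> (\<forall>k. Ck_on k f S)"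

text \<open>A chart is a pair of its domain and its coordinate map. The model space \<open>'b\<close> is any
  finite-dimensional real inner product space; class \<open>euclidean_space\<close> is avoided because it
  excludes dimension zero.\<close>

type_synonym ('a, 'b) atlas = "('a set \<times> ('a \<Rightarrow> 'b)) set"

definition smooth_atlas ::
  "'a::{t2_space,second_countable_topology} set \<Rightarrow> ('a, 'b::real_inner) atlas \<Rightarrow> bool" where
  "smooth_atlas S A \<longleftrightarrow>
     (\<exists>B::'b set. finite B \<and> span B = UNIV) \<and>
     \<Union>(fst ` A) = S \<and>
     (\<forall>(U, \<phi>)\<in>A. openin (top_of_set S) U \<and> open (\<phi> ` U) \<and>
                 homeomorphism U (\<phi> ` U) \<phi> (inv_into U \<phi>)) \<and>
     (\<forall>(U, \<phi>)\<in>A. \<forall>(V, \<psi>)\<in>A. smooth_on (\<psi> \<circ> inv_into U \<phi>) (\<phi> ` (U \<inter> V)))"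

text \<open>Manifolds are whole types, \<open>smooth_manifold\<close>; atlases on proper subsets are only needed
  for the circle.\<close>

definition smooth_manifold ::
  "('a::{t2_space,second_countable_topology}, 'b::real_inner) atlas \<Rightarrow> bool" where
  "smooth_manifold A \<longleftrightarrow> smooth_atlas UNIV A"

definition vector_space_atlas :: "('b::real_inner, 'b) atlas" where
  "vector_space_atlas = {(UNIV, \<lambda>x. x)}"

definition circle :: "complex set" where
  "circle = sphere 0 1"

definition circle_atlas :: "(complex, real) atlas" where
  "circle_atlas = {(cis ` {a<..<a + 2 * pi}, inv_into {a<..<a + 2 * pi} cis) | a. True}"

definition prod_atlas :: "('a, 'b) atlas \<Rightarrow> ('c, 'd) atlas \<Rightarrow> ('a \<times> 'c, 'b \<times> 'd) atlas" where
  "prod_atlas A B = {(U \<times> V, map_prod \<phi> \<psi>) | U \<phi> V \<psi>. (U, \<phi>) \<in> A \<and> (V, \<psi>) \<in> B}"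

text \<open>Here \<open>S\<close> is meant to be an open subset of the manifold with atlas \<open>A\<close>.\<close>

definition smooth_map_on ::
  "('a::topological_space, 'b::real_inner) atlas \<Rightarrow> ('c::topological_space, 'd::real_inner) atlas
     \<Rightarrow> 'a set \<Rightarrow> ('a \<Rightarrow> 'c) \<Rightarrow> bool" where
  "smooth_map_on A B S f \<longleftrightarrow>
     continuous_on S f \<and>
     (\<forall>(U, \<phi>)\<in>A. \<forall>(V, \<psi>)\<in>B.
        smooth_on (\<psi> \<circ> f \<circ> inv_into U \<phi>) (\<phi> ` (U \<inter> S \<inter> f -` V)))"

definition diffeomorphism_on ::
  "('a::topological_space, 'b::real_inner) atlas \<Rightarrow> ('c::topological_space, 'd::real_inner) atlas
     \<Rightarrow> 'a set \<Rightarrow> 'c set \<Rightarrow> ('a \<Rightarrow> 'c) \<Rightarrow> bool" where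
  "diffeomorphism_on A B S T f \<longleftrightarrow>
     bij_betw f S T \<and> smooth_map_on A B S f \<and> smooth_map_on B A T (inv_into S f)"

definition smooth_funs :: "('a::topological_space, 'b::real_inner) atlas \<Rightarrow> ('a \<Rightarrow> real) set" where
  "smooth_funs A = {f. smooth_map_on A vector_space_atlas UNIV f}"


section \<open>Tangent vectors and vector fields\<close>

text \<open>A tangent vector is the velocity of a smooth curve, viewed as a derivation on smooth
  functions; it is set to zero on non-smooth functions, so that equality of tangent vectors is
  equality of functions. Linear combinations are taken pointwise.\<close>

type_synonym 'a tvec = "('a \<Rightarrow> real) \<Rightarrow> real"
type_synonym 'a vfield = "'a \<Rightarrow> 'a tvec"

definition velocity ::
  "('a::topological_space, 'b::real_inner) atlas \<Rightarrow> (real \<Rightarrow> 'a) \<Rightarrow> 'a tvec" where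
  "velocity A \<gamma> = (\<lambda>f. if f \<in> smooth_funs A then deriv (\<lambda>t. f (\<gamma> t)) 0 else 0)"

definition tangent_space :: "('a::topological_space, 'b::real_inner) atlas \<Rightarrow> 'a \<Rightarrow> 'a tvec set" where
  "tangent_space A p = {velocity A \<gamma> | \<gamma>. smooth_map_on vector_space_atlas A UNIV \<gamma> \<and> \<gamma> 0 = p}"

definition differential ::
  "('c::topological_space, 'd::real_inner) atlas \<Rightarrow> ('a \<Rightarrow> 'c) \<Rightarrow> 'a tvec \<Rightarrow> 'c tvec" where
  "differential B F v = (\<lambda>g. if g \<in> smooth_funs B then v (g \<circ> F) else 0)"

definition vector_fields :: "('a::topological_space, 'b::real_inner) atlas \<Rightarrow> 'a vfield set" where
  "vector_fields A = {X. (\<forall>p. X p \<in> tangent_space A p) \<and>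
                         (\<forall>f\<in>smooth_funs A. (\<lambda>p. X p f) \<in> smooth_funs A)}"

definition lie_bracket :: "'a vfield \<Rightarrow> 'a vfield \<Rightarrow> 'a vfield" where
  "lie_bracket X Y = (\<lambda>p f. X p (\<lambda>q. Y q f) - Y p (\<lambda>q. X q f))"


section \<open>Differential forms\<close>

text \<open>A \<open>k\<close>-form takes a point and a list of \<open>k\<close> tangent vectors at that point; it is
  zero on all other lists.\<close>

type_synonym 'a form = "'a \<Rightarrow> 'a tvec list \<Rightarrow> real"

definition tangent_lists ::
  "('a::topological_space, 'b::real_inner) atlas \<Rightarrow> nat \<Rightarrow> 'a \<Rightarrow> 'a tvec list set" where
  "tangent_lists A k p = {vs. length vs = k \<and> set vs \<subseteq> tangent_space A p}"

definition forms :: "('a::topological_space, 'b::real_inner) atlas \<Rightarrow> nat \<Rightarrow> 'a form set" where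
  "forms A k = {\<omega>.
     (\<forall>p vs. vs \<notin> tangent_lists A k p \<longrightarrow> \<omega> p vs = 0) \<and>
     (\<forall>p. \<forall>vs\<in>tangent_lists A k p. \<forall>i<k. \<forall>u\<in>tangent_space A p. \<forall>w\<in>tangent_space A p. \<forall>a b.
        \<omega> p (vs[i := (\<lambda>f. a * u f + b * w f)]) = a * \<omega> p (vs[i := u]) + b * \<omega> p (vs[i := w])) \<and>
     (\<forall>p. \<forall>vs\<in>tangent_lists A k p. \<forall>i j. i < j \<and> j < k \<and> vs ! i = vs ! j \<longrightarrow> \<omega> p vs = 0) \<and>
     (\<forall>Xs. length Xs = k \<and> set Xs \<subseteq> vector_fields A \<longrightarrow>
        (\<lambda>p. \<omega> p (map (\<lambda>X. X p) Xs)) \<in> smooth_funs A)}"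

definition drop_nth :: "nat \<Rightarrow> 'x list \<Rightarrow> 'x list" where
  "drop_nth i xs = take i xs @ drop (Suc i) xs"

definition pullback ::
  "('a::topological_space, 'b::real_inner) atlas \<Rightarrow> ('c::topological_space, 'd::real_inner) atlas
     \<Rightarrow> nat \<Rightarrow> ('a \<Rightarrow> 'c) \<Rightarrow> 'c form \<Rightarrow> 'a form" where
  "pullback A B k F \<omega> = (\<lambda>p vs.
     if vs \<in> tangent_lists A k p then \<omega> (F p) (map (differential B F) vs) else 0)"

text \<open>Wedge product of a 1-form with a form of arbitrary degree, without normalising factor.\<close>

definition wedge1 :: "'a form \<Rightarrow> 'a form \<Rightarrow> 'a form" where
  "wedge1 \<alpha> \<beta> = (\<lambda>p vs. \<Sum>i<length vs. (- 1) ^ i * \<alpha> p [vs ! i] * \<beta> p (drop_nth i vs))"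

definition interior_prod :: "'a vfield \<Rightarrow> 'a form \<Rightarrow> 'a form" where
  "interior_prod X \<omega> = (\<lambda>p vs. \<omega> p (X p # vs))"

text \<open>The exterior and the Lie derivative are given by the usual invariant formulas on vector
  fields. Both expressions are linear over smooth functions in \<open>Xs\<close>, so their value at \<open>p\<close> only
  depends on the values of \<open>Xs\<close> at \<open>p\<close>, and any extension of tangent vectors to vector fields
  may be used.\<close>

definition extension ::
  "('a::topological_space, 'b::real_inner) atlas \<Rightarrow> 'a \<Rightarrow> 'a tvec \<Rightarrow> 'a vfield" where
  "extension A p v = (SOME X. X \<in> vector_fields A \<and> X p = v)"

definition d_formula :: "'a form \<Rightarrow> 'a vfield list \<Rightarrow> 'a \<Rightarrow> real" where
  "d_formula \<omega> Xs p =
     (\<Sum>i<length Xs. (- 1) ^ i * (Xs ! i) p (\<lambda>q. \<omega> q (map (\<lambda>X. X q) (drop_nth i Xs)))) +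
     (\<Sum>j<length Xs. \<Sum>i<j. (- 1) ^ (i + j) *
        \<omega> p (lie_bracket (Xs ! i) (Xs ! j) p # map (\<lambda>X. X p) (drop_nth i (drop_nth j Xs))))"

definition ext_deriv ::
  "('a::topological_space, 'b::real_inner) atlas \<Rightarrow> nat \<Rightarrow> 'a form \<Rightarrow> 'a form" where
  "ext_deriv A k \<omega> = (\<lambda>p vs.
     if vs \<in> tangent_lists A (Suc k) p then d_formula \<omega> (map (extension A p) vs) p else 0)"

definition lie_formula :: "'a vfield \<Rightarrow> 'a form \<Rightarrow> 'a vfield list \<Rightarrow> 'a \<Rightarrow> real" where
  "lie_formula U \<omega> Xs p =
     U p (\<lambda>q. \<omega> q (map (\<lambda>X. X q) Xs)) -
     (\<Sum>i<length Xs. \<omega> p ((map (\<lambda>X. X p) Xs)[i := lie_bracket U (Xs ! i) p]))"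

definition lie_deriv ::
  "('a::topological_space, 'b::real_inner) atlas \<Rightarrow> nat \<Rightarrow> 'a vfield \<Rightarrow> 'a form \<Rightarrow> 'a form" where
  "lie_deriv A k U \<omega> = (\<lambda>p vs.
     if vs \<in> tangent_lists A k p then lie_formula U \<omega> (map (extension A p) vs) p else 0)"

definition closed_forms :: "('a::topological_space, 'b::real_inner) atlas \<Rightarrow> nat \<Rightarrow> 'a form set" where
  "closed_forms A k = {\<omega> \<in> forms A k. ext_deriv A k \<omega> = (\<lambda>p vs. 0)}"


section \<open>Principal circle bundles\<close>

text \<open>\<open>act P e z\<close> is the right action of \<open>z\<close> in the unit circle.\<close>

record ('e, 'b, 'm) circle_bundle =
  tot :: "('e, 'b) atlas"
  prj :: "'e \<Rightarrow> 'm"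
  act :: "'e \<Rightarrow> complex \<Rightarrow> 'e"

definition local_trivialization ::
  "('m::topological_space, 'n::real_inner) atlas
     \<Rightarrow> ('e::topological_space, 'b::real_inner, 'm) circle_bundle
     \<Rightarrow> 'm set \<Rightarrow> ('e \<Rightarrow> 'm \<times> complex) \<Rightarrow> bool" where
  "local_trivialization M P W \<Phi> \<longleftrightarrow>
     diffeomorphism_on (tot P) (prod_atlas M circle_atlas) (prj P -` W) (W \<times> circle) \<Phi> \<and>
     (\<forall>e\<in>prj P -` W. fst (\<Phi> e) = prj P e) \<and>
     (\<forall>e\<in>prj P -` W. \<forall>z\<in>circle. \<Phi> (act P e z) = (prj P e, snd (\<Phi> e) * z))"

definition principal_circle_bundle ::
  "('m::{t2_space,second_countable_topology}, 'n::real_inner) atlas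
     \<Rightarrow> ('e::{t2_space,second_countable_topology}, 'b::real_inner, 'm) circle_bundle \<Rightarrow> bool" where
  "principal_circle_bundle M P \<longleftrightarrow>
     smooth_manifold M \<and> smooth_manifold (tot P) \<and>
     smooth_map_on (tot P) M UNIV (prj P) \<and>
     smooth_map_on (prod_atlas (tot P) circle_atlas) (tot P) (UNIV \<times> circle)
       (\<lambda>(e, z). act P e z) \<and>
     (\<forall>e. act P e 1 = e) \<and>
     (\<forall>e. \<forall>z\<in>circle. \<forall>w\<in>circle. act P (act P e z) w = act P e (z * w)) \<and>
     (\<forall>e. \<forall>z\<in>circle. prj P (act P e z) = prj P e) \<and>
     (\<forall>p. \<exists>W \<Phi>. open W \<and> p \<in> W \<and> local_trivialization M P W \<Phi>)"

definition fundamental_field ::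
  "('e::topological_space, 'b::real_inner, 'm) circle_bundle \<Rightarrow> 'e vfield" where
  "fundamental_field P = (\<lambda>e. velocity (tot P) (\<lambda>t. act P e (cis t)))"

definition invariant_field ::
  "('e::topological_space, 'b::real_inner, 'm) circle_bundle \<Rightarrow> 'e vfield \<Rightarrow> bool" where
  "invariant_field P U \<longleftrightarrow>
     (\<forall>z\<in>circle. \<forall>e. differential (tot P) (\<lambda>x. act P x z) (U e) = U (act P e z))"

definition invariant_form ::
  "('e::topological_space, 'b::real_inner, 'm) circle_bundle \<Rightarrow> nat \<Rightarrow> 'e form \<Rightarrow> bool" where
  "invariant_form P k \<omega> \<longleftrightarrow>
     (\<forall>z\<in>circle. pullback (tot P) (tot P) k (\<lambda>x. act P x z) \<omega> = \<omega>)"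

definition connection_form ::
  "('e::topological_space, 'b::real_inner, 'm) circle_bundle \<Rightarrow> 'e form \<Rightarrow> bool" where
  "connection_form P \<theta> \<longleftrightarrow>
     \<theta> \<in> forms (tot P) 1 \<and> invariant_form P 1 \<theta> \<and> (\<forall>e. \<theta> e [fundamental_field P e] = 1)"

definition pull ::
  "('m::topological_space, 'n::real_inner) atlas
     \<Rightarrow> ('e::topological_space, 'b::real_inner, 'm) circle_bundle \<Rightarrow> nat \<Rightarrow> 'm form \<Rightarrow> 'e form" where
  "pull M P k \<omega> = pullback (tot P) M k (prj P) \<omega>"

definition curvature_form ::
  "('m::topological_space, 'n::real_inner) atlas
     \<Rightarrow> ('e::topological_space, 'b::real_inner, 'm) circle_bundle \<Rightarrow> 'e form \<Rightarrow> 'm form \<Rightarrow> bool" where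
  "curvature_form M P \<theta> F \<longleftrightarrow> F \<in> closed_forms M 2 \<and> ext_deriv (tot P) 1 \<theta> = pull M P 2 F"

definition horizontal_lift ::
  "('m::topological_space, 'n::real_inner) atlas
     \<Rightarrow> ('e::topological_space, 'b::real_inner, 'm) circle_bundle
     \<Rightarrow> 'e form \<Rightarrow> 'm vfield \<Rightarrow> 'e vfield" where
  "horizontal_lift M P \<theta> X = (\<lambda>e. THE v.
     v \<in> tangent_space (tot P) e \<and> differential M (prj P) v = X (prj P e) \<and> \<theta> e [v] = 0)"


section \<open>The Courant algebroid of invariant sections\<close>

text \<open>A section of \<open>TE \<oplus> T\<^sup>*E\<close> is a pair of a vector field and a 1-form.\<close>

type_synonym 'e gsection = "'e vfield \<times> 'e form"

definition invariant_sections ::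
  "('e::topological_space, 'b::real_inner, 'm) circle_bundle \<Rightarrow> 'e gsection set" where
  "invariant_sections P = {(U, \<xi>). U \<in> vector_fields (tot P) \<and> \<xi> \<in> forms (tot P) 1 \<and>
     invariant_field P U \<and> invariant_form P 1 \<xi>}"

definition dorfman ::
  "('e::topological_space, 'b::real_inner) atlas \<Rightarrow> 'e form
     \<Rightarrow> 'e gsection \<Rightarrow> 'e gsection \<Rightarrow> 'e gsection" where
  "dorfman A \<eta> = (\<lambda>(U, \<xi>) (V, \<zeta>).
     (lie_bracket U V,
      \<lambda>p vs. lie_deriv A 1 U \<zeta> p vs - interior_prod V (ext_deriv A 1 \<xi>) p vs
              - interior_prod V (interior_prod U \<eta>) p vs))"

text \<open>The data of a Courant algebroid over a manifold with underlying set \<open>'m\<close>, in terms of its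
  module of sections \<open>'s\<close>.\<close>

record ('m, 's) courant_data =
  csections :: "'s set"
  cadd :: "'s \<Rightarrow> 's \<Rightarrow> 's"
  cscale :: "('m \<Rightarrow> real) \<Rightarrow> 's \<Rightarrow> 's"
  cbracket :: "'s \<Rightarrow> 's \<Rightarrow> 's"
  cpairing :: "'s \<Rightarrow> 's \<Rightarrow> 'm \<Rightarrow> real"
  canchor :: "'s \<Rightarrow> 'm vfield"

definition courant_isomorphism ::
  "('m::topological_space, 'n::real_inner) atlas \<Rightarrow> ('m, 's) courant_data
     \<Rightarrow> ('m, 't) courant_data \<Rightarrow> ('s \<Rightarrow> 't) \<Rightarrow> bool" where
  "courant_isomorphism M A B \<phi> \<longleftrightarrow>
     bij_betw \<phi> (csections A) (csections B) \<and>
     (\<forall>s\<in>csections A. \<forall>t\<in>csections A. \<phi> (cadd A s t) = cadd B (\<phi> s) (\<phi> t)) \<and>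
     (\<forall>h\<in>smooth_funs M. \<forall>s\<in>csections A. \<phi> (cscale A h s) = cscale B h (\<phi> s)) \<and>
     (\<forall>s\<in>csections A. \<forall>t\<in>csections A. \<phi> (cbracket A s t) = cbracket B (\<phi> s) (\<phi> t)) \<and>
     (\<forall>s\<in>csections A. \<forall>t\<in>csections A. cpairing B (\<phi> s) (\<phi> t) = cpairing A s t) \<and>
     (\<forall>s\<in>csections A. canchor B (\<phi> s) = canchor A s)"

text \<open>The pairing and the anchor of invariant sections are constant along the fibres; their value
  at \<open>p\<close> is computed at an arbitrary point over \<open>p\<close>.\<close>

definition fibre_point :: "('e, 'b, 'm) circle_bundle \<Rightarrow> 'm \<Rightarrow> 'e" where
  "fibre_point P p = (SOME e. prj P e = p)"

definition invariant_courant ::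
  "('m::topological_space, 'n::real_inner) atlas
     \<Rightarrow> ('e::topological_space, 'b::real_inner, 'm) circle_bundle
     \<Rightarrow> 'e form \<Rightarrow> ('m, 'e gsection) courant_data" where
  "invariant_courant M P \<eta> = \<lparr>
     csections = invariant_sections P,
     cadd = (\<lambda>(U, \<xi>) (V, \<zeta>). (\<lambda>e f. U e f + V e f, \<lambda>e vs. \<xi> e vs + \<zeta> e vs)),
     cscale = (\<lambda>h (U, \<xi>). (\<lambda>e f. h (prj P e) * U e f, \<lambda>e vs. h (prj P e) * \<xi> e vs)),
     cbracket = dorfman (tot P) \<eta>,
     cpairing = (\<lambda>(U, \<xi>) (V, \<zeta>) p. let e = fibre_point P p in \<zeta> e [U e] + \<xi> e [V e]),
     canchor = (\<lambda>(U, \<xi>) p. differential M (prj P) (U (fibre_point P p)))\<rparr>"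

text \<open>The section \<open>X + f \<partial>\<^sub>\<theta> + C + g \<theta>\<close>, with \<open>X\<close> identified with its horizontal lift and
  \<open>C\<close>, \<open>f\<close>, \<open>g\<close> with their pullbacks.\<close>

definition split_section ::
  "('m::topological_space, 'n::real_inner) atlas
     \<Rightarrow> ('e::topological_space, 'b::real_inner, 'm) circle_bundle \<Rightarrow> 'e form
     \<Rightarrow> 'm vfield \<times> ('m \<Rightarrow> real) \<times> 'm form \<times> ('m \<Rightarrow> real) \<Rightarrow> 'e gsection" where
  "split_section M P \<theta> = (\<lambda>(X, f, C, g).
     (\<lambda>e h. horizontal_lift M P \<theta> X e h + f (prj P e) * fundamental_field P e h,
      \<lambda>e vs. pull M P 1 C e vs + g (prj P e) * \<theta> e vs))"

definition base_data ::
  "('m::topological_space, 'n::real_inner) atlas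
     \<Rightarrow> ('m vfield \<times> ('m \<Rightarrow> real) \<times> 'm form \<times> ('m \<Rightarrow> real)) set" where
  "base_data M = vector_fields M \<times> smooth_funs M \<times> forms M 1 \<times> smooth_funs M"

text \<open>Defined through the decomposition of an invariant section as a \<open>split_section\<close>.\<close>

definition t_duality_map ::
  "('m::topological_space, 'n::real_inner) atlas
     \<Rightarrow> ('e::topological_space, 'b::real_inner, 'm) circle_bundle \<Rightarrow> 'e form
     \<Rightarrow> ('k::topological_space, 'c::real_inner, 'm) circle_bundle \<Rightarrow> 'k form
     \<Rightarrow> 'e gsection \<Rightarrow> 'k gsection" where
  "t_duality_map M P \<theta> Q \<theta>' s =
     (case inv_into (base_data M) (split_section M P \<theta>) s of
        (X, f, C, g) \<Rightarrow> split_section M Q \<theta>' (X, g, C, f))"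

end

theory Submission
  imports Defs
begin

text \<open>An invariant section splits as \<open>X + f \<partial>\<^sub>\<theta> + C + g \<theta>\<close> with components on the base. Since
  \<open>d\<theta>\<close> is the pullback of \<open>F\<close> and the contraction of \<open>\<eta>\<close> with \<open>\<partial>\<^sub>\<theta>\<close> is the pullback of \<open>F'\<close>, the
  components of a bracket of two invariant sections are given by formulas on the base. Exchanging
  \<open>f\<close> with \<open>g\<close> and \<open>F\<close> with \<open>F'\<close> in these formulas exchanges the two scalar components of the
  bracket and fixes the other two.\<close>

section \<open>Calculus of smooth functions\<close>

text \<open>Tangent vectors act on globally smooth functions only, and \<open>ext_deriv\<close> and
  \<open>lie_deriv\<close> evaluate an arbitrary choice of extending vector fields. Two supplies are
  therefore needed before a bracket can be computed: bump functions, which turn local coordinates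
  and coordinate fields into global ones, and tensoriality, which makes the choice of extension
  irrelevant. That the Lie bracket of vector fields again consists of velocities of curves rests on
  the symmetry of second derivatives. On the total space, the form part of a bracket is tested on
  fields \<open>Z + c \<partial>\<^sub>\<theta>\<close> with \<open>c\<close> constant. They attain
  every tangent vector and are projectable, so every function that gets differentiated is a pullback
  from the base. In the form part the two 2-forms have different origins: \<open>F\<close> enters
  through the vertical part \<open>- F(X, Y)\<close> of Lie brackets and gets multiplied by the
  components along \<open>\<theta>\<close>, while \<open>F'\<close> enters through the twist and
  gets multiplied by the components along \<open>\<partial>\<^sub>\<theta>\<close>.\<close>

lemma Ck_on_SucE:
  assumes "Ck_on (Suc k) f S"
  obtains f' where "\<And>x. x \<in> S \<Longrightarrow> (f has_derivative f' x) (at x)" "\<And>v. Ck_on k (\<lambda>x. f' x v) S"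
  using assms by auto

lemma Ck_on_subset: "Ck_on k f S \<Longrightarrow> T \<subseteq> S \<Longrightarrow> Ck_on k f T"
proof (induction k arbitrary: f)
  case 0
  then show ?case by (auto intro: continuous_on_subset)
next
  case (Suc k)
  then obtain f' where f': "\<And>x. x \<in> S \<Longrightarrow> (f has_derivative f' x) (at x)"
      "\<And>v. Ck_on k (\<lambda>x. f' x v) S"
    by auto
  then show ?case using Suc.IH[OF f'(2) Suc.prems(2)] Suc.prems(2)
    by (auto intro!: exI[of _ f'])
qed

lemma Ck_on_cong:
  assumes "open S" "\<And>x. x \<in> S \<Longrightarrow> f x = g x"
  shows "Ck_on k f S \<longleftrightarrow> Ck_on k g S"
proof (cases k)
  case 0
  then show ?thesis using assms by (simp cong: continuous_on_cong)
next
  case (Suc n)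
  have "(f has_derivative d) (at x) \<longleftrightarrow> (g has_derivative d) (at x)" if "x \<in> S" for x d
    using has_derivative_transform_within_open[OF _ assms(1) that] assms(2) by metis
  then show ?thesis using Suc by auto
qed

text \<open>The existential witness is replaced by \<open>frechet_derivative\<close>, which does not
  depend on \<open>S\<close>; this is what allows derivatives on overlapping neighbourhoods to be
  glued in \<open>Ck_on_local\<close>.\<close>

lemma Ck_on_Suc_iff:
  assumes "open S"
  shows "Ck_on (Suc k) f S \<longleftrightarrow> (\<forall>x\<in>S. f differentiable (at x)) \<and>
           (\<forall>v. Ck_on k (\<lambda>x. frechet_derivative f (at x) v) S)" (is "?L \<longleftrightarrow> ?R")
proof
  assume ?L
  then obtain f' where f': "\<And>x. x \<in> S \<Longrightarrow> (f has_derivative f' x) (at x)"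
      "\<And>v. Ck_on k (\<lambda>x. f' x v) S"
    by auto
  then have "Ck_on k (\<lambda>x. frechet_derivative f (at x) v) S" for v
    using Ck_on_cong[OF assms, of "\<lambda>x. f' x v" "\<lambda>x. frechet_derivative f (at x) v" k]
      frechet_derivative_at by metis
  then show ?R using f' differentiable_def by blast
next
  assume ?R
  then show ?L using frechet_derivative_works
    by (auto intro!: exI[of _ "\<lambda>x. frechet_derivative f (at x)"])
qed

lemma Ck_on_Suc_imp: "Ck_on (Suc k) f S \<Longrightarrow> Ck_on k f S"
proof (induction k arbitrary: f)
  case 0
  then show ?case
    by (auto intro!: continuous_at_imp_continuous_on dest: has_derivative_continuous)
next
  case (Suc k)
  from Suc.prems show ?case
    unfolding Ck_on.simps(2)[of "Suc k"] Ck_on.simps(2)[of k f] using Suc.IH by meson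
qed

lemma Ck_on_local:
  assumes "open S" "\<And>x. x \<in> S \<Longrightarrow> \<exists>T. open T \<and> x \<in> T \<and> T \<subseteq> S \<and> Ck_on k f T"
  shows "Ck_on k f S"
  using assms(2)
proof (induction k arbitrary: f)
  case 0
  have "isCont f x" if x: "x \<in> S" for x
    using 0[OF x] by (metis Ck_on.simps(1) continuous_on_eq_continuous_at)
  then show ?case
    by (simp add: continuous_at_imp_continuous_on)
next
  case (Suc k)
  have "f differentiable (at x)" if x: "x \<in> S" for x
    using Suc.prems[OF x] by (metis Ck_on_Suc_iff)
  moreover have "Ck_on k (\<lambda>x. frechet_derivative f (at x) v) S" for v
    by (rule Suc.IH) (metis Suc.prems Ck_on_Suc_iff)
  ultimately show ?case by (simp only: Ck_on_Suc_iff[OF assms(1)]) blast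
qed

lemma Ck_on_const: "Ck_on k (\<lambda>x. c) S"
proof (induction k arbitrary: c)
  case (Suc k)
  show ?case using Suc[of 0] by (auto intro!: exI[of _ "\<lambda>x v. 0"])
qed simp

lemma Ck_on_linear_compose:
  assumes "bounded_linear L" "Ck_on k f S"
  shows "Ck_on k (\<lambda>x. L (f x)) S"
  using assms(2)
proof (induction k arbitrary: f)
  case 0
  then show ?case
    using assms(1) by (auto intro!: bounded_linear.continuous_on[OF assms(1)])
next
  case (Suc k)
  then obtain f' where f': "\<And>x. x \<in> S \<Longrightarrow> (f has_derivative f' x) (at x)"
      "\<And>v. Ck_on k (\<lambda>x. f' x v) S"
    by auto
  have "((\<lambda>x. L (f x)) has_derivative (\<lambda>v. L (f' x v))) (at x)" if "x \<in> S" for x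
    using bounded_linear.has_derivative[OF assms(1) f'(1)[OF that]] .
  then show ?case using Suc.IH[OF f'(2)]
    by (auto intro!: exI[of _ "\<lambda>x v. L (f' x v)"])
qed

lemma Ck_on_id: "Ck_on k (\<lambda>x. x) S"
proof (cases k)
  case (Suc n)
  then show ?thesis by (auto intro!: exI[of _ "\<lambda>x v. v"] Ck_on_const)
qed simp

lemma Ck_on_add:
  "Ck_on k f S \<Longrightarrow> Ck_on k g S \<Longrightarrow> Ck_on k (\<lambda>x. f x + g x) S"
proof (induction k arbitrary: f g)
  case 0
  then show ?case by (auto intro: continuous_on_add)
next
  case (Suc k)
  obtain f' g' where d: "\<And>x. x \<in> S \<Longrightarrow> (f has_derivative f' x) (at x)"
      "\<And>v. Ck_on k (\<lambda>x. f' x v) S" "\<And>x. x \<in> S \<Longrightarrow> (g has_derivative g' x) (at x)"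
      "\<And>v. Ck_on k (\<lambda>x. g' x v) S"
    using Ck_on_SucE[OF Suc.prems(1)] Ck_on_SucE[OF Suc.prems(2)] by metis
  have "((\<lambda>x. f x + g x) has_derivative (\<lambda>v. f' x v + g' x v)) (at x)" if "x \<in> S" for x
    using d that by (auto intro: has_derivative_add)
  then show ?case using Suc.IH d
    by (auto intro!: exI[of _ "\<lambda>x v. f' x v + g' x v"])
qed

text \<open>The product rule leaves one factor undifferentiated in each term, so the induction also
  needs the two functions themselves at the lower order \<open>k\<close>.\<close>

lemma Ck_on_bilinear:
  assumes "bounded_bilinear pr"
  shows "Ck_on k f S \<Longrightarrow> Ck_on k g S \<Longrightarrow> Ck_on k (\<lambda>x. pr (f x) (g x)) S"
proof (induction k arbitrary: f g)
  case 0
  then show ?case by (auto intro: bounded_bilinear.continuous_on[OF assms])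
next
  case (Suc k)
  obtain f' g' where d: "\<And>x. x \<in> S \<Longrightarrow> (f has_derivative f' x) (at x)"
      "\<And>v. Ck_on k (\<lambda>x. f' x v) S" "\<And>x. x \<in> S \<Longrightarrow> (g has_derivative g' x) (at x)"
      "\<And>v. Ck_on k (\<lambda>x. g' x v) S"
    using Ck_on_SucE[OF Suc.prems(1)] Ck_on_SucE[OF Suc.prems(2)] by metis
  have "((\<lambda>x. pr (f x) (g x)) has_derivative (\<lambda>v. pr (f x) (g' x v) + pr (f' x v) (g x))) (at x)"
    if "x \<in> S" for x
    using bounded_bilinear.FDERIV[OF assms d(1)[OF that] d(3)[OF that]] .
  moreover have "Ck_on k (\<lambda>x. pr (f x) (g' x v) + pr (f' x v) (g x)) S" for v
    using Suc.IH d(2,4) Suc.prems[THEN Ck_on_Suc_imp] by (intro Ck_on_add) auto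
  ultimately show ?case
    by (auto intro!: exI[of _ "\<lambda>x v. pr (f x) (g' x v) + pr (f' x v) (g x)"])
qed

lemma Ck_on_sum:
  assumes "\<And>i. i \<in> I \<Longrightarrow> Ck_on k (f i) S"
  shows "Ck_on k (\<lambda>x. \<Sum>i\<in>I. f i x) S"
  using assms by (induction I rule: infinite_finite_induct) (auto intro: Ck_on_const Ck_on_add)

section \<open>Orthonormal bases of the model spaces and the chain rule\<close>

definition onb :: "'a::real_inner set \<Rightarrow> bool" where
  "onb B \<longleftrightarrow> finite B \<and> (\<forall>x\<in>B. \<forall>y\<in>B. x \<bullet> y = (if x = y then 1 else 0)) \<and>
             (\<forall>x. x = (\<Sum>b\<in>B. (x \<bullet> b) *\<^sub>R b))"

lemma onb_finite: "onb B \<Longrightarrow> finite B"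
  and onb_expand: "onb B \<Longrightarrow> (\<Sum>b\<in>B. (x \<bullet> b) *\<^sub>R b) = x"
  and onb_inner: "onb B \<Longrightarrow> b \<in> B \<Longrightarrow> c \<in> B \<Longrightarrow> b \<bullet> c = (if b = c then 1 else 0)"
  unfolding onb_def by metis+

lemma onb_linear_expand:
  assumes "onb B" "linear L"
  shows "L v = (\<Sum>b\<in>B. (v \<bullet> b) *\<^sub>R L b)"
proof -
  have "L v = L (\<Sum>b\<in>B. (v \<bullet> b) *\<^sub>R b)" using onb_expand[OF assms(1)] by simp
  also have "\<dots> = (\<Sum>b\<in>B. (v \<bullet> b) *\<^sub>R L b)"
    by (simp add: linear_sum[OF assms(2)] linear_cmul[OF assms(2)])
  finally show ?thesis .
qed

text \<open>Gram-Schmidt, discarding vectors already in the span. \<open>C\<close> may be empty, so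
  zero-dimensional models are covered.\<close>

lemma orthonormal_span_extend:
  fixes B :: "'a::real_inner set"
  assumes "finite B"
  shows "\<exists>C. finite C \<and> (\<forall>x\<in>C. \<forall>y\<in>C. x \<bullet> y = (if x = y then 1 else 0)) \<and> B \<subseteq> span C"
  using assms
proof (induction B rule: finite_induct)
  case empty
  then show ?case by (intro exI[of _ "{}"]) auto
next
  case (insert b B)
  then obtain C where C: "finite C" "\<forall>x\<in>C. \<forall>y\<in>C. x \<bullet> y = (if x = y then 1 else 0)" "B \<subseteq> span C"
    by auto
  \<comment> \<open>The component of \<open>b\<close> orthogonal to \<open>C\<close>; if it
    vanishes, \<open>C\<close> already spans \<open>b\<close>.\<close>
  define d where "d = b - (\<Sum>c\<in>C. (b \<bullet> c) *\<^sub>R c)"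
  have bd: "b = d + (\<Sum>c\<in>C. (b \<bullet> c) *\<^sub>R c)" by (simp add: d_def)
  have sC: "(\<Sum>c\<in>C. (b \<bullet> c) *\<^sub>R c) \<in> span C"
    by (intro span_sum span_scale span_base)
  have dC: "d \<bullet> y = 0" if "y \<in> C" for y
  proof -
    have "(\<Sum>c\<in>C. (b \<bullet> c) * (c \<bullet> y)) = (\<Sum>c\<in>C. if c = y then b \<bullet> y else 0)"
      using C(2) that by (intro sum.cong) auto
    then show ?thesis using C(1) that
      by (simp add: d_def inner_diff_left inner_sum_left)
  qed
  show ?case
  proof (cases "d = 0")
    case True
    then show ?thesis using C sC bd by (intro exI[of _ C]) auto
  next
    case False
    define e where "e = d /\<^sub>R norm d"
    have "e \<bullet> e = inverse (norm d) * (inverse (norm d) * (norm d * norm d))"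
      by (simp add: e_def power2_norm_eq_inner[symmetric] power2_eq_square)
    then have ee: "e \<bullet> e = 1" using False by (simp add: divide_simps)
    have eC: "e \<bullet> y = 0" "y \<bullet> e = 0" if "y \<in> C" for y
      using dC[OF that] by (simp_all add: e_def inner_commute)
    have "d = norm d *\<^sub>R e" using False by (simp add: e_def)
    then have "d \<in> span (insert e C)" by (metis insertI1 span_base span_scale)
    moreover have "span C \<subseteq> span (insert e C)" by (intro span_mono) auto
    ultimately have "insert b B \<subseteq> span (insert e C)"
      using bd sC C(3) span_add by (metis insert_subset subset_iff)
    then show ?thesis using C ee eC
      by (intro exI[of _ "insert e C"]) auto
  qed
qed

lemma onb_exists:
  assumes "finite (B::'a::real_inner set)" "span B = UNIV"
  shows "\<exists>C::'a set. onb C"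
proof -
  obtain C where C: "finite C" "\<forall>x\<in>C. \<forall>y\<in>C. x \<bullet> y = (if x = y then 1 else 0)" "B \<subseteq> span C"
    using orthonormal_span_extend[OF assms(1)] by blast
  have "span C = UNIV" using C(3) assms(2) by (metis UNIV_eq_I UNIV_I span_minimal subspace_span subsetD)
  have "x = (\<Sum>b\<in>C. (x \<bullet> b) *\<^sub>R b)" for x
  proof -
    obtain u where u: "x = (\<Sum>c\<in>C. u c *\<^sub>R c)"
      using \<open>span C = UNIV\<close> span_finite[OF C(1)] by blast
    have "x \<bullet> b = u b" if "b \<in> C" for b
    proof -
      have "(\<Sum>c\<in>C. u c * (c \<bullet> b)) = (\<Sum>c\<in>C. if c = b then u b else 0)"
        using C(2) that by (intro sum.cong) auto
      then show ?thesis using C(1) that by (simp add: u inner_sum_left)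
    qed
    then show ?thesis using u by (metis (mono_tags, lifting) sum.cong)
  qed
  then show ?thesis using C unfolding onb_def by blast
qed

lemma onb_real: "onb {1::real}"
  by (auto simp: onb_def)

lemma onb_prod:
  assumes "onb B" "onb C"
  shows "onb ((\<lambda>b. (b, 0)) ` B \<union> (\<lambda>c. (0, c)) ` C)"
proof -
  \<comment> \<open>Orthonormal vectors have norm one, so \<open>0\<close> lies in neither basis and
    the two embedded copies cannot meet.\<close>
  have [simp]: "(0, 0) \<notin> (\<lambda>b. (b, 0)) ` B" "(0, 0) \<notin> (\<lambda>c. (0, c)) ` C"
    using onb_inner[OF assms(1), of 0 0] onb_inner[OF assms(2), of 0 0] by (auto split: if_splits)
  have fin: "finite B" "finite C" using assms onb_finite by auto
  have disj: "(\<lambda>b. (b, 0)) ` B \<inter> (\<lambda>c. (0, c)) ` C = {}"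
    using onb_inner[OF assms(1), of 0 0] by (auto split: if_splits)
  have "(\<Sum>b\<in>(\<lambda>b. (b, 0)) ` B \<union> (\<lambda>c. (0, c)) ` C. (x \<bullet> b) *\<^sub>R b) = x" for x :: "'a \<times> 'b"
  proof -
    have "(\<Sum>b\<in>(\<lambda>b. (b, 0)) ` B \<union> (\<lambda>c. (0, c)) ` C. (x \<bullet> b) *\<^sub>R b)
        = (\<Sum>b\<in>B. (x \<bullet> (b, 0)) *\<^sub>R (b, 0)) + (\<Sum>c\<in>C. (x \<bullet> (0, c)) *\<^sub>R (0, c))"
      using fin disj by (simp add: sum.union_disjoint sum.reindex inj_on_def)
    also have "\<dots> = (\<Sum>b\<in>B. ((fst x \<bullet> b) *\<^sub>R b, 0)) + (\<Sum>c\<in>C. (0, (snd x \<bullet> c) *\<^sub>R c))"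
      by (cases x) simp
    also have "\<dots> = x"
      by (simp add: sum_prod onb_expand[OF assms(1)] onb_expand[OF assms(2)])
    finally show ?thesis .
  qed
  then show ?thesis
    using fin disj onb_inner[OF assms(1)] onb_inner[OF assms(2)] unfolding onb_def
    by (auto split: if_splits)
qed

text \<open>The chain rule gives \<open>g' (f x) (f' x v)\<close>, whose direction varies with
  \<open>x\<close>, whereas \<open>Ck_on\<close> controls derivatives in fixed directions only.
  Expanding \<open>f' x v\<close> in an orthonormal basis reduces to fixed directions.\<close>

lemma Ck_on_compose:
  fixes f :: "'a::real_normed_vector \<Rightarrow> 'b::real_inner"
  assumes B: "onb (B::'b set)" and S: "open S"
  shows "Ck_on k g T \<Longrightarrow> Ck_on k f S \<Longrightarrow> f ` S \<subseteq> T \<Longrightarrow> Ck_on k (\<lambda>x. g (f x)) S"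
proof (induction k arbitrary: g)
  case 0
  then show ?case by (auto intro: continuous_on_compose2)
next
  case (Suc k)
  obtain f' g' where d: "\<And>x. x \<in> S \<Longrightarrow> (f has_derivative f' x) (at x)"
      "\<And>v. Ck_on k (\<lambda>x. f' x v) S" "\<And>x. x \<in> T \<Longrightarrow> (g has_derivative g' x) (at x)"
      "\<And>v. Ck_on k (\<lambda>x. g' x v) T"
    using Ck_on_SucE[OF Suc.prems(1)] Ck_on_SucE[OF Suc.prems(2)] by metis
  have "((\<lambda>x. g (f x)) has_derivative (\<lambda>v. g' (f x) (f' x v))) (at x)" if "x \<in> S" for x
    using has_derivative_compose d(1)[OF that] d(3)[of "f x"] Suc.prems(3) that by blast
  moreover have "Ck_on k (\<lambda>x. g' (f x) (f' x v)) S" for v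
  proof -
    have "Ck_on k (\<lambda>x. \<Sum>b\<in>B. (f' x v \<bullet> b) *\<^sub>R g' (f x) b) S"
      by (intro Ck_on_sum Ck_on_bilinear[OF bounded_bilinear_scaleR] Suc.IH d
          Ck_on_linear_compose[OF bounded_linear_inner_left] Suc.prems Ck_on_Suc_imp)
    moreover have "g' (f x) (f' x v) = (\<Sum>b\<in>B. (f' x v \<bullet> b) *\<^sub>R g' (f x) b)" if "x \<in> S" for x
      using onb_linear_expand[OF B] has_derivative_linear[OF d(3)] Suc.prems(3) that by blast
    ultimately show ?thesis by (subst Ck_on_cong[OF S]) auto
  qed
  ultimately show ?case
    by (auto intro!: exI[of _ "\<lambda>x v. g' (f x) (f' x v)"])
qed

section \<open>Smoothness of elementary functions\<close>

lemma Ck_on_real_inverse: "Ck_on k (inverse :: real \<Rightarrow> real) (- {0})"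
proof (induction k)
  case 0
  then show ?case by (auto intro!: continuous_intros)
next
  case (Suc k)
  \<comment> \<open>The derivative is built from \<open>inverse\<close> itself, so the product rule
    and the induction hypothesis suffice.\<close>
  have "(inverse has_derivative (\<lambda>v. - (inverse x * v * inverse x))) (at x)"
    if "x \<in> - {0}" for x :: real
    using has_derivative_inverse'[of x UNIV] that by simp
  moreover have "Ck_on k (\<lambda>x::real. - (inverse x * v * inverse x)) (- {0})" for v
  proof -
    have "Ck_on k (\<lambda>x::real. (- v) * (inverse x * inverse x)) (- {0})"
      by (intro Ck_on_bilinear[OF bounded_bilinear_mult] Ck_on_const Suc)
    then show ?thesis by (simp add: algebra_simps)
  qed
  ultimately show ?case by (auto intro!: exI[of _ "\<lambda>x v. - (inverse x * v * inverse x)"])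
qed

text \<open>Proved jointly because each derivative is a multiple of the other function.\<close>

lemma Ck_on_sin_cos: "Ck_on k (sin :: real \<Rightarrow> real) S \<and> Ck_on k (cos :: real \<Rightarrow> real) S"
proof (induction k)
  case 0
  then show ?case by (auto intro!: continuous_intros)
next
  case (Suc k)
  have "(sin has_derivative (\<lambda>v. cos x * v)) (at x)" "(cos has_derivative (\<lambda>v. - sin x * v)) (at x)"
    for x :: real
    using DERIV_sin[of x] DERIV_cos[of x] by (simp_all only: has_field_derivative_def)
  moreover have "Ck_on k (\<lambda>x::real. cos x * v) S" "Ck_on k (\<lambda>x::real. - sin x * v) S" for v
    using Suc Ck_on_linear_compose[OF bounded_linear_mult_left, of k cos S v]
      Ck_on_linear_compose[OF bounded_linear_mult_left, of k sin S "- v"] by auto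
  ultimately show ?case by fastforce
qed

text \<open>The derivative of \<open>t\<^sup>-\<^sup>n exp (- 1 / t)\<close> is a combination of functions of the same kind, which
  is why the exponent \<open>n\<close> is carried along.\<close>

definition flat_exp :: "nat \<Rightarrow> real \<Rightarrow> real" where
  "flat_exp n t = (if t > 0 then inverse t ^ n * exp (- inverse t) else 0)"

text \<open>In terms of \<open>1 / t\<close> this is the domination of powers by the exponential at
  infinity; left of 0 the function vanishes.\<close>

lemma flat_exp_tendsto_0: "(flat_exp n \<longlongrightarrow> 0) (at 0)"
proof -
  have "((\<lambda>t. inverse t ^ n / exp (inverse t)) \<longlongrightarrow> 0) (at_right (0::real))"
    using filterlim_compose[OF tendsto_power_div_exp_0 filterlim_inverse_at_top_right] .
  then have "(flat_exp n \<longlongrightarrow> 0) (at_right 0)"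
    by (rule tendsto_cong[THEN iffD1, rotated])
      (auto simp: flat_exp_def eventually_at_filter exp_minus divide_inverse)
  moreover have "(flat_exp n \<longlongrightarrow> 0) (at_left 0)"
    by (rule tendsto_eventually) (auto simp: flat_exp_def eventually_at_filter)
  ultimately show ?thesis by (rule filterlim_split_at[rotated])
qed

lemma flat_exp_deriv:
  "(flat_exp n has_real_derivative (flat_exp (n + 2) t - real n * flat_exp (n + 1) t)) (at t)"
proof -
  consider "t > 0" | "t < 0" | "t = 0" by linarith
  then show ?thesis
  proof cases
    case 1
    have "((\<lambda>t. inverse t ^ n * exp (- inverse t)) has_real_derivative
         (flat_exp (n + 2) t - real n * flat_exp (n + 1) t)) (at t)"
      using 1 by (auto intro!: derivative_eq_intros simp: flat_exp_def power2_eq_square)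
        (cases n; simp add: algebra_simps power_add)
    then show ?thesis
      by (rule has_field_derivative_transform_within_open[where S="{0<..}"])
        (use 1 in \<open>auto simp: flat_exp_def\<close>)
  next
    case 2
    have "((\<lambda>t. 0) has_real_derivative (flat_exp (n + 2) t - real n * flat_exp (n + 1) t)) (at t)"
      using 2 by (auto simp: flat_exp_def)
    then show ?thesis
      by (rule has_field_derivative_transform_within_open[where S="{..<0}"])
        (use 2 in \<open>auto simp: flat_exp_def\<close>)
  next
    case 3
    \<comment> \<open>The difference quotient of \<open>flat_exp n\<close> at 0 is
      \<open>flat_exp (Suc n)\<close>.\<close>
    have "((\<lambda>h. (flat_exp n h - flat_exp n 0) / (h - 0)) \<longlongrightarrow> 0) (at 0)"
      using flat_exp_tendsto_0[of "Suc n"]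
      by (rule tendsto_cong[THEN iffD1, rotated])
        (auto simp: flat_exp_def eventually_at_filter divide_inverse)
    then show ?thesis unfolding has_field_derivative_iff 3 by (simp add: flat_exp_def)
  qed
qed

lemma Ck_on_flat_exp: "Ck_on k (flat_exp n) S"
proof (induction k arbitrary: n)
  case 0
  show ?case using DERIV_continuous[OF flat_exp_deriv]
    by (auto intro!: continuous_at_imp_continuous_on)
next
  case (Suc k)
  have "Ck_on k (\<lambda>x. v * flat_exp (n + 2) x + (- (v * real n)) * flat_exp (n + 1) x) S" for v
    by (intro Ck_on_add Ck_on_linear_compose[OF bounded_linear_mult_right] Suc)
  then have "Ck_on k (\<lambda>x. (flat_exp (n + 2) x - real n * flat_exp (n + 1) x) * v) S" for v
    by (simp add: algebra_simps)
  moreover have "(flat_exp n has_derivative (\<lambda>v. (flat_exp (n + 2) x - real n * flat_exp (n + 1) x) * v)) (at x)" for x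
    using flat_exp_deriv[of n x] by (simp add: has_field_derivative_def)
  ultimately show ?case
    by (auto intro!: exI[of _ "\<lambda>x v. (flat_exp (n + 2) x - real n * flat_exp (n + 1) x) * v"])
qed

section \<open>Symmetry of second derivatives\<close>

lemma mixed_second_difference:
  fixes f :: "'a::real_normed_vector \<Rightarrow> real"
  assumes S: "open S" and ball: "ball x d \<subseteq> S" and s: "0 < s" "s * (norm u + norm v) < d"
    and f': "\<And>y. y \<in> S \<Longrightarrow> (f has_derivative f' y) (at y)"
    and H: "\<And>y. y \<in> S \<Longrightarrow> ((\<lambda>y. f' y u) has_derivative H y) (at y)"
  shows "\<exists>y\<in>ball x d. f (x + s *\<^sub>R u + s *\<^sub>R v) - f (x + s *\<^sub>R u) - f (x + s *\<^sub>R v) + f x = s * s * H y v"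
proof -
  have inb: "x + a *\<^sub>R u + b *\<^sub>R v \<in> ball x d" if "0 \<le> a" "a \<le> s" "0 \<le> b" "b \<le> s" for a b
  proof -
    have "norm (a *\<^sub>R u + b *\<^sub>R v) \<le> a * norm u + b * norm v"
      using that norm_triangle_ineq[of "a *\<^sub>R u" "b *\<^sub>R v"] by simp
    also have "\<dots> \<le> s * norm u + s * norm v"
      using that by (intro add_mono mult_right_mono) auto
    also have "\<dots> < d" using s by (simp add: algebra_simps)
    finally show ?thesis using norm_minus_cancel[of "a *\<^sub>R u + b *\<^sub>R v"] by (simp add: dist_norm)
  qed
  \<comment> \<open>First mean value theorem, in direction \<open>u\<close>, for the increment of
    \<open>f\<close> by \<open>s *\<^sub>R v\<close>. The summand \<open>0 *\<^sub>R v\<close> gives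
    both terms the same shape.\<close>
  define g where "g a = f (x + a *\<^sub>R u + s *\<^sub>R v) - f (x + a *\<^sub>R u + 0 *\<^sub>R v)" for a
  have "(g has_derivative (\<lambda>h. h * (f' (x + a *\<^sub>R u + s *\<^sub>R v) u - f' (x + a *\<^sub>R u + 0 *\<^sub>R v) u)))
      (at a within {0..s})" if "0 \<le> a" "a \<le> s" for a
  proof -
    have *: "((\<lambda>a. f (x + a *\<^sub>R u + b *\<^sub>R v)) has_derivative (\<lambda>h. f' (x + a *\<^sub>R u + b *\<^sub>R v) (h *\<^sub>R u)))
      (at a within {0..s})" if "0 \<le> b" "b \<le> s" for b
    proof (rule has_derivative_compose[where f="\<lambda>a. x + a *\<^sub>R u + b *\<^sub>R v" and g=f])
      show "((\<lambda>a. x + a *\<^sub>R u + b *\<^sub>R v) has_derivative (\<lambda>h. h *\<^sub>R u)) (at a within {0..s})"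
        by (auto intro!: derivative_eq_intros)
      show "(f has_derivative f' (x + a *\<^sub>R u + b *\<^sub>R v)) (at (x + a *\<^sub>R u + b *\<^sub>R v))"
        using f' inb ball that \<open>0 \<le> a\<close> \<open>a \<le> s\<close> by blast
    qed
    have lin: "linear (f' (x + a *\<^sub>R u + b *\<^sub>R v))" if "0 \<le> b" "b \<le> s" for b
      using f' inb ball that \<open>0 \<le> a\<close> \<open>a \<le> s\<close> has_derivative_linear by blast
    have "(g has_derivative (\<lambda>h. f' (x + a *\<^sub>R u + s *\<^sub>R v) (h *\<^sub>R u) - f' (x + a *\<^sub>R u + 0 *\<^sub>R v) (h *\<^sub>R u)))
      (at a within {0..s})"
      unfolding g_def using s(1) by (intro has_derivative_diff *) auto
    moreover have "(\<lambda>h. f' (x + a *\<^sub>R u + s *\<^sub>R v) (h *\<^sub>R u) - f' (x + a *\<^sub>R u + 0 *\<^sub>R v) (h *\<^sub>R u))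
       = (\<lambda>h. h * (f' (x + a *\<^sub>R u + s *\<^sub>R v) u - f' (x + a *\<^sub>R u + 0 *\<^sub>R v) u))"
      using lin[of s] lin[of 0] s(1) by (auto simp: linear_cmul right_diff_distrib)
    ultimately show ?thesis by simp
  qed
  then obtain a where a: "a \<in> {0<..<s}"
      "g s - g 0 = s * (f' (x + a *\<^sub>R u + s *\<^sub>R v) u - f' (x + a *\<^sub>R u + 0 *\<^sub>R v) u)"
    using mvt_simple[of 0 s g "\<lambda>a h. h * (f' (x + a *\<^sub>R u + s *\<^sub>R v) u - f' (x + a *\<^sub>R u + 0 *\<^sub>R v) u)"] s(1)
    by auto
  \<comment> \<open>Second mean value theorem, in direction \<open>v\<close>, for the derivative of
    \<open>f\<close> along \<open>u\<close>.\<close>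
  have "((\<lambda>b. f' (x + a *\<^sub>R u + b *\<^sub>R v) u) has_derivative (\<lambda>h. h * H (x + a *\<^sub>R u + b *\<^sub>R v) v))
      (at b within {0..s})" if "0 \<le> b" "b \<le> s" for b
  proof -
    have yS: "x + a *\<^sub>R u + b *\<^sub>R v \<in> S" using inb ball that a(1) by (simp add: subset_iff)
    have "((\<lambda>b. f' (x + a *\<^sub>R u + b *\<^sub>R v) u) has_derivative (\<lambda>h. H (x + a *\<^sub>R u + b *\<^sub>R v) (h *\<^sub>R v)))
      (at b within {0..s})"
    proof (rule has_derivative_compose[where f="\<lambda>b. x + a *\<^sub>R u + b *\<^sub>R v" and g="\<lambda>y. f' y u"])
      show "((\<lambda>b. x + a *\<^sub>R u + b *\<^sub>R v) has_derivative (\<lambda>h. h *\<^sub>R v)) (at b within {0..s})"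
        by (auto intro!: derivative_eq_intros)
    qed (rule H[OF yS])
    then show ?thesis using has_derivative_linear[OF H[OF yS]] by (simp add: linear_cmul)
  qed
  then obtain b where b: "b \<in> {0<..<s}"
     "f' (x + a *\<^sub>R u + s *\<^sub>R v) u - f' (x + a *\<^sub>R u + 0 *\<^sub>R v) u = s * H (x + a *\<^sub>R u + b *\<^sub>R v) v"
    using mvt_simple[of 0 s "\<lambda>b. f' (x + a *\<^sub>R u + b *\<^sub>R v) u" "\<lambda>b h. h * H (x + a *\<^sub>R u + b *\<^sub>R v) v"] s(1)
    by auto
  have "f (x + s *\<^sub>R u + s *\<^sub>R v) - f (x + s *\<^sub>R u) - f (x + s *\<^sub>R v) + f x = s * s * H (x + a *\<^sub>R u + b *\<^sub>R v) v"
    using a(2) b(2) by (simp add: g_def)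
  moreover have "x + a *\<^sub>R u + b *\<^sub>R v \<in> ball x d" using a b inb by auto
  ultimately show ?thesis by blast
qed

text \<open>Both sides are limits of the same second difference quotient.\<close>

lemma second_derivative_symmetric:
  fixes f :: "'a::real_normed_vector \<Rightarrow> real"
  assumes S: "open S" "x \<in> S"
    and f': "\<And>y. y \<in> S \<Longrightarrow> (f has_derivative f' y) (at y)"
    and Hu: "\<And>y. y \<in> S \<Longrightarrow> ((\<lambda>y. f' y u) has_derivative Hu y) (at y)"
    and Hv: "\<And>y. y \<in> S \<Longrightarrow> ((\<lambda>y. f' y v) has_derivative Hv y) (at y)"
    and cont: "continuous_on S (\<lambda>y. Hu y v)" "continuous_on S (\<lambda>y. Hv y u)"
  shows "Hu x v = Hv x u"
proof -
  have "\<not> 0 < \<bar>Hu x v - Hv x u\<bar> / 2"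
  proof
    \<comment> \<open>Half of the supposed gap. The equal numbers \<open>Hu y v\<close> and
      \<open>Hv z u\<close> will lie within \<open>\<epsilon>\<close> of its two ends.\<close>
    define \<epsilon> where \<epsilon>: "\<epsilon> = \<bar>Hu x v - Hv x u\<bar> / 2"
    assume "0 < \<bar>Hu x v - Hv x u\<bar> / 2"
    then have "0 < \<epsilon>" by (simp add: \<epsilon>)
    have "isCont (\<lambda>y. Hu y v) x" "isCont (\<lambda>y. Hv y u) x"
      using cont S continuous_on_eq_continuous_at by blast+
    then obtain d1 d2 where d1: "d1 > 0" "\<And>y. dist y x < d1 \<Longrightarrow> \<bar>Hu y v - Hu x v\<bar> < \<epsilon>"
      and d2: "d2 > 0" "\<And>y. dist y x < d2 \<Longrightarrow> \<bar>Hv y u - Hv x u\<bar> < \<epsilon>"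
      using \<open>0 < \<epsilon>\<close> unfolding continuous_at_eps_delta by (metis dist_real_def)
    obtain d3 where d3: "d3 > 0" "ball x d3 \<subseteq> S" using S open_contains_ball by blast
    define d where "d = min d1 (min d2 d3)"
    \<comment> \<open>The summand 1 keeps the denominator positive when \<open>u\<close> and
      \<open>v\<close> are both zero.\<close>
    define s where "s = d / (norm u + norm v + 1) / 2"
    have "d > 0" using d1 d2 d3 by (simp add: d_def)
    have s: "0 < s" "s * (norm u + norm v) < d"
      using \<open>d > 0\<close> norm_ge_zero[of u] norm_ge_zero[of v]
      by (auto simp: s_def divide_simps add_pos_nonneg add_nonneg_pos)
    have ball: "ball x d \<subseteq> S" using d3 by (auto simp: d_def)
    obtain y where y: "y \<in> ball x d"
      "f (x + s *\<^sub>R u + s *\<^sub>R v) - f (x + s *\<^sub>R u) - f (x + s *\<^sub>R v) + f x = s * s * Hu y v"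
      using mixed_second_difference[OF S(1) ball s f' Hu] by blast
    have "s * (norm v + norm u) < d" using s by (simp add: add.commute)
    then obtain z where z: "z \<in> ball x d"
      "f (x + s *\<^sub>R v + s *\<^sub>R u) - f (x + s *\<^sub>R v) - f (x + s *\<^sub>R u) + f x = s * s * Hv z u"
      using mixed_second_difference[OF S(1) ball s(1) _ f' Hv] by blast
    have "s * s * Hu y v = s * s * Hv z u" using y(2) z(2) by (simp add: algebra_simps)
    then have "Hu y v = Hv z u" using s(1) by simp
    moreover have "\<bar>Hu y v - Hu x v\<bar> < \<epsilon>" "\<bar>Hv z u - Hv x u\<bar> < \<epsilon>"
      using d1(2)[of y] d2(2)[of z] y(1) z(1) by (auto simp: d_def dist_commute)
    ultimately show False using \<epsilon> by (simp add: abs_if split: if_splits)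
  qed
  then show ?thesis by auto
qed

section \<open>Transfer of the calculus to infinite order\<close>

lemma smooth_on_subset: "smooth_on f S \<Longrightarrow> T \<subseteq> S \<Longrightarrow> smooth_on f T"
  unfolding smooth_on_def using Ck_on_subset by blast

lemma smooth_on_cong:
  "open S \<Longrightarrow> (\<And>x. x \<in> S \<Longrightarrow> f x = g x) \<Longrightarrow> smooth_on f S \<longleftrightarrow> smooth_on g S"
  unfolding smooth_on_def using Ck_on_cong by blast

lemma smooth_on_eq:
  assumes "open S" "smooth_on f S" "\<And>x. x \<in> S \<Longrightarrow> f x = g x"
  shows "smooth_on g S"
  using smooth_on_cong[OF assms(1), of f g] assms(2,3) by simp

lemma smooth_on_local:
  "open S \<Longrightarrow> (\<And>x. x \<in> S \<Longrightarrow> \<exists>T. open T \<and> x \<in> T \<and> T \<subseteq> S \<and> smooth_on f T) \<Longrightarrow> smooth_on f S"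
  unfolding smooth_on_def using Ck_on_local by metis

lemma smooth_on_const: "smooth_on (\<lambda>x. c) S"
  and smooth_on_id: "smooth_on (\<lambda>x. x) S"
  and smooth_on_sin: "smooth_on (sin :: real \<Rightarrow> real) R"
  and smooth_on_real_inverse: "smooth_on (inverse :: real \<Rightarrow> real) (- {0})"
  and smooth_on_flat_exp: "smooth_on (flat_exp n) R"
  unfolding smooth_on_def
  using Ck_on_const Ck_on_id Ck_on_sin_cos Ck_on_real_inverse Ck_on_flat_exp by blast+

lemma smooth_on_linear_compose:
  "bounded_linear L \<Longrightarrow> smooth_on f S \<Longrightarrow> smooth_on (\<lambda>x. L (f x)) S"
  unfolding smooth_on_def using Ck_on_linear_compose by blast

lemma smooth_on_bounded_linear: "bounded_linear L \<Longrightarrow> smooth_on L S"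
  using smooth_on_linear_compose[OF _ smooth_on_id] .

lemma smooth_on_add: "smooth_on f S \<Longrightarrow> smooth_on g S \<Longrightarrow> smooth_on (\<lambda>x. f x + g x) S"
  unfolding smooth_on_def using Ck_on_add by blast

lemma smooth_on_bilinear:
  "bounded_bilinear pr \<Longrightarrow> smooth_on f S \<Longrightarrow> smooth_on g S \<Longrightarrow> smooth_on (\<lambda>x. pr (f x) (g x)) S"
  unfolding smooth_on_def using Ck_on_bilinear by blast

lemmas smooth_on_mult = smooth_on_bilinear[OF bounded_bilinear_mult]
  and smooth_on_scaleR = smooth_on_bilinear[OF bounded_bilinear_scaleR]
  and smooth_on_inner = smooth_on_bilinear[OF bounded_bilinear_inner]

lemma smooth_on_diff:
  assumes "smooth_on f S" "smooth_on g S"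
  shows "smooth_on (\<lambda>x. f x - g x) S"
  using smooth_on_add[OF assms(1) smooth_on_linear_compose[OF bounded_linear_minus[OF bounded_linear_ident] assms(2)]]
  by simp

lemma smooth_on_compose:
  "onb (B::'b::real_inner set) \<Longrightarrow> open S \<Longrightarrow> smooth_on g T \<Longrightarrow> smooth_on (f::_ \<Rightarrow> 'b) S \<Longrightarrow> f ` S \<subseteq> T
    \<Longrightarrow> smooth_on (\<lambda>x. g (f x)) S"
  unfolding smooth_on_def using Ck_on_compose by blast

lemma smooth_on_Pair:
  assumes "smooth_on f S" "smooth_on g S"
  shows "smooth_on (\<lambda>x. (f x, g x)) S"
proof -
  have "smooth_on (\<lambda>x. (f x, 0) + (0, g x)) S"
    by (intro smooth_on_add smooth_on_linear_compose[OF _ assms(1)]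
        smooth_on_linear_compose[OF _ assms(2)] bounded_linear_Pair bounded_linear_ident bounded_linear_zero)
  then show ?thesis by simp
qed

lemma smooth_on_imp_continuous_on: "smooth_on f S \<Longrightarrow> continuous_on S f"
  unfolding smooth_on_def by (metis Ck_on.simps(1))

lemma smooth_on_has_derivative:
  assumes "smooth_on f S" "x \<in> S"
  shows "(f has_derivative frechet_derivative f (at x)) (at x)"
proof -
  have "Ck_on (Suc 0) f S" using assms(1) by (simp only: smooth_on_def)
  then show ?thesis using assms(2) frechet_derivative_at by (metis Ck_on.simps(2))
qed

lemma smooth_on_frechet_derivative:
  "smooth_on f S \<Longrightarrow> open S \<Longrightarrow> smooth_on (\<lambda>x. frechet_derivative f (at x) v) S"
  unfolding smooth_on_def using Ck_on_Suc_iff by blast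

lemma smooth_on_second_derivative_symmetric:
  fixes f :: "'a::real_normed_vector \<Rightarrow> real"
  assumes "smooth_on f S" "open S" "x \<in> S"
  shows "frechet_derivative (\<lambda>y. frechet_derivative f (at y) u) (at x) v
       = frechet_derivative (\<lambda>y. frechet_derivative f (at y) v) (at x) u"
proof -
  note d = smooth_on_frechet_derivative[OF _ assms(2)]
  show ?thesis
    using second_derivative_symmetric[OF assms(2,3) smooth_on_has_derivative[OF assms(1)]
        smooth_on_has_derivative[OF d[OF assms(1)]] smooth_on_has_derivative[OF d[OF assms(1)]]
        smooth_on_imp_continuous_on[OF d[OF d[OF assms(1)]]] smooth_on_imp_continuous_on[OF d[OF d[OF assms(1)]]]]
    by simp
qed

section \<open>Bump functions and compactness of balls\<close>

lemma bump_function_exists: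
  fixes p :: "'a::real_inner"
  assumes "0 < r"
  shows "\<exists>\<beta>::'a \<Rightarrow> real. smooth_on \<beta> UNIV \<and> (\<forall>x\<in>ball p (r / 2). \<beta> x = 1) \<and> (\<forall>x. x \<notin> ball p r \<longrightarrow> \<beta> x = 0)"
proof -
  \<comment> \<open>\<open>a\<close> is positive exactly inside the ball of radius \<open>r\<close>,
    and \<open>b\<close> exactly outside the closed ball of radius \<open>r / 2\<close>. At every
    point one of them is positive, so the denominator in \<open>\<beta>\<close> does not vanish.
    Squared distances keep both smooth at the centre.\<close>
  define a b where "a x = r\<^sup>2 - (x - p) \<bullet> (x - p)" and "b x = (x - p) \<bullet> (x - p) - (r / 2)\<^sup>2" for x
  define h where "h = flat_exp 0"
  define \<beta> where "\<beta> x = h (a x) * inverse (h (a x) + h (b x))" for x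
  have sq: "(x - p) \<bullet> (x - p) = (dist p x)\<^sup>2" for x
    by (metis dist_commute dist_norm power2_norm_eq_inner)
  have h: "h t \<ge> 0" "h t > 0 \<longleftrightarrow> t > 0" for t by (auto simp: h_def flat_exp_def)
  have "(r / 2)\<^sup>2 < r\<^sup>2" using assms by (simp add: power2_eq_square)
  then have "a x > 0 \<or> b x > 0" for x unfolding a_def b_def by linarith
  then have pos: "h (a x) + h (b x) > 0" for x
    using h by (metis add_nonneg_pos add_pos_nonneg)
  have sa: "smooth_on a UNIV" "smooth_on b UNIV"
    unfolding a_def b_def by (intro smooth_on_diff smooth_on_inner smooth_on_const smooth_on_id)+
  have sh: "smooth_on (\<lambda>x. h (a x)) UNIV" "smooth_on (\<lambda>x. h (b x)) UNIV"
    unfolding h_def by (intro smooth_on_compose[OF onb_real _ smooth_on_flat_exp[where R=UNIV]] sa; simp)+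
  have "smooth_on \<beta> UNIV" unfolding \<beta>_def
    by (intro smooth_on_mult sh smooth_on_compose[OF onb_real _ smooth_on_real_inverse] smooth_on_add)
      (use pos in \<open>auto simp: less_imp_neq[symmetric]\<close>)
  moreover have "\<beta> x = 1" if "x \<in> ball p (r / 2)" for x
  proof -
    have "(dist p x)\<^sup>2 < (r / 2)\<^sup>2" using that assms by (intro power_strict_mono) auto
    then have "h (b x) = 0" using h[of "b x"] by (simp add: b_def sq)
    then show ?thesis using pos[of x] by (simp add: \<beta>_def)
  qed
  moreover have "\<beta> x = 0" if "x \<notin> ball p r" for x
  proof -
    have "(dist p x)\<^sup>2 \<ge> r\<^sup>2" using that assms by (intro power_mono) auto
    then have "h (a x) = 0" using h[of "a x"] by (simp add: a_def sq)
    then show ?thesis by (simp add: \<beta>_def)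
  qed
  ultimately show ?thesis by blast
qed

text \<open>Coordinates with respect to the basis are bounded by the norm, so a ball about the
  origin is a closed subset of a cube of linear combinations. The cube is compact by induction over
  the basis, one interval factor at a time.\<close>

lemma onb_compact_cball:
  fixes p :: "'a::real_inner"
  assumes "onb (B::'a set)"
  shows "compact (cball p r)"
proof -
  have "compact {\<Sum>b\<in>C. u b *\<^sub>R b |u. \<forall>b\<in>C. \<bar>u b\<bar> \<le> r}" if "finite C" for C :: "'a set"
    using that
  proof (induction C rule: finite_induct)
    case (insert c C)
    let ?K = "{\<Sum>b\<in>C. u b *\<^sub>R b |u. \<forall>b\<in>C. \<bar>u b\<bar> \<le> r}"
    have "{\<Sum>b\<in>insert c C. u b *\<^sub>R b |u. \<forall>b\<in>insert c C. \<bar>u b\<bar> \<le> r}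
        = (\<lambda>(t, x). t *\<^sub>R c + x) ` ({-r..r} \<times> ?K)" (is "?L = ?R")
    proof
      show "?L \<subseteq> ?R" using insert.hyps by fastforce
      show "?R \<subseteq> ?L"
      proof clarify
        fix t u assume *: "t \<in> {-r..r}" "\<forall>b\<in>C. \<bar>u b\<bar> \<le> r"
        have "(\<Sum>b\<in>C. (u(c := t)) b *\<^sub>R b) = (\<Sum>b\<in>C. u b *\<^sub>R b)"
          using insert.hyps by (intro sum.cong) auto
        then have "t *\<^sub>R c + (\<Sum>b\<in>C. u b *\<^sub>R b) = (\<Sum>b\<in>insert c C. (u(c := t)) b *\<^sub>R b)"
          using insert.hyps by simp
        moreover have "\<forall>b\<in>insert c C. \<bar>(u(c := t)) b\<bar> \<le> r" using * by auto
        ultimately show "\<exists>v. t *\<^sub>R c + (\<Sum>b\<in>C. u b *\<^sub>R b) = (\<Sum>b\<in>insert c C. v b *\<^sub>R b) \<and>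
            (\<forall>b\<in>insert c C. \<bar>v b\<bar> \<le> r)" by blast
      qed
    qed
    moreover have "compact ((\<lambda>(t, x). t *\<^sub>R c + x) ` ({-r..r} \<times> ?K))"
      unfolding case_prod_unfold
      by (intro compact_continuous_image continuous_intros compact_Times insert.IH compact_Icc)
    ultimately show ?case by simp
  qed simp
  then have K: "compact {\<Sum>b\<in>B. u b *\<^sub>R b |u. \<forall>b\<in>B. \<bar>u b\<bar> \<le> r}" using onb_finite[OF assms] by blast
  have "cball 0 r \<subseteq> {\<Sum>b\<in>B. u b *\<^sub>R b |u. \<forall>b\<in>B. \<bar>u b\<bar> \<le> r}"
  proof
    fix x :: 'a assume x: "x \<in> cball 0 r"
    have "\<bar>x \<bullet> b\<bar> \<le> r" if "b \<in> B" for b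
    proof -
      have "norm b = 1" using onb_inner[OF assms that that] by (simp add: norm_eq_sqrt_inner)
      then show ?thesis using Cauchy_Schwarz_ineq2[of x b] x by simp
    qed
    then show "x \<in> {\<Sum>b\<in>B. u b *\<^sub>R b |u. \<forall>b\<in>B. \<bar>u b\<bar> \<le> r}" using onb_expand[OF assms, of x] by force
  qed
  then have "compact (cball (0::'a) r)"
    using compact_Int_closed[OF K closed_cball[of 0 r]] by (simp add: Int_absorb1)
  then have "compact ((+) p ` cball 0 r)" by (intro compact_continuous_image continuous_intros)
  then show ?thesis by simp
qed

section \<open>Coordinates on manifolds\<close>

text \<open>Unlike \<^const>\<open>smooth_manifold\<close>, this makes sense without any assumption on the topology of
  the model space, so that it also applies to \<^const>\<open>vector_space_atlas\<close>.\<close>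

definition compatible_atlas :: "('a::topological_space, 'b::real_inner) atlas \<Rightarrow> bool" where
  "compatible_atlas A \<longleftrightarrow> (\<exists>B::'b set. onb B) \<and> (\<forall>p. \<exists>(U, \<phi>)\<in>A. p \<in> U) \<and>
     (\<forall>(U, \<phi>)\<in>A. open U \<and> open (\<phi> ` U) \<and> inj_on \<phi> U \<and> continuous_on U \<phi> \<and>
        continuous_on (\<phi> ` U) (inv_into U \<phi>)) \<and>
     (\<forall>(U, \<phi>)\<in>A. \<forall>(V, \<psi>)\<in>A. smooth_on (\<psi> \<circ> inv_into U \<phi>) (\<phi> ` (U \<inter> V)))"

lemma smooth_manifold_compatible:
  fixes A :: "('a::{t2_space,second_countable_topology}, 'b::real_inner) atlas"
  assumes "smooth_manifold A"
  shows "compatible_atlas A"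
proof -
  have A: "smooth_atlas UNIV A" using assms by (simp add: smooth_manifold_def)
  have "open U \<and> open (\<phi> ` U) \<and> inj_on \<phi> U \<and> continuous_on U \<phi> \<and> continuous_on (\<phi> ` U) (inv_into U \<phi>)"
    if "(U, \<phi>) \<in> A" for U \<phi>
  proof -
    have h: "homeomorphism U (\<phi> ` U) \<phi> (inv_into U \<phi>)" "open (\<phi> ` U)" "open U"
      using A that unfolding smooth_atlas_def by auto
    then have "inj_on \<phi> U" by (metis homeomorphism_def inj_on_inverseI)
    then show ?thesis using h by (simp add: homeomorphism_def)
  qed
  moreover have "\<exists>(U, \<phi>)\<in>A. p \<in> U" for p
  proof -
    have "\<Union> (fst ` A) = UNIV" using A by (simp add: smooth_atlas_def)
    then obtain c where "c \<in> A" "p \<in> fst c" by blast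
    then show ?thesis by (cases c) auto
  qed
  moreover have "\<exists>B::'b set. onb B"
  proof -
    have "\<exists>B::'b set. finite B \<and> span B = UNIV" using A by (simp add: smooth_atlas_def)
    then show ?thesis using onb_exists by blast
  qed
  moreover have "smooth_on (\<psi> \<circ> inv_into U \<phi>) (\<phi> ` (U \<inter> V))" if "(U, \<phi>) \<in> A" "(V, \<psi>) \<in> A" for U \<phi> V \<psi>
  proof -
    have "\<forall>(U, \<phi>)\<in>A. \<forall>(V, \<psi>)\<in>A. smooth_on (\<psi> \<circ> inv_into U \<phi>) (\<phi> ` (U \<inter> V))"
      using A by (simp add: smooth_atlas_def)
    then show ?thesis using that by fast
  qed
  ultimately show ?thesis unfolding compatible_atlas_def by auto
qed

lemma compatible_atlas_onb:
  fixes A :: "('a::topological_space, 'b::real_inner) atlas"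
  assumes "compatible_atlas A" obtains B :: "'b set" where "onb B"
  using assms unfolding compatible_atlas_def by blast

lemma chart_at:
  assumes "compatible_atlas A" obtains U \<phi> where "(U, \<phi>) \<in> A" "p \<in> U"
  using assms unfolding compatible_atlas_def by blast

lemma chartD:
  assumes "compatible_atlas A" "(U, \<phi>) \<in> A"
  shows "open U" "open (\<phi> ` U)" "inj_on \<phi> U" "continuous_on U \<phi>" "continuous_on (\<phi> ` U) (inv_into U \<phi>)"
  using assms unfolding compatible_atlas_def by auto

lemma transition_smooth:
  assumes "compatible_atlas A" "(U, \<phi>) \<in> A" "(V, \<psi>) \<in> A"
  shows "smooth_on (\<psi> \<circ> inv_into U \<phi>) (\<phi> ` (U \<inter> V))"
  using assms unfolding compatible_atlas_def by auto

text \<open>The image is the preimage of \<open>S\<close> under the inverse map, hence open because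
  the full image of \<open>U\<close> is.\<close>

lemma open_image_of_continuous_inverse:
  assumes "open (\<phi> ` U)" "inj_on \<phi> U" "continuous_on (\<phi> ` U) (inv_into U \<phi>)" "open S"
  shows "open (\<phi> ` (U \<inter> S))"
proof -
  have "\<phi> ` (U \<inter> S) = inv_into U \<phi> -` S \<inter> \<phi> ` U"
    using assms(2) by auto
  then show ?thesis
    using continuous_on_open_vimage[OF assms(1)] assms(3,4) by (metis Int_commute)
qed

lemma chart_image_open:
  assumes "compatible_atlas A" "(U, \<phi>) \<in> A" "open S"
  shows "open (\<phi> ` (U \<inter> S))"
  using open_image_of_continuous_inverse chartD[OF assms(1,2)] assms(3) by blast

lemma vector_space_atlas_compatible:
  assumes "onb (B::'v::real_inner set)"
  shows "compatible_atlas (vector_space_atlas :: ('v, 'v) atlas)"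
proof -
  have "inv (\<lambda>x::'v. x) = (\<lambda>x. x)" using inv_id unfolding id_def .
  then show ?thesis using assms
    by (auto simp: compatible_atlas_def vector_space_atlas_def comp_def
        intro: continuous_on_id smooth_on_id)
qed

section \<open>Smooth maps in terms of charts\<close>

lemma smooth_map_on_vector_space_atlas_iff:
  "smooth_map_on A vector_space_atlas S f \<longleftrightarrow>
     continuous_on S f \<and> (\<forall>U \<phi>. (U, \<phi>) \<in> A \<longrightarrow> smooth_on (\<lambda>x. f (inv_into U \<phi> x)) (\<phi> ` (U \<inter> S)))"
  by (auto simp: smooth_map_on_def vector_space_atlas_def comp_def)

lemma smooth_map_on_vector_spaces_iff:
  "smooth_map_on vector_space_atlas vector_space_atlas S f \<longleftrightarrow> smooth_on f S"
proof -
  have "inv (\<lambda>x::'a. x) = (\<lambda>x. x)" using inv_id unfolding id_def .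
  then show ?thesis
    by (auto simp: smooth_map_on_def vector_space_atlas_def comp_def smooth_on_imp_continuous_on)
qed

lemma smooth_map_on_subset:
  "smooth_map_on A B S f \<Longrightarrow> T \<subseteq> S \<Longrightarrow> smooth_map_on A B T f"
  unfolding smooth_map_on_def
  by (auto intro: continuous_on_subset intro!: smooth_on_subset[where T="_ ` (_ \<inter> T \<inter> _)"])

lemma smooth_map_on_continuous: "smooth_map_on A B S f \<Longrightarrow> continuous_on S f"
  by (simp add: smooth_map_on_def)

lemma chart_overlap_open:
  assumes "compatible_atlas A" "(U, \<phi>) \<in> A" "open S" "continuous_on S f" "open V"
  shows "open (\<phi> ` (U \<inter> S \<inter> f -` V))"
proof -
  have "open (S \<inter> f -` V)"
    using continuous_on_open_vimage[OF assms(3)] assms(4,5) by (metis Int_commute)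
  then show ?thesis using chart_image_open[OF assms(1,2)] by (simp add: Int_assoc)
qed

lemma smooth_map_on_local:
  assumes A: "compatible_atlas (A :: ('a::t2_space, 'v::real_inner) atlas)" and B: "compatible_atlas B" and S: "open S"
    and loc: "\<And>p. p \<in> S \<Longrightarrow> \<exists>T. open T \<and> p \<in> T \<and> T \<subseteq> S \<and> smooth_map_on A B T f"
  shows "smooth_map_on A B S f"
proof -
  have "isCont f p" if "p \<in> S" for p
    using loc[OF that] by (metis continuous_on_eq_continuous_at smooth_map_on_continuous)
  then have cont: "continuous_on S f" by (simp add: continuous_at_imp_continuous_on)
  moreover have "smooth_on (\<psi> \<circ> f \<circ> inv_into U \<phi>) (\<phi> ` (U \<inter> S \<inter> f -` V))"
    if c: "(U, \<phi>) \<in> A" "(V, \<psi>) \<in> B" for U \<phi> V \<psi>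
  proof (rule smooth_on_local)
    note V = chartD(1)[OF B c(2)]
    show "open (\<phi> ` (U \<inter> S \<inter> f -` V))" by (rule chart_overlap_open[OF A c(1) S cont V])
    fix x assume "x \<in> \<phi> ` (U \<inter> S \<inter> f -` V)"
    then obtain p where p: "x = \<phi> p" "p \<in> U" "p \<in> S" "f p \<in> V" by auto
    obtain T where T: "open T" "p \<in> T" "T \<subseteq> S" "smooth_map_on A B T f" using loc[OF p(3)] by auto
    have "open (\<phi> ` (U \<inter> T \<inter> f -` V))"
      using chart_overlap_open[OF A c(1) T(1) _ V] T(4) smooth_map_on_continuous by blast
    moreover have "smooth_on (\<psi> \<circ> f \<circ> inv_into U \<phi>) (\<phi> ` (U \<inter> T \<inter> f -` V))"
      using T(4) c unfolding smooth_map_on_def by auto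
    ultimately show "\<exists>T'. open T' \<and> x \<in> T' \<and> T' \<subseteq> \<phi> ` (U \<inter> S \<inter> f -` V) \<and>
        smooth_on (\<psi> \<circ> f \<circ> inv_into U \<phi>) T'"
      using T p by (intro exI[of _ "\<phi> ` (U \<inter> T \<inter> f -` V)"]) blast
  qed
  ultimately show ?thesis unfolding smooth_map_on_def by auto
qed

lemma smooth_map_on_cong:
  assumes A: "compatible_atlas A" and B: "compatible_atlas B" and S: "open S"
    and fg: "\<And>p. p \<in> S \<Longrightarrow> f p = g p" and f: "smooth_map_on A B S f"
  shows "smooth_map_on A B S g"
proof -
  have cont: "continuous_on S f" using f by (rule smooth_map_on_continuous)
  then have "continuous_on S g" using fg by (simp cong: continuous_on_cong)
  moreover have "smooth_on (\<psi> \<circ> g \<circ> inv_into U \<phi>) (\<phi> ` (U \<inter> S \<inter> g -` V))"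
    if c: "(U, \<phi>) \<in> A" "(V, \<psi>) \<in> B" for U \<phi> V \<psi>
  proof -
    have "U \<inter> S \<inter> g -` V = U \<inter> S \<inter> f -` V" using fg by auto
    moreover have "smooth_on (\<psi> \<circ> f \<circ> inv_into U \<phi>) (\<phi> ` (U \<inter> S \<inter> f -` V))"
      using f c unfolding smooth_map_on_def by auto
    moreover have "open (\<phi> ` (U \<inter> S \<inter> f -` V))"
      by (rule chart_overlap_open[OF A c(1) S cont chartD(1)[OF B c(2)]])
    moreover have "(\<psi> \<circ> f \<circ> inv_into U \<phi>) x = (\<psi> \<circ> g \<circ> inv_into U \<phi>) x"
      if "x \<in> \<phi> ` (U \<inter> S \<inter> f -` V)" for x
      using that fg chartD(3)[OF A c(1)] by (auto simp: inv_into_f_f)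
    ultimately show ?thesis using smooth_on_cong by metis
  qed
  ultimately show ?thesis unfolding smooth_map_on_def by auto
qed

text \<open>A chart around \<open>f p\<close> factors the representative of the composite near
  \<open>p\<close> into representatives of \<open>f\<close> and \<open>g\<close>. A single such
  chart covers only part of the domain, so the argument is local.\<close>

lemma smooth_map_on_compose:
  assumes A: "compatible_atlas A" and B: "compatible_atlas (B :: ('b::topological_space, 'v::real_inner) atlas)"
    and C: "compatible_atlas C"
    and S: "open S" and T: "open T" and f: "smooth_map_on A B S f" and g: "smooth_map_on B C T g"
    and fS: "f ` S \<subseteq> T"
  shows "smooth_map_on A C S (\<lambda>x. g (f x))"
proof -
  have cf: "continuous_on S f" and cg: "continuous_on T g"
    using f g smooth_map_on_continuous by auto
  have cgf: "continuous_on S (\<lambda>x. g (f x))" using cg cf fS by (rule continuous_on_compose2)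
  moreover have "smooth_on (\<omega> \<circ> (\<lambda>x. g (f x)) \<circ> inv_into U \<phi>) (\<phi> ` (U \<inter> S \<inter> (\<lambda>x. g (f x)) -` W))"
    if c: "(U, \<phi>) \<in> A" "(W, \<omega>) \<in> C" for U \<phi> W \<omega>
  proof (rule smooth_on_local)
    note W = chartD(1)[OF C c(2)]
    show "open (\<phi> ` (U \<inter> S \<inter> (\<lambda>x. g (f x)) -` W))" by (rule chart_overlap_open[OF A c(1) S cgf W])
    fix x assume "x \<in> \<phi> ` (U \<inter> S \<inter> (\<lambda>x. g (f x)) -` W)"
    then obtain p where p: "x = \<phi> p" "p \<in> U" "p \<in> S" "g (f p) \<in> W" by auto
    obtain V \<psi> where V: "(V, \<psi>) \<in> B" "f p \<in> V" using chart_at[OF B] by blast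
    obtain D :: "'v set" where D: "onb D" using compatible_atlas_onb[OF B] .
    have "open (S \<inter> f -` V)"
      using continuous_on_open_vimage[OF S] cf chartD(1)[OF B V(1)] by (metis Int_commute)
    then have oN: "open (\<phi> ` (U \<inter> (S \<inter> f -` V) \<inter> (\<lambda>x. g (f x)) -` W))" (is "open ?N")
      by (intro chart_overlap_open[OF A c(1) _ _ W] continuous_on_subset[OF cgf]) auto
    have "smooth_on (\<psi> \<circ> f \<circ> inv_into U \<phi>) ?N"
      using f c V unfolding smooth_map_on_def by (fastforce intro: smooth_on_subset)
    moreover have "smooth_on (\<omega> \<circ> g \<circ> inv_into V \<psi>) (\<psi> ` (V \<inter> T \<inter> g -` W))"
      using g c V unfolding smooth_map_on_def by auto
    moreover have "(\<psi> \<circ> f \<circ> inv_into U \<phi>) ` ?N \<subseteq> \<psi> ` (V \<inter> T \<inter> g -` W)"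
      using fS chartD(3)[OF A c(1)] by (auto simp: inv_into_f_f)
    ultimately have *: "smooth_on (\<lambda>x. (\<omega> \<circ> g \<circ> inv_into V \<psi>) ((\<psi> \<circ> f \<circ> inv_into U \<phi>) x)) ?N"
      using smooth_on_compose[OF D oN] by blast
    have "smooth_on (\<lambda>x. (\<omega> \<circ> g \<circ> inv_into V \<psi>) ((\<psi> \<circ> f \<circ> inv_into U \<phi>) x)) ?N
        = smooth_on (\<omega> \<circ> (\<lambda>x. g (f x)) \<circ> inv_into U \<phi>) ?N"
    proof (intro smooth_on_cong[OF oN])
      fix x assume "x \<in> ?N"
      then show "(\<omega> \<circ> g \<circ> inv_into V \<psi>) ((\<psi> \<circ> f \<circ> inv_into U \<phi>) x)
        = (\<omega> \<circ> (\<lambda>x. g (f x)) \<circ> inv_into U \<phi>) x"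
        using chartD(3)[OF A c(1)] chartD(3)[OF B V(1)] by (auto simp: inv_into_f_f)
    qed
    with * have "smooth_on (\<omega> \<circ> (\<lambda>x. g (f x)) \<circ> inv_into U \<phi>) ?N" by simp
    then show "\<exists>T'. open T' \<and> x \<in> T' \<and> T' \<subseteq> \<phi> ` (U \<inter> S \<inter> (\<lambda>x. g (f x)) -` W) \<and>
        smooth_on (\<omega> \<circ> (\<lambda>x. g (f x)) \<circ> inv_into U \<phi>) T'"
      using oN p V by (intro exI[of _ ?N]) blast
  qed
  ultimately show ?thesis unfolding smooth_map_on_def by auto
qed

section \<open>Smooth functions with values in a vector space\<close>

abbreviation smooth_fun_on ::
  "('a::topological_space, 'b::real_inner) atlas \<Rightarrow> 'a set \<Rightarrow> ('a \<Rightarrow> 'v::real_inner) \<Rightarrow> bool" where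
  "smooth_fun_on A S f \<equiv> smooth_map_on A vector_space_atlas S f"

text \<open>The continuity clause of \<open>smooth_map_on\<close> is recovered from the charts: near
  a point \<open>f\<close> is its continuous representative after the continuous chart.\<close>

lemma smooth_fun_on_from_charts:
  assumes A: "compatible_atlas (A :: ('a::t2_space, 'b::real_inner) atlas)" and S: "open S"
    and f: "\<And>U \<phi>. (U, \<phi>) \<in> A \<Longrightarrow> smooth_on (\<lambda>x. f (inv_into U \<phi> x)) (\<phi> ` (U \<inter> S))"
  shows "smooth_fun_on A S f"
proof -
  have "isCont f p" if "p \<in> S" for p
  proof -
    obtain U \<phi> where U: "(U, \<phi>) \<in> A" "p \<in> U" using chart_at[OF A] by blast
    note c = chartD[OF A U(1)]
    have "continuous_on (U \<inter> S) (\<lambda>q. f (inv_into U \<phi> (\<phi> q)))"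
      by (rule continuous_on_compose2[OF smooth_on_imp_continuous_on[OF f[OF U(1)]]])
        (auto intro: continuous_on_subset[OF c(4)])
    then have "continuous_on (U \<inter> S) f"
      by (rule continuous_on_eq) (use c(3) in \<open>simp add: inv_into_f_f\<close>)
    then show ?thesis using S c(1) U(2) that by (metis IntI continuous_on_eq_continuous_at open_Int)
  qed
  then show ?thesis using f by (auto simp: smooth_map_on_vector_space_atlas_iff continuous_at_imp_continuous_on)
qed

lemma smooth_fun_on_const: "smooth_fun_on A S (\<lambda>x. c)"
  by (auto simp: smooth_map_on_vector_space_atlas_iff intro: smooth_on_const continuous_on_const)

lemma smooth_fun_on_add:
  "smooth_fun_on A S f \<Longrightarrow> smooth_fun_on A S g \<Longrightarrow> smooth_fun_on A S (\<lambda>x. f x + g x)"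
  unfolding smooth_map_on_vector_space_atlas_iff by (auto intro!: smooth_on_add continuous_on_add)

lemma smooth_fun_on_mult:
  fixes f g :: "_ \<Rightarrow> real"
  shows "smooth_fun_on A S f \<Longrightarrow> smooth_fun_on A S g \<Longrightarrow> smooth_fun_on A S (\<lambda>x. f x * g x)"
  unfolding smooth_map_on_vector_space_atlas_iff by (auto intro!: smooth_on_mult continuous_on_mult)

lemma smooth_funs_iff: "f \<in> smooth_funs A \<longleftrightarrow> smooth_fun_on A UNIV f"
  by (simp add: smooth_funs_def)

lemma smooth_funs_const [simp]: "(\<lambda>x. c) \<in> smooth_funs A"
  by (simp add: smooth_funs_iff smooth_fun_on_const)

lemma smooth_funs_add: "f \<in> smooth_funs A \<Longrightarrow> g \<in> smooth_funs A \<Longrightarrow> (\<lambda>x. f x + g x) \<in> smooth_funs A"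
  by (simp add: smooth_funs_iff smooth_fun_on_add)

lemma smooth_funs_mult: "f \<in> smooth_funs A \<Longrightarrow> g \<in> smooth_funs A \<Longrightarrow> (\<lambda>x. f x * g x) \<in> smooth_funs A"
  by (simp add: smooth_funs_iff smooth_fun_on_mult)

lemma smooth_funs_diff:
  assumes "f \<in> smooth_funs A" "g \<in> smooth_funs A"
  shows "(\<lambda>x. f x - g x) \<in> smooth_funs A"
  using smooth_funs_add[OF assms(1) smooth_funs_mult[OF smooth_funs_const[of "-1"] assms(2)]] by simp

lemma smooth_funs_sum: "(\<And>i. i \<in> I \<Longrightarrow> f i \<in> smooth_funs A) \<Longrightarrow> (\<lambda>x. \<Sum>i\<in>I. f i x) \<in> smooth_funs A"
  by (induction I rule: infinite_finite_induct) (auto intro: smooth_funs_add)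

text \<open>Diffeomorphisms of open sets onto open sets of a vector space which need not belong to the
  atlas; on the total space of a bundle we use coordinates adapted to the projection.\<close>

definition coords ::
  "('a::topological_space, 'b::real_inner) atlas \<Rightarrow> 'a set \<Rightarrow> ('a \<Rightarrow> 'v::real_inner) \<Rightarrow> bool" where
  "coords A U \<kappa> \<longleftrightarrow> (\<exists>C::'v set. onb C) \<and> open U \<and> open (\<kappa> ` U) \<and> inj_on \<kappa> U \<and> smooth_fun_on A U \<kappa> \<and>
     smooth_map_on vector_space_atlas A (\<kappa> ` U) (inv_into U \<kappa>)"

lemma coordsD:
  assumes "coords A U \<kappa>"
  shows "open U" "open (\<kappa> ` U)" "inj_on \<kappa> U" "smooth_fun_on A U \<kappa>" "continuous_on U \<kappa>"
    "smooth_map_on vector_space_atlas A (\<kappa> ` U) (inv_into U \<kappa>)" "continuous_on (\<kappa> ` U) (inv_into U \<kappa>)"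
  using assms smooth_map_on_continuous unfolding coords_def by auto

lemma coords_vector_space_compatible:
  assumes "coords A U (\<kappa>::_ \<Rightarrow> 'v::real_inner)"
  shows "compatible_atlas (vector_space_atlas :: ('v, 'v) atlas)"
  using assms vector_space_atlas_compatible unfolding coords_def by auto

lemmas real_atlas_compatible = vector_space_atlas_compatible[OF onb_real]

text \<open>The transition maps are precisely the expressions of a chart and of its inverse in the
  other charts.\<close>

lemma chart_coords:
  assumes A: "compatible_atlas (A :: ('a::topological_space, 'b::real_inner) atlas)"
    and c: "(U, \<phi>) \<in> A"
  shows "coords A U \<phi>"
proof -
  obtain B :: "'b set" where B: "onb B" using compatible_atlas_onb[OF A] .
  have i: "inv (\<lambda>x::'b. x) = (\<lambda>x. x)" using inv_id unfolding id_def .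
  have "smooth_fun_on A U \<phi>"
    using chartD[OF A c] transition_smooth[OF A _ c]
    by (auto simp: smooth_map_on_vector_space_atlas_iff comp_def)
  moreover have "smooth_map_on vector_space_atlas A (\<phi> ` U) (inv_into U \<phi>)"
  proof -
    have "smooth_on (\<psi> \<circ> inv_into U \<phi>) (\<phi> ` U \<inter> inv_into U \<phi> -` V)" if "(V, \<psi>) \<in> A" for V \<psi>
    proof (rule smooth_on_subset[OF transition_smooth[OF A c that]])
      show "\<phi> ` U \<inter> inv_into U \<phi> -` V \<subseteq> \<phi> ` (U \<inter> V)"
        using chartD(3)[OF A c] by (auto simp: inv_into_f_f)
    qed
    then show ?thesis using chartD[OF A c]
      by (auto simp: smooth_map_on_def vector_space_atlas_def i comp_def)
  qed
  ultimately show ?thesis using B chartD[OF A c] unfolding coords_def by blast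
qed

lemma coords_at:
  fixes A :: "('a::topological_space, 'b::real_inner) atlas"
  assumes "compatible_atlas A"
  obtains U and \<phi> :: "'a \<Rightarrow> 'b" where "coords A U \<phi>" "p \<in> U"
  using chart_at[OF assms, of p] chart_coords[OF assms] by metis

lemma coords_image_open:
  assumes "coords A U \<kappa>" "open S"
  shows "open (\<kappa> ` (U \<inter> S))"
  using open_image_of_continuous_inverse coordsD[OF assms(1)] assms(2) by blast

lemma coords_preimage_open:
  assumes "coords A U \<kappa>" "open S"
  shows "open (U \<inter> \<kappa> -` S)"
  using continuous_on_open_vimage[OF coordsD(1)[OF assms(1)]] coordsD(5)[OF assms(1)] assms(2)
  by (metis Int_commute)

lemma coords_representative_smooth:
  assumes A: "compatible_atlas A" and k: "coords A U \<kappa>" and S: "open S" and f: "smooth_fun_on A S (f::_ \<Rightarrow> real)"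
  shows "smooth_on (\<lambda>x. f (inv_into U \<kappa> x)) (\<kappa> ` (U \<inter> S))"
proof -
  have "smooth_map_on vector_space_atlas vector_space_atlas (\<kappa> ` (U \<inter> S)) (\<lambda>x. f (inv_into U \<kappa> x))"
    by (rule smooth_map_on_compose[OF coords_vector_space_compatible[OF k] A real_atlas_compatible
          coords_image_open[OF k S] S smooth_map_on_subset[OF coordsD(6)[OF k]] f])
      (use coordsD(3)[OF k] in auto)
  then show ?thesis by (simp add: smooth_map_on_vector_spaces_iff)
qed

lemma smooth_fun_on_coords_compose:
  assumes A: "compatible_atlas A" and k: "coords A U \<kappa>" and g: "smooth_on (g::_ \<Rightarrow> real) (\<kappa> ` U)"
  shows "smooth_fun_on A U (\<lambda>q. g (\<kappa> q))"
  using smooth_map_on_compose[OF A coords_vector_space_compatible[OF k] real_atlas_compatible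
      coordsD(1,2,4)[OF k], of g] g by (simp add: smooth_map_on_vector_spaces_iff)

lemma smooth_funs_local:
  assumes A: "compatible_atlas (A :: ('a::t2_space, 'v::real_inner) atlas)" and "\<And>p. \<exists>T g. open T \<and> p \<in> T \<and> smooth_fun_on A T g \<and> (\<forall>q\<in>T. f q = g q)"
  shows "f \<in> smooth_funs A"
  unfolding smooth_funs_iff
proof (rule smooth_map_on_local[OF A real_atlas_compatible])
  fix p
  obtain T g where "open T" "p \<in> T" "smooth_fun_on A T g" "\<forall>q\<in>T. f q = g q" using assms(2) by blast
  then have "smooth_fun_on A T f" using smooth_map_on_cong[OF A real_atlas_compatible, of T g f] by simp
  then show "\<exists>T. open T \<and> p \<in> T \<and> T \<subseteq> UNIV \<and> smooth_fun_on A T f" using \<open>open T\<close> \<open>p \<in> T\<close> by blast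
qed simp

lemma smooth_funs_compose:
  assumes "compatible_atlas A" "compatible_atlas B" "smooth_map_on A B UNIV f" "g \<in> smooth_funs B"
  shows "(\<lambda>x. g (f x)) \<in> smooth_funs A"
  using smooth_map_on_compose[OF assms(1,2) real_atlas_compatible open_UNIV open_UNIV assms(3), of g] assms(4)
  by (simp add: smooth_funs_iff)

text \<open>This is where the Hausdorff property enters: the compact support is closed.\<close>

lemma smooth_extension_by_zero:
  fixes A :: "('a::t2_space, 'b::real_inner) atlas" and \<kappa> :: "'a \<Rightarrow> 'v::real_inner"
  assumes A: "compatible_atlas A" and k: "coords A U \<kappa>" and r: "cball c r \<subseteq> \<kappa> ` U"
    and g: "smooth_on (g::'v \<Rightarrow> real) (\<kappa> ` U)" and g0: "\<And>x. x \<in> \<kappa> ` U \<Longrightarrow> x \<notin> ball c r \<Longrightarrow> g x = 0"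
  shows "(\<lambda>q. if q \<in> U then g (\<kappa> q) else 0) \<in> smooth_funs A"
proof (rule smooth_funs_local[OF A])
  fix p
  obtain C :: "'v set" where C: "onb C" using k unfolding coords_def by blast
  define K where "K = inv_into U \<kappa> ` cball c r"
  have "compact K" unfolding K_def
    using coordsD(7)[OF k] r by (intro compact_continuous_image onb_compact_cball[OF C]) (rule continuous_on_subset)
  then have "open (- K)" using compact_imp_closed by blast
  show "\<exists>T h. open T \<and> p \<in> T \<and> smooth_fun_on A T h \<and> (\<forall>q\<in>T. (if q \<in> U then g (\<kappa> q) else 0) = h q)"
  proof (cases "p \<in> U")
    case True
    then show ?thesis using smooth_fun_on_coords_compose[OF A k g] coordsD(1)[OF k]
      by (intro exI[of _ U] exI[of _ "\<lambda>q. g (\<kappa> q)"]) auto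
  next
    case False
    \<comment> \<open>\<open>K\<close> lies in \<open>U\<close> and the function vanishes off
      \<open>K\<close>, so around a point outside \<open>U\<close> it is zero on an open
      set.\<close>
    then have "p \<in> - K" using inv_into_into[of _ \<kappa> U] r unfolding K_def by blast
    moreover have "(if q \<in> U then g (\<kappa> q) else 0) = 0" if "q \<in> - K" for q
    proof -
      have "\<kappa> q \<notin> ball c r" if "q \<in> U"
        using \<open>q \<in> - K\<close> coordsD(3)[OF k] that unfolding K_def
        by (metis ComplD ball_subset_cball imageI inv_into_f_f subsetD)
      then show ?thesis using g0 by auto
    qed
    ultimately show ?thesis using \<open>open (- K)\<close> smooth_fun_on_const[of A "- K" 0]
      by (intro exI[of _ "- K"] exI[of _ "\<lambda>q. 0"]) auto
  qed
qed

section \<open>Tangent vectors\<close>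

text \<open>The tangent vector with coordinates \<open>a\<close>. It vanishes on functions that are
  not smooth because \<open>velocity\<close> does, so that the two can be equal as
  functions.\<close>

definition coord_vec ::
  "('a::topological_space, 'b::real_inner) atlas \<Rightarrow> 'a set \<Rightarrow> ('a \<Rightarrow> 'v::real_inner) \<Rightarrow> 'a \<Rightarrow> 'v \<Rightarrow> 'a tvec" where
  "coord_vec A U \<kappa> p a = (\<lambda>f. if f \<in> smooth_funs A
     then frechet_derivative (\<lambda>x. f (inv_into U \<kappa> x)) (at (\<kappa> p)) a else 0)"

lemma coord_vec_nonsmooth: "f \<notin> smooth_funs A \<Longrightarrow> coord_vec A U \<kappa> p a f = 0"
  by (simp add: coord_vec_def)

lemma smooth_funs_representative:
  assumes "compatible_atlas A" "coords A U \<kappa>" "f \<in> smooth_funs A"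
  shows "smooth_on (\<lambda>x. f (inv_into U \<kappa> x)) (\<kappa> ` U)"
  using coords_representative_smooth[OF assms(1,2) open_UNIV] assms(3) by (simp add: smooth_funs_iff)

lemma coord_vec_has_derivative:
  assumes "compatible_atlas A" "coords A U \<kappa>" "p \<in> U" "f \<in> smooth_funs A"
  shows "((\<lambda>x. f (inv_into U \<kappa> x)) has_derivative (\<lambda>a. coord_vec A U \<kappa> p a f)) (at (\<kappa> p))"
  using smooth_on_has_derivative[OF smooth_funs_representative[OF assms(1,2,4)], of "\<kappa> p"] assms(3,4)
  by (simp add: coord_vec_def)

text \<open>A coordinate expression valid near \<open>p\<close> is enough, so functions cut off away
  from \<open>p\<close> can be differentiated through their original formula.\<close>

lemma coord_vec_eqI:
  assumes "compatible_atlas A" "coords A U \<kappa>" "p \<in> U" "f \<in> smooth_funs A"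
    and N: "open N" "p \<in> N" "\<And>q. q \<in> N \<Longrightarrow> q \<in> U \<Longrightarrow> f q = g (\<kappa> q)" and g: "(g has_derivative g') (at (\<kappa> p))"
  shows "coord_vec A U \<kappa> p a f = g' a"
proof -
  have "((\<lambda>x. f (inv_into U \<kappa> x)) has_derivative g') (at (\<kappa> p))"
  proof (rule has_derivative_transform_within_open[OF g])
    show "open (\<kappa> ` (U \<inter> N))" by (rule coords_image_open[OF assms(2) N(1)])
    show "\<kappa> p \<in> \<kappa> ` (U \<inter> N)" using assms(3) N(2) by blast
    show "g x = f (inv_into U \<kappa> x)" if "x \<in> \<kappa> ` (U \<inter> N)" for x
      using that N(3) coordsD(3)[OF assms(2)] by (auto simp: inv_into_f_f)
  qed
  then show ?thesis
    using coord_vec_has_derivative[OF assms(1-4)] has_derivative_unique by metis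
qed

lemma coord_vec_lincomb:
  assumes "compatible_atlas A" "coords A U \<kappa>" "p \<in> U"
  shows "coord_vec A U \<kappa> p (a *\<^sub>R u + b *\<^sub>R w) = (\<lambda>f. a * coord_vec A U \<kappa> p u f + b * coord_vec A U \<kappa> p w f)"
proof
  fix f
  show "coord_vec A U \<kappa> p (a *\<^sub>R u + b *\<^sub>R w) f = a * coord_vec A U \<kappa> p u f + b * coord_vec A U \<kappa> p w f"
  proof (cases "f \<in> smooth_funs A")
    case True
    note l = has_derivative_linear[OF coord_vec_has_derivative[OF assms True]]
    show ?thesis by (simp add: linear_add[OF l] linear_cmul[OF l])
  qed (simp add: coord_vec_nonsmooth)
qed

lemma velocity_eq_coord_vec:
  assumes A: "compatible_atlas A" and k: "coords A U \<kappa>" and \<gamma>: "smooth_map_on vector_space_atlas A UNIV \<gamma>"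
    and p: "\<gamma> 0 = p" "p \<in> U" and d: "((\<lambda>t. \<kappa> (\<gamma> t)) has_derivative (\<lambda>t. t *\<^sub>R a)) (at 0)"
  shows "velocity A \<gamma> = coord_vec A U \<kappa> p a"
proof
  fix f
  show "velocity A \<gamma> f = coord_vec A U \<kappa> p a f"
  proof (cases "f \<in> smooth_funs A")
    case True
    have "((\<lambda>x. f (inv_into U \<kappa> x)) has_derivative (\<lambda>a. coord_vec A U \<kappa> p a f)) (at (\<kappa> (\<gamma> 0)))"
      using coord_vec_has_derivative[OF A k p(2) True] p(1) by simp
    from has_derivative_compose[OF d this]
    have "((\<lambda>t. f (inv_into U \<kappa> (\<kappa> (\<gamma> t)))) has_derivative (\<lambda>t. coord_vec A U \<kappa> p (t *\<^sub>R a) f)) (at 0)" .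
    then have "((\<lambda>t. f (\<gamma> t)) has_derivative (\<lambda>t. coord_vec A U \<kappa> p (t *\<^sub>R a) f)) (at 0)"
    proof (rule has_derivative_transform_within_open)
      have "continuous_on UNIV \<gamma>" using \<gamma> by (rule smooth_map_on_continuous)
      then show "open (\<gamma> -` U)" using continuous_on_open_vimage[OF open_UNIV] coordsD(1)[OF k]
        by (metis Int_UNIV_right)
      show "f (inv_into U \<kappa> (\<kappa> (\<gamma> t))) = f (\<gamma> t)" if "t \<in> \<gamma> -` U" for t
        using that coordsD(3)[OF k] by (simp add: inv_into_f_f)
    qed (use p in auto)
    moreover have "coord_vec A U \<kappa> p (t *\<^sub>R a) f = t * coord_vec A U \<kappa> p a f" for t
      using coord_vec_lincomb[OF A k p(2), of t a 0 0] by simp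
    ultimately have "((\<lambda>t. f (\<gamma> t)) has_field_derivative coord_vec A U \<kappa> p a f) (at 0)"
      by (simp add: has_field_derivative_def mult.commute[of _ "coord_vec A U \<kappa> p a f"])
    then show ?thesis using True by (simp add: velocity_def DERIV_imp_deriv)
  qed (simp add: velocity_def coord_vec_nonsmooth)
qed

text \<open>The sine keeps the straight line inside the coordinate domain, so that the curve is global.\<close>

lemma curve_with_coord_vec:
  assumes A: "compatible_atlas (A :: ('a::topological_space, 'b::real_inner) atlas)"
    and k: "coords A U \<kappa>" and p: "p \<in> U"
  obtains \<gamma> where "smooth_map_on vector_space_atlas A UNIV \<gamma>" "\<gamma> 0 = p" "velocity A \<gamma> = coord_vec A U \<kappa> p a"
    "\<And>t. \<gamma> t \<in> U"
proof -
  obtain r where r: "r > 0" "ball (\<kappa> p) r \<subseteq> \<kappa> ` U"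
    using coordsD(2)[OF k] p open_contains_ball by blast
  \<comment> \<open>The amplitude \<open>e\<close> keeps the curve within distance \<open>r\<close>
    of \<open>\<kappa> p\<close>; the frequency \<open>1 / e\<close> compensates it, so that the
    velocity at 0 is exactly \<open>a\<close>.\<close>
  define e where "e = r / (norm a + 1)"
  have e: "e > 0" "e * norm a < r"
    using r(1) norm_ge_zero[of a] by (auto simp: e_def divide_simps add_nonneg_pos)
  define c where "c t = \<kappa> p + (e * sin (t / e)) *\<^sub>R a" for t
  define \<gamma> where "\<gamma> t = inv_into U \<kappa> (c t)" for t
  have cU: "c t \<in> \<kappa> ` U" for t
  proof -
    have "norm (c t - \<kappa> p) = e * norm a * \<bar>sin (t / e)\<bar>"
      using e(1) by (simp add: c_def abs_mult)
    also have "\<dots> \<le> e * norm a" using e(1) abs_sin_le_one[of "t / e"]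
      by (intro mult_right_le_one_le) auto
    finally have "c t \<in> ball (\<kappa> p) r" using e(2) by (simp add: dist_norm norm_minus_commute)
    then show ?thesis using r(2) by blast
  qed
  have "smooth_on c UNIV" unfolding c_def
    by (intro smooth_on_add smooth_on_const smooth_on_scaleR smooth_on_mult
        smooth_on_compose[OF onb_real _ smooth_on_sin[where R=UNIV]]
        smooth_on_bounded_linear[OF bounded_linear_divide]) auto
  then have g1: "smooth_map_on vector_space_atlas A UNIV \<gamma>" unfolding \<gamma>_def
    by (intro smooth_map_on_compose[OF real_atlas_compatible coords_vector_space_compatible[OF k] A
         open_UNIV coordsD(2)[OF k] _ coordsD(6)[OF k]])
      (use cU in \<open>auto simp: smooth_map_on_vector_spaces_iff\<close>)
  have g0: "\<gamma> 0 = p" using coordsD(3)[OF k] p by (simp add: \<gamma>_def c_def)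
  have "\<kappa> (\<gamma> t) = c t" for t using cU[of t] by (simp add: \<gamma>_def f_inv_into_f)
  moreover have "(c has_derivative (\<lambda>t. t *\<^sub>R a)) (at 0)"
    unfolding c_def using e(1) by (auto intro!: derivative_eq_intros)
  ultimately have "velocity A \<gamma> = coord_vec A U \<kappa> p a"
    using velocity_eq_coord_vec[OF A k g1 g0 p] by simp
  moreover have "\<gamma> t \<in> U" for t using cU[of t] unfolding \<gamma>_def by (rule inv_into_into)
  ultimately show ?thesis using that g1 g0 by blast
qed

text \<open>A sum of velocities is not visibly the velocity of a curve. This parametrization, linear
  by \<open>coord_vec_lincomb\<close>, gives the tangent space its vector space structure.\<close>

lemma tangent_space_eq:
  assumes A: "compatible_atlas (A :: ('a::topological_space, 'b::real_inner) atlas)"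
    and k: "coords A U \<kappa>" and p: "p \<in> U"
  shows "tangent_space A p = range (coord_vec A U \<kappa> p)"
proof
  show "range (coord_vec A U \<kappa> p) \<subseteq> tangent_space A p"
  proof clarify
    fix a
    show "coord_vec A U \<kappa> p a \<in> tangent_space A p"
      using curve_with_coord_vec[OF A k p, of a] unfolding tangent_space_def by (smt (verit) mem_Collect_eq)
  qed
  show "tangent_space A p \<subseteq> range (coord_vec A U \<kappa> p)"
  proof
    fix v assume "v \<in> tangent_space A p"
    then obtain \<gamma> where g: "v = velocity A \<gamma>" "smooth_map_on vector_space_atlas A UNIV \<gamma>" "\<gamma> 0 = p"
      unfolding tangent_space_def by blast
    have oT: "open (\<gamma> -` U)" using continuous_on_open_vimage[OF open_UNIV] coordsD(1)[OF k]
      smooth_map_on_continuous[OF g(2)] by (metis Int_UNIV_right)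
    have "smooth_map_on vector_space_atlas vector_space_atlas (\<gamma> -` U) (\<lambda>t. \<kappa> (\<gamma> t))"
      by (intro smooth_map_on_compose[OF real_atlas_compatible A coords_vector_space_compatible[OF k] oT
           coordsD(1)[OF k] smooth_map_on_subset[OF g(2)] coordsD(4)[OF k]]) auto
    then have "smooth_on (\<lambda>t. \<kappa> (\<gamma> t)) (\<gamma> -` U)" by (simp add: smooth_map_on_vector_spaces_iff)
    then have d: "((\<lambda>t. \<kappa> (\<gamma> t)) has_derivative frechet_derivative (\<lambda>t. \<kappa> (\<gamma> t)) (at 0)) (at 0)"
      using smooth_on_has_derivative g(3) p by blast
    define D where "D = frechet_derivative (\<lambda>t. \<kappa> (\<gamma> t)) (at 0)"
    have D: "((\<lambda>t. \<kappa> (\<gamma> t)) has_derivative D) (at 0)" using d by (simp add: D_def)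
    have "D t = t *\<^sub>R D 1" for t
      using linear_cmul[OF has_derivative_linear[OF D], of t 1] by simp
    \<comment> \<open>A linear map on the reals is determined by its value at 1, which is the
      coordinate velocity.\<close>
    then have "D = (\<lambda>t. t *\<^sub>R D 1)" by blast
    then have "velocity A \<gamma> = coord_vec A U \<kappa> p (D 1)"
      using velocity_eq_coord_vec[OF A k g(2,3) p] D by metis
    then show "v \<in> range (coord_vec A U \<kappa> p)" unfolding g(1) by (rule range_eqI)
  qed
qed

lemma tangent_space_lincomb:
  fixes A :: "('a::topological_space, 'b::real_inner) atlas"
  assumes A: "compatible_atlas A" and v: "v \<in> tangent_space A p" "w \<in> tangent_space A p"
  shows "(\<lambda>f. a * v f + b * w f) \<in> tangent_space A p"
proof -
  obtain U and \<phi> :: "'a \<Rightarrow> 'b" where k: "coords A U \<phi>" "p \<in> U" by (rule coords_at[OF A, where p=p])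
  obtain u u' where "v = coord_vec A U \<phi> p u" "w = coord_vec A U \<phi> p u'"
    using v tangent_space_eq[OF A k] by auto
  then have "(\<lambda>f. a * v f + b * w f) = coord_vec A U \<phi> p (a *\<^sub>R u + b *\<^sub>R u')"
    by (simp add: coord_vec_lincomb[OF A k])
  then show ?thesis using tangent_space_eq[OF A k] by simp
qed

lemma tangent_space_zero:
  fixes A :: "('a::topological_space, 'b::real_inner) atlas"
  assumes A: "compatible_atlas A"
  shows "(\<lambda>f. 0) \<in> tangent_space A p"
proof -
  obtain U and \<phi> :: "'a \<Rightarrow> 'b" where k: "coords A U \<phi>" "p \<in> U" by (rule coords_at[OF A, where p=p])
  show ?thesis using tangent_space_lincomb[OF A, of "coord_vec A U \<phi> p 0" p _ 0 0] tangent_space_eq[OF A k] by auto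
qed

lemma tangent_space_scale:
  assumes "compatible_atlas A" "v \<in> tangent_space A p"
  shows "(\<lambda>f. a * v f) \<in> tangent_space A p"
  using tangent_space_lincomb[OF assms(1) assms(2) assms(2), of a 0] by simp

lemma tangent_space_sum:
  assumes "compatible_atlas A" "\<And>i. i \<in> I \<Longrightarrow> v i \<in> tangent_space A p"
  shows "(\<lambda>f. \<Sum>i\<in>I. c i * v i f) \<in> tangent_space A p"
  using assms(2)
proof (induction I rule: infinite_finite_induct)
  case (insert x F)
  then show ?case using tangent_space_lincomb[OF assms(1), of "v x" p "\<lambda>f. \<Sum>i\<in>F. c i * v i f" "c x" 1] by simp
qed (simp_all add: tangent_space_zero[OF assms(1)])

section \<open>Tangent vectors as local derivations\<close>

lemma tangent_vector_nonsmooth: "v \<in> tangent_space A p \<Longrightarrow> f \<notin> smooth_funs A \<Longrightarrow> v f = 0"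
  unfolding tangent_space_def velocity_def by auto

lemma tangent_vector_local:
  fixes A :: "('a::topological_space, 'b::real_inner) atlas"
  assumes A: "compatible_atlas A" and v: "v \<in> tangent_space A p" and fg: "f \<in> smooth_funs A" "g \<in> smooth_funs A"
    and N: "open N" "p \<in> N" "\<And>q. q \<in> N \<Longrightarrow> f q = g q"
  shows "v f = v g"
proof -
  obtain U and \<phi> :: "'a \<Rightarrow> 'b" where k: "coords A U \<phi>" "p \<in> U" by (rule coords_at[OF A, where p=p])
  obtain a where a: "v = coord_vec A U \<phi> p a" using v tangent_space_eq[OF A k] by auto
  show ?thesis unfolding a
    by (rule coord_vec_eqI[OF A k fg(1) N(1,2) _ coord_vec_has_derivative[OF A k fg(2)]])
      (use coordsD(3)[OF k(1)] N(3) in \<open>simp add: inv_into_f_f\<close>)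
qed

lemma tangent_vector_add:
  fixes A :: "('a::topological_space, 'b::real_inner) atlas"
  assumes A: "compatible_atlas A" and v: "v \<in> tangent_space A p" and fg: "f \<in> smooth_funs A" "g \<in> smooth_funs A"
  shows "v (\<lambda>q. f q + g q) = v f + v g"
proof -
  obtain U and \<phi> :: "'a \<Rightarrow> 'b" where k: "coords A U \<phi>" "p \<in> U" by (rule coords_at[OF A, where p=p])
  obtain a where a: "v = coord_vec A U \<phi> p a" using v tangent_space_eq[OF A k] by auto
  show ?thesis unfolding a
    by (rule coord_vec_eqI[OF A k smooth_funs_add[OF fg] open_UNIV UNIV_I _
          has_derivative_add[OF coord_vec_has_derivative[OF A k fg(1)] coord_vec_has_derivative[OF A k fg(2)]]])
      (use coordsD(3)[OF k(1)] in \<open>simp add: inv_into_f_f\<close>)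
qed

lemma tangent_vector_mult:
  fixes A :: "('a::topological_space, 'b::real_inner) atlas"
  assumes A: "compatible_atlas A" and v: "v \<in> tangent_space A p" and fg: "f \<in> smooth_funs A" "g \<in> smooth_funs A"
  shows "v (\<lambda>q. f q * g q) = f p * v g + v f * g p"
proof -
  obtain U and \<phi> :: "'a \<Rightarrow> 'b" where k: "coords A U \<phi>" "p \<in> U" by (rule coords_at[OF A, where p=p])
  obtain a where a: "v = coord_vec A U \<phi> p a" using v tangent_space_eq[OF A k] by auto
  have "v (\<lambda>q. f q * g q) = f (inv_into U \<phi> (\<phi> p)) * v g + v f * g (inv_into U \<phi> (\<phi> p))"
    unfolding a
    by (rule coord_vec_eqI[OF A k smooth_funs_mult[OF fg] open_UNIV UNIV_I _
          has_derivative_mult[OF coord_vec_has_derivative[OF A k fg(1)] coord_vec_has_derivative[OF A k fg(2)]]])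
      (use coordsD(3)[OF k(1)] in \<open>simp add: inv_into_f_f\<close>)
  then show ?thesis using coordsD(3)[OF k(1)] k(2) by (simp add: inv_into_f_f)
qed

lemma tangent_vector_const:
  fixes A :: "('a::topological_space, 'b::real_inner) atlas"
  assumes A: "compatible_atlas A" and v: "v \<in> tangent_space A p"
  shows "v (\<lambda>q. c) = 0"
proof -
  obtain U and \<phi> :: "'a \<Rightarrow> 'b" where k: "coords A U \<phi>" "p \<in> U" by (rule coords_at[OF A, where p=p])
  obtain a where a: "v = coord_vec A U \<phi> p a" using v tangent_space_eq[OF A k] by auto
  show ?thesis unfolding a
    by (rule coord_vec_eqI[OF A k smooth_funs_const open_UNIV UNIV_I _ has_derivative_const]) simp
qed

lemma tangent_vector_cmult:
  assumes A: "compatible_atlas A" and v: "v \<in> tangent_space A p" and f: "f \<in> smooth_funs A"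
  shows "v (\<lambda>q. c * f q) = c * v f"
  using tangent_vector_mult[OF A v smooth_funs_const f, of c] tangent_vector_const[OF A v, of c] by simp

lemma tangent_vector_sum:
  assumes A: "compatible_atlas A" and v: "v \<in> tangent_space A p" and f: "\<And>i. i \<in> I \<Longrightarrow> f i \<in> smooth_funs A"
  shows "v (\<lambda>q. \<Sum>i\<in>I. f i q) = (\<Sum>i\<in>I. v (f i))"
  using f
proof (induction I rule: infinite_finite_induct)
  case (insert x F)
  then have "(\<lambda>q. \<Sum>i\<in>F. f i q) \<in> smooth_funs A" by (intro smooth_funs_sum) auto
  then show ?case using tangent_vector_add[OF A v, of "f x" "\<lambda>q. \<Sum>i\<in>F. f i q"] insert by simp
qed (simp_all add: tangent_vector_const[OF A v])

section \<open>Vector fields and local frames\<close>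

lemma vector_fieldsD:
  assumes "X \<in> vector_fields A"
  shows "X p \<in> tangent_space A p" "f \<in> smooth_funs A \<Longrightarrow> (\<lambda>p. X p f) \<in> smooth_funs A"
  using assms unfolding vector_fields_def by auto

text \<open>Tangent vectors vanish on functions that are not smooth, and the zero function is
  smooth; the claim therefore holds for every \<open>f\<close>.\<close>

lemma vector_field_smooth:
  assumes "X \<in> vector_fields A"
  shows "(\<lambda>p. X p f) \<in> smooth_funs A"
proof (cases "f \<in> smooth_funs A")
  case False
  then have "X p f = 0" for p using tangent_vector_nonsmooth vector_fieldsD(1)[OF assms] by blast
  then show ?thesis by simp
qed (rule vector_fieldsD(2)[OF assms])

lemma vector_fields_sum:
  assumes A: "compatible_atlas A" and "\<And>i. i \<in> I \<Longrightarrow> c i \<in> smooth_funs A" "\<And>i. i \<in> I \<Longrightarrow> X i \<in> vector_fields A"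
  shows "(\<lambda>p f. \<Sum>i\<in>I. c i p * X i p f) \<in> vector_fields A"
proof -
  have "(\<lambda>f. \<Sum>i\<in>I. c i p * X i p f) \<in> tangent_space A p" for p
    using assms(3) vector_fieldsD(1) by (intro tangent_space_sum[OF A]) blast
  moreover have "(\<lambda>p. \<Sum>i\<in>I. c i p * X i p f) \<in> smooth_funs A" for f
    using assms(2,3) by (intro smooth_funs_sum smooth_funs_mult vector_field_smooth[of "X _"]) auto
  ultimately show ?thesis by (simp add: vector_fields_def)
qed

lemma vector_fields_scale:
  assumes A: "compatible_atlas A" and "c \<in> smooth_funs A" "X \<in> vector_fields A"
  shows "(\<lambda>p f. c p * X p f) \<in> vector_fields A"
  using vector_fields_sum[OF A, of "{()}" "\<lambda>_. c" "\<lambda>_. X"] assms by simp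

lemma vector_fields_add:
  assumes A: "compatible_atlas A" and "X \<in> vector_fields A" "Y \<in> vector_fields A"
  shows "(\<lambda>p f. X p f + Y p f) \<in> vector_fields A"
  using vector_fields_sum[OF A, of "{True, False}" "\<lambda>_ _. 1" "\<lambda>b. if b then X else Y"] assms by simp

text \<open>Coordinate functions and coordinate fields are multiplied by a bump function and
  extended by zero. The results are global, as tangent vectors demand of their arguments, and
  unaltered on the smaller neighbourhood \<open>N\<close>.\<close>

lemma coord_frame:
  fixes A :: "('a::t2_space, 'b::real_inner) atlas" and \<kappa> :: "'a \<Rightarrow> 'v::real_inner"
  assumes A: "compatible_atlas A" and k: "coords A U \<kappa>" and p: "p \<in> U"
  obtains N y Y where "open N" "p \<in> N" "N \<subseteq> U"
    "\<And>b. y b \<in> smooth_funs A" "\<And>a. Y a \<in> vector_fields A"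
    "\<And>q a. q \<in> N \<Longrightarrow> Y a q = coord_vec A U \<kappa> q a"
    "\<And>q a b. q \<in> N \<Longrightarrow> coord_vec A U \<kappa> q a (y b) = a \<bullet> b"
proof -
  obtain r0 where "r0 > 0" "cball (\<kappa> p) r0 \<subseteq> \<kappa> ` U"
    using coordsD(2)[OF k] p open_contains_cball by blast
  then obtain r where r: "r > 0" "cball (\<kappa> p) r \<subseteq> \<kappa> ` U" by blast
  obtain \<beta> :: "'v \<Rightarrow> real" where \<beta>: "smooth_on \<beta> UNIV" "\<And>x. x \<in> ball (\<kappa> p) (r / 2) \<Longrightarrow> \<beta> x = 1"
     "\<And>x. x \<notin> ball (\<kappa> p) r \<Longrightarrow> \<beta> x = 0"
    using bump_function_exists[OF r(1), of "\<kappa> p"] by blast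
  have \<beta>U: "smooth_on \<beta> (\<kappa> ` U)" using \<beta>(1) by (rule smooth_on_subset) simp
  define N where "N = U \<inter> \<kappa> -` ball (\<kappa> p) (r / 2)"
  have N: "open N" "p \<in> N" "N \<subseteq> U" using coords_preimage_open[OF k open_ball] p r(1) by (auto simp: N_def)
  define y where "y b q = (if q \<in> U then \<beta> (\<kappa> q) * (\<kappa> q \<bullet> b) else 0)" for b q
  define Y where "Y a q f = (if q \<in> U then \<beta> (\<kappa> q) * coord_vec A U \<kappa> q a f else 0)" for a q f
  have y: "y b \<in> smooth_funs A" for b
  proof -
    have "smooth_on (\<lambda>x. \<beta> x * (x \<bullet> b)) (\<kappa> ` U)"
      by (intro smooth_on_mult \<beta>U smooth_on_bounded_linear bounded_linear_inner_left)
    from smooth_extension_by_zero[OF A k r(2) this] show ?thesis using \<beta>(3) by (simp add: y_def[abs_def])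
  qed
  have Y: "Y a \<in> vector_fields A" for a
  proof -
    have "Y a q \<in> tangent_space A q" for q
      using tangent_space_zero[OF A, of q] tangent_space_scale[OF A, of "coord_vec A U \<kappa> q a" q]
        tangent_space_eq[OF A k, of q]
      by (cases "q \<in> U") (simp_all add: Y_def[abs_def])
    moreover have "(\<lambda>q. Y a q f) \<in> smooth_funs A" if f: "f \<in> smooth_funs A" for f
    proof -
      have "smooth_on (\<lambda>x. \<beta> x * frechet_derivative (\<lambda>x. f (inv_into U \<kappa> x)) (at x) a) (\<kappa> ` U)"
        by (intro smooth_on_mult \<beta>U smooth_on_frechet_derivative smooth_funs_representative[OF A k f] coordsD(2)[OF k])
      from smooth_extension_by_zero[OF A k r(2) this] show ?thesis
        using \<beta>(3) f by (simp add: Y_def coord_vec_def cong: if_cong)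
    qed
    ultimately show ?thesis by (simp add: vector_fields_def)
  qed
  have YN: "Y a q = coord_vec A U \<kappa> q a" if "q \<in> N" for q a
    using that \<beta>(2) by (auto simp: Y_def N_def)
  have "coord_vec A U \<kappa> q a (y b) = a \<bullet> b" if q: "q \<in> N" for q a b
    by (rule coord_vec_eqI[OF A k _ y N(1) q, where g="\<lambda>x. x \<bullet> b"])
      (use q \<beta>(2) in \<open>auto simp: y_def N_def intro!: derivative_eq_intros\<close>)
  then show ?thesis using that N y Y YN by blast
qed

text \<open>Writes an iterated coordinate derivative as an iterated Frechet derivative, to which the
  symmetry of second derivatives applies.\<close>

lemma frechet_derivative_representative:
  assumes A: "compatible_atlas A" and k: "coords A U \<kappa>" and f: "f \<in> smooth_funs A"
    and N: "open N" "N \<subseteq> U" and h: "\<And>q. q \<in> N \<Longrightarrow> h q = coord_vec A U \<kappa> q b f" "h \<in> smooth_funs A" and q: "q \<in> N"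
  shows "coord_vec A U \<kappa> q a h
     = frechet_derivative (\<lambda>x. frechet_derivative (\<lambda>x. f (inv_into U \<kappa> x)) (at x) b) (at (\<kappa> q)) a"
proof (rule coord_vec_eqI[OF A k _ h(2) N(1) q])
  show "q \<in> U" using q N by auto
  then have "\<kappa> q \<in> \<kappa> ` U" by simp
  then show "((\<lambda>x. frechet_derivative (\<lambda>x. f (inv_into U \<kappa> x)) (at x) b) has_derivative
     frechet_derivative (\<lambda>x. frechet_derivative (\<lambda>x. f (inv_into U \<kappa> x)) (at x) b) (at (\<kappa> q))) (at (\<kappa> q))"
    using smooth_on_has_derivative[OF smooth_on_frechet_derivative[OF smooth_funs_representative[OF A k f] coordsD(2)[OF k]]]
    by blast
  show "h r = frechet_derivative (\<lambda>x. f (inv_into U \<kappa> x)) (at (\<kappa> r)) b" if "r \<in> N" "r \<in> U" for r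
    using h(1)[OF that(1)] f by (simp add: coord_vec_def)
qed

text \<open>The frame is indexed by an orthonormal basis, for then the coefficient of
  \<open>Y i\<close> in \<open>v\<close> is \<open>v (y i)\<close>. The commutation clause will
  cancel the second-order terms of a Lie bracket.\<close>

lemma local_frame:
  fixes A :: "('a::t2_space, 'b::real_inner) atlas"
  assumes A: "compatible_atlas A"
  obtains N and I :: "'b set" and y Y where "open N" "p \<in> N" "finite I"
    "\<And>i. i \<in> I \<Longrightarrow> y i \<in> smooth_funs A" "\<And>i. i \<in> I \<Longrightarrow> Y i \<in> vector_fields A"
    "\<And>q v. q \<in> N \<Longrightarrow> v \<in> tangent_space A q \<Longrightarrow> v = (\<lambda>f. \<Sum>i\<in>I. v (y i) * Y i q f)"
    "\<And>q i j f. q \<in> N \<Longrightarrow> i \<in> I \<Longrightarrow> j \<in> I \<Longrightarrow> Y i q (\<lambda>r. Y j r f) = Y j q (\<lambda>r. Y i r f)"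
proof -
  obtain U and \<phi> :: "'a \<Rightarrow> 'b" where k: "coords A U \<phi>" "p \<in> U" by (rule coords_at[OF A, where p=p])
  obtain I :: "'b set" where I: "onb I" using compatible_atlas_onb[OF A] .
  obtain N y Y where N: "open N" "p \<in> N" "N \<subseteq> U"
    "\<And>b. y b \<in> smooth_funs A" "\<And>a. Y a \<in> vector_fields A"
    "\<And>q a. q \<in> N \<Longrightarrow> Y a q = coord_vec A U \<phi> q a"
    "\<And>q a b. q \<in> N \<Longrightarrow> coord_vec A U \<phi> q a (y b) = a \<bullet> b"
    by (rule coord_frame[OF A k]) blast
  have "v = (\<lambda>f. \<Sum>i\<in>I. v (y i) * Y i q f)" if q: "q \<in> N" "v \<in> tangent_space A q" for q v
  proof
    fix f
    have qU: "q \<in> U" using q N by auto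
    obtain a where a: "v = coord_vec A U \<phi> q a" using q(2) tangent_space_eq[OF A k(1) qU] by auto
    show "v f = (\<Sum>i\<in>I. v (y i) * Y i q f)"
    proof (cases "f \<in> smooth_funs A")
      case True
      show ?thesis
        using onb_linear_expand[OF I has_derivative_linear[OF coord_vec_has_derivative[OF A k(1) qU True]], of a]
        by (simp add: a N(6,7)[OF q(1)])
    next
      case False
      then show ?thesis using tangent_vector_nonsmooth[OF q(2)] tangent_vector_nonsmooth[OF vector_fieldsD(1)[OF N(5)]] by simp
    qed
  qed
  moreover have "Y i q (\<lambda>r. Y j r f) = Y j q (\<lambda>r. Y i r f)" if "q \<in> N" for q i j f
  proof (cases "f \<in> smooth_funs A")
    case True
    have s: "(\<lambda>r. Y i r f) \<in> smooth_funs A" for i using vector_field_smooth[OF N(5)] .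
    have *: "Y i q (\<lambda>r. Y j r f) = frechet_derivative (\<lambda>x. frechet_derivative (\<lambda>x. f (inv_into U \<phi> x)) (at x) j) (at (\<phi> q)) i"
      for i j unfolding N(6)[OF that]
      by (rule frechet_derivative_representative[OF A k(1) True N(1,3) _ s that]) (simp add: N(6))
    have "\<phi> q \<in> \<phi> ` U" using that N(3) by blast
    from smooth_on_second_derivative_symmetric[OF smooth_funs_representative[OF A k(1) True] coordsD(2)[OF k(1)] this, of j i]
    show ?thesis unfolding * .
  next
    case False
    then have "Y i r f = 0" for i r using tangent_vector_nonsmooth[OF vector_fieldsD(1)[OF N(5)]] by blast
    then show ?thesis using tangent_vector_const[OF A vector_fieldsD(1)[OF N(5)]] by simp
  qed
  ultimately show ?thesis using that[OF N(1,2) onb_finite[OF I]] N(4,5) by blast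
qed

text \<open>The coefficients of \<open>v\<close> in a local frame are frozen to constants.\<close>

lemma tangent_vector_extends:
  fixes A :: "('a::t2_space, 'b::real_inner) atlas"
  assumes A: "compatible_atlas A" and v: "v \<in> tangent_space A p"
  shows "\<exists>X\<in>vector_fields A. X p = v"
proof -
  obtain N and I :: "'b set" and y Y where N: "open N" "p \<in> N" "finite I"
    "\<And>i. i \<in> I \<Longrightarrow> y i \<in> smooth_funs A" "\<And>i. i \<in> I \<Longrightarrow> Y i \<in> vector_fields A"
    "\<And>q v. q \<in> N \<Longrightarrow> v \<in> tangent_space A q \<Longrightarrow> v = (\<lambda>f. \<Sum>i\<in>I. v (y i) * Y i q f)"
    "\<And>q i j f. q \<in> N \<Longrightarrow> i \<in> I \<Longrightarrow> j \<in> I \<Longrightarrow> Y i q (\<lambda>r. Y j r f) = Y j q (\<lambda>r. Y i r f)"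
    by (rule local_frame[OF A, where p=p]) blast
  have "(\<lambda>q f. \<Sum>i\<in>I. v (y i) * Y i q f) \<in> vector_fields A"
    using vector_fields_sum[OF A, of I "\<lambda>i q. v (y i)" Y] N(5) by simp
  then show ?thesis using N(6)[OF N(2) v] by (intro bexI) auto
qed

lemma extension_vector_field:
  fixes A :: "('a::t2_space, 'b::real_inner) atlas"
  assumes "compatible_atlas A" "v \<in> tangent_space A p"
  shows "extension A p v \<in> vector_fields A" "extension A p v p = v"
  unfolding extension_def
  using someI_ex[of "\<lambda>X. X \<in> vector_fields A \<and> X p = v"] tangent_vector_extends[OF assms] by blast+

text \<open>The point at issue is that the bracket is a velocity and not merely an operator of
  second order: in a commuting frame the second derivatives cancel and a combination of frame fields
  remains.\<close>

lemma lie_bracket_vector_fields: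
  fixes A :: "('a::t2_space, 'b::real_inner) atlas"
  assumes A: "compatible_atlas A" and X: "X \<in> vector_fields A" and Y: "Y \<in> vector_fields A"
  shows "lie_bracket X Y \<in> vector_fields A"
proof -
  note s = vector_field_smooth and t = vector_fieldsD(1)
  have "lie_bracket X Y p \<in> tangent_space A p" for p
  proof -
    obtain N and I :: "'b set" and y Z where N: "open N" "p \<in> N" "finite I"
      "\<And>i. i \<in> I \<Longrightarrow> y i \<in> smooth_funs A" "\<And>i. i \<in> I \<Longrightarrow> Z i \<in> vector_fields A"
      "\<And>q v. q \<in> N \<Longrightarrow> v \<in> tangent_space A q \<Longrightarrow> v = (\<lambda>f. \<Sum>i\<in>I. v (y i) * Z i q f)"
      "\<And>q i j f. q \<in> N \<Longrightarrow> i \<in> I \<Longrightarrow> j \<in> I \<Longrightarrow> Z i q (\<lambda>r. Z j r f) = Z j q (\<lambda>r. Z i r f)"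
      by (rule local_frame[OF A, where p=p]) blast
    \<comment> \<open>The product rule, applied to the frame expansion of \<open>Y\<close>,
      separates a second-order part from a first-order part.\<close>
    have second: "X p (\<lambda>q. Y q f) = (\<Sum>j\<in>I. Y p (y j) * (\<Sum>i\<in>I. X p (y i) * Z i p (\<lambda>q. Z j q f)))
         + (\<Sum>j\<in>I. X p (\<lambda>q. Y q (y j)) * Z j p f)"
      if X: "X \<in> vector_fields A" and Y: "Y \<in> vector_fields A" for X Y f
    proof -
      have "X p (\<lambda>q. Y q f) = X p (\<lambda>q. \<Sum>j\<in>I. Y q (y j) * Z j q f)"
        by (rule tangent_vector_local[OF A t[OF X] s[OF Y] _ N(1,2)])
          (auto intro!: smooth_funs_sum smooth_funs_mult s[OF Y] s[OF N(5)] fun_cong[OF N(6)] t[OF Y])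
      also have "\<dots> = (\<Sum>j\<in>I. X p (\<lambda>q. Y q (y j) * Z j q f))"
        by (intro tangent_vector_sum[OF A t[OF X]] smooth_funs_mult s N(5) Y)
      also have "\<dots> = (\<Sum>j\<in>I. Y p (y j) * X p (\<lambda>q. Z j q f) + X p (\<lambda>q. Y q (y j)) * Z j p f)"
        by (intro sum.cong refl tangent_vector_mult[OF A t[OF X]] s N(5) Y)
      also have "\<dots> = (\<Sum>j\<in>I. Y p (y j) * (\<Sum>i\<in>I. X p (y i) * Z i p (\<lambda>q. Z j q f)) + X p (\<lambda>q. Y q (y j)) * Z j p f)"
      proof (intro sum.cong refl)
        fix j assume "j \<in> I"
        have "X p (\<lambda>q. Z j q f) = (\<Sum>i\<in>I. X p (y i) * Z i p (\<lambda>q. Z j q f))"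
          by (rule fun_cong[OF N(6)[OF N(2) t[OF X]]])
        then show "Y p (y j) * X p (\<lambda>q. Z j q f) + X p (\<lambda>q. Y q (y j)) * Z j p f
          = Y p (y j) * (\<Sum>i\<in>I. X p (y i) * Z i p (\<lambda>q. Z j q f)) + X p (\<lambda>q. Y q (y j)) * Z j p f"
          by simp
      qed
      finally show ?thesis by (simp add: sum.distrib)
    qed
    \<comment> \<open>Commuting frame fields make the second-order part symmetric in
      \<open>X\<close> and \<open>Y\<close>.\<close>
    have sym: "(\<Sum>j\<in>I. Y p (y j) * (\<Sum>i\<in>I. X p (y i) * Z i p (\<lambda>q. Z j q f)))
        = (\<Sum>j\<in>I. X p (y j) * (\<Sum>i\<in>I. Y p (y i) * Z i p (\<lambda>q. Z j q f)))" for f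
    proof -
      have "(\<Sum>j\<in>I. Y p (y j) * (\<Sum>i\<in>I. X p (y i) * Z i p (\<lambda>q. Z j q f)))
          = (\<Sum>j\<in>I. \<Sum>i\<in>I. Y p (y j) * X p (y i) * Z j p (\<lambda>q. Z i q f))"
        using N(7)[OF N(2)] by (auto simp: sum_distrib_left mult.assoc intro!: sum.cong)
      also have "\<dots> = (\<Sum>i\<in>I. \<Sum>j\<in>I. Y p (y j) * X p (y i) * Z j p (\<lambda>q. Z i q f))" by (rule sum.swap)
      also have "\<dots> = (\<Sum>j\<in>I. X p (y j) * (\<Sum>i\<in>I. Y p (y i) * Z i p (\<lambda>q. Z j q f)))"
        by (auto simp: sum_distrib_left mult_ac intro!: sum.cong)
      finally show ?thesis .
    qed
    have "lie_bracket X Y p f = (\<Sum>j\<in>I. (X p (\<lambda>q. Y q (y j)) - Y p (\<lambda>q. X q (y j))) * Z j p f)" for f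
    proof -
      have "lie_bracket X Y p f = X p (\<lambda>q. Y q f) - Y p (\<lambda>q. X q f)" by (simp add: lie_bracket_def)
      also have "\<dots> = ((\<Sum>j\<in>I. Y p (y j) * (\<Sum>i\<in>I. X p (y i) * Z i p (\<lambda>q. Z j q f)))
            + (\<Sum>j\<in>I. X p (\<lambda>q. Y q (y j)) * Z j p f))
          - ((\<Sum>j\<in>I. X p (y j) * (\<Sum>i\<in>I. Y p (y i) * Z i p (\<lambda>q. Z j q f)))
            + (\<Sum>j\<in>I. Y p (\<lambda>q. X q (y j)) * Z j p f))"
        by (rule arg_cong2[where f=minus, OF second[OF X Y] second[OF Y X]])
      also have "\<dots> = (\<Sum>j\<in>I. X p (\<lambda>q. Y q (y j)) * Z j p f) - (\<Sum>j\<in>I. Y p (\<lambda>q. X q (y j)) * Z j p f)"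
        using sym[of f] by linarith
      also have "\<dots> = (\<Sum>j\<in>I. (X p (\<lambda>q. Y q (y j)) - Y p (\<lambda>q. X q (y j))) * Z j p f)"
        by (simp only: left_diff_distrib sum_subtractf)
      finally show ?thesis .
    qed
    then have "lie_bracket X Y p = (\<lambda>f. \<Sum>j\<in>I. (X p (\<lambda>q. Y q (y j)) - Y p (\<lambda>q. X q (y j))) * Z j p f)" by (rule ext)
    moreover have "(\<lambda>f. \<Sum>j\<in>I. (X p (\<lambda>q. Y q (y j)) - Y p (\<lambda>q. X q (y j))) * Z j p f) \<in> tangent_space A p"
      by (rule tangent_space_sum[OF A t[OF N(5)]])
    ultimately show ?thesis by (simp only:)
  qed
  moreover have "(\<lambda>p. lie_bracket X Y p f) \<in> smooth_funs A" for f
    unfolding lie_bracket_def by (intro smooth_funs_diff s[OF X] s[OF Y])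
  ultimately show ?thesis by (simp add: vector_fields_def)
qed

section \<open>Cartan calculus of 1-forms\<close>

lemma form_linear:
  assumes "\<omega> \<in> forms A k" "vs \<in> tangent_lists A k p" "i < k" "u \<in> tangent_space A p" "w \<in> tangent_space A p"
  shows "\<omega> p (vs[i := (\<lambda>f. a * u f + b * w f)]) = a * \<omega> p (vs[i := u]) + b * \<omega> p (vs[i := w])"
proof -
  have "\<forall>p. \<forall>vs\<in>tangent_lists A k p. \<forall>i<k. \<forall>u\<in>tangent_space A p. \<forall>w\<in>tangent_space A p. \<forall>a b.
      \<omega> p (vs[i := (\<lambda>f. a * u f + b * w f)]) = a * \<omega> p (vs[i := u]) + b * \<omega> p (vs[i := w])"
    using assms(1) unfolding forms_def mem_Collect_eq by (elim conjE) assumption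
  then show ?thesis using assms(2-) by simp
qed

lemma form1_lincomb:
  assumes "\<omega> \<in> forms A 1" "u \<in> tangent_space A p" "w \<in> tangent_space A p"
  shows "\<omega> p [\<lambda>f. a * u f + b * w f] = a * \<omega> p [u] + b * \<omega> p [w]"
proof -
  have "[u] \<in> tangent_lists A 1 p" using assms(2) by (simp add: tangent_lists_def)
  then have "\<omega> p ([u][0 := (\<lambda>f. a * u f + b * w f)]) = a * \<omega> p ([u][0 := u]) + b * \<omega> p ([u][0 := w])"
    by (rule form_linear[OF assms(1) _ _ assms(2,3)]) simp_all
  then show ?thesis by simp
qed

lemma form_last_lincomb:
  assumes "\<omega> \<in> forms A (Suc (length vs))" "set vs \<subseteq> tangent_space A p" "u \<in> tangent_space A p" "w \<in> tangent_space A p"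
  shows "\<omega> p (vs @ [\<lambda>f. a * u f + b * w f]) = a * \<omega> p (vs @ [u]) + b * \<omega> p (vs @ [w])"
proof -
  have "vs @ [u] \<in> tangent_lists A (Suc (length vs)) p" using assms(2,3) by (simp add: tangent_lists_def)
  then have "\<omega> p ((vs @ [u])[length vs := (\<lambda>f. a * u f + b * w f)])
      = a * \<omega> p ((vs @ [u])[length vs := u]) + b * \<omega> p ((vs @ [u])[length vs := w])"
    by (rule form_linear[OF assms(1) _ _ assms(3,4)]) simp_all
  then show ?thesis by simp
qed

lemma form_off_tangent_lists: "\<omega> \<in> forms A k \<Longrightarrow> vs \<notin> tangent_lists A k p \<Longrightarrow> \<omega> p vs = 0"
  unfolding forms_def mem_Collect_eq by (elim conjE) simp

lemma form_smooth:
  assumes "\<omega> \<in> forms A (length Xs)" "set Xs \<subseteq> vector_fields A"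
  shows "(\<lambda>p. \<omega> p (map (\<lambda>X. X p) Xs)) \<in> smooth_funs A"
proof -
  have "\<forall>Xs. length Xs = k \<and> set Xs \<subseteq> vector_fields A \<longrightarrow> (\<lambda>p. \<omega> p (map (\<lambda>X. X p) Xs)) \<in> smooth_funs A"
    if "\<omega> \<in> forms A k" for k
    using that unfolding forms_def mem_Collect_eq by (elim conjE) assumption
  then show ?thesis using assms by simp
qed

lemma form1_smooth: "\<omega> \<in> forms A 1 \<Longrightarrow> X \<in> vector_fields A \<Longrightarrow> (\<lambda>p. \<omega> p [X p]) \<in> smooth_funs A"
  and form2_smooth: "\<alpha> \<in> forms A 2 \<Longrightarrow> X \<in> vector_fields A \<Longrightarrow> Y \<in> vector_fields A
    \<Longrightarrow> (\<lambda>p. \<alpha> p [X p, Y p]) \<in> smooth_funs A"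
  and form3_smooth: "\<beta> \<in> forms A 3 \<Longrightarrow> X \<in> vector_fields A \<Longrightarrow> Y \<in> vector_fields A \<Longrightarrow> Z \<in> vector_fields A
    \<Longrightarrow> (\<lambda>p. \<beta> p [X p, Y p, Z p]) \<in> smooth_funs A"
  using form_smooth[of \<omega> A "[X]"] form_smooth[of \<alpha> A "[X, Y]"] form_smooth[of \<beta> A "[X, Y, Z]"]
  by (simp_all add: eval_nat_numeral)

lemma form2_lincomb:
  assumes "\<alpha> \<in> forms A 2" "x \<in> tangent_space A p" "u \<in> tangent_space A p" "w \<in> tangent_space A p"
  shows "\<alpha> p [x, \<lambda>f. a * u f + b * w f] = a * \<alpha> p [x, u] + b * \<alpha> p [x, w]"
  using form_last_lincomb[of \<alpha> A "[x]" p u w a b] assms by (simp add: eval_nat_numeral)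

lemma form3_lincomb:
  assumes "\<beta> \<in> forms A 3" "x \<in> tangent_space A p" "y \<in> tangent_space A p" "u \<in> tangent_space A p" "w \<in> tangent_space A p"
  shows "\<beta> p [x, y, \<lambda>f. a * u f + b * w f] = a * \<beta> p [x, y, u] + b * \<beta> p [x, y, w]"
  using form_last_lincomb[of \<beta> A "[x, y]" p u w a b] assms by (simp add: eval_nat_numeral)

lemma form_last_zero:
  assumes A: "compatible_atlas A" and "\<omega> \<in> forms A (Suc (length vs))" "set vs \<subseteq> tangent_space A p"
  shows "\<omega> p (vs @ [\<lambda>f. 0]) = 0"
  using form_last_lincomb[OF assms(2,3) tangent_space_zero[OF A] tangent_space_zero[OF A], of 0 0] by simp

lemma form1_zero:
  assumes A: "compatible_atlas A" shows "\<omega> \<in> forms A 1 \<Longrightarrow> \<omega> p [\<lambda>f. 0] = 0"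
  using form_last_zero[OF A, of \<omega> "[]" p] by simp

lemma form2_zero:
  assumes A: "compatible_atlas A" shows "\<alpha> \<in> forms A 2 \<Longrightarrow> x \<in> tangent_space A p \<Longrightarrow> \<alpha> p [x, \<lambda>f. 0] = 0"
  using form_last_zero[OF A, of \<alpha> "[x]" p] by (simp add: eval_nat_numeral)

lemma form3_zero:
  assumes A: "compatible_atlas A"
  shows "\<beta> \<in> forms A 3 \<Longrightarrow> x \<in> tangent_space A p \<Longrightarrow> y \<in> tangent_space A p \<Longrightarrow> \<beta> p [x, y, \<lambda>f. 0] = 0"
  using form_last_zero[OF A, of \<beta> "[x, y]" p] by (simp add: eval_nat_numeral)

lemma form1_sum:
  assumes A: "compatible_atlas A" and w: "\<omega> \<in> forms A 1" and "\<And>i. i \<in> I \<Longrightarrow> v i \<in> tangent_space A p"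
  shows "\<omega> p [\<lambda>f. \<Sum>i\<in>I. c i * v i f] = (\<Sum>i\<in>I. c i * \<omega> p [v i])"
  using assms(3)
proof (induction I rule: infinite_finite_induct)
  case (insert x F)
  then show ?case
    using form1_lincomb[OF w, of "v x" p "\<lambda>f. \<Sum>i\<in>F. c i * v i f" "c x" 1] tangent_space_sum[OF A, of F v p c] by simp
qed (simp_all add: form1_zero[OF A w])

section \<open>Exterior and Lie derivative in terms of vector fields\<close>

definition d1 :: "'a form \<Rightarrow> 'a vfield \<Rightarrow> 'a vfield \<Rightarrow> 'a \<Rightarrow> real" where
  "d1 \<omega> X Y p = X p (\<lambda>q. \<omega> q [Y q]) - Y p (\<lambda>q. \<omega> q [X q]) - \<omega> p [lie_bracket X Y p]"

definition lie1 :: "'a vfield \<Rightarrow> 'a form \<Rightarrow> 'a vfield \<Rightarrow> 'a \<Rightarrow> real" where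
  "lie1 U \<omega> W p = U p (\<lambda>q. \<omega> q [W q]) - \<omega> p [lie_bracket U W p]"

text \<open>Cartan's formula; it reduces the tensoriality of the Lie derivative to that of
  \<open>d1\<close>.\<close>

lemma lie1_eq_d1: "lie1 U \<omega> W p = d1 \<omega> U W p + W p (\<lambda>q. \<omega> q [U q])"
  by (simp add: d1_def lie1_def)

lemma d_formula_eq_d1: "d_formula \<omega> [X, Y] p = d1 \<omega> X Y p"
  by (simp add: d_formula_def d1_def drop_nth_def lessThan_Suc)

lemma lie_formula_eq_lie1: "lie_formula U \<omega> [W] p = lie1 U \<omega> W p"
  by (simp add: lie_formula_def lie1_def)

lemma lie_bracket_lincomb:
  assumes A: "compatible_atlas A" and "X \<in> vector_fields A" "Y \<in> vector_fields A" "Z \<in> vector_fields A"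
  shows "lie_bracket X (\<lambda>p f. a * Y p f + b * Z p f) p = (\<lambda>f. a * lie_bracket X Y p f + b * lie_bracket X Z p f)"
proof
  fix f
  have s: "(\<lambda>p. Y p f) \<in> smooth_funs A" "(\<lambda>p. Z p f) \<in> smooth_funs A" using assms vector_field_smooth by blast+
  have "X p (\<lambda>q. a * Y q f + b * Z q f) = a * X p (\<lambda>q. Y q f) + b * X p (\<lambda>q. Z q f)"
    using tangent_vector_add[OF A vector_fieldsD(1)[OF assms(2)] smooth_funs_mult[OF smooth_funs_const s(1)]
        smooth_funs_mult[OF smooth_funs_const s(2)]]
      tangent_vector_cmult[OF A vector_fieldsD(1)[OF assms(2)]] s by simp
  then show "lie_bracket X (\<lambda>p f. a * Y p f + b * Z p f) p f = a * lie_bracket X Y p f + b * lie_bracket X Z p f"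
    by (simp add: lie_bracket_def algebra_simps)
qed

lemma vector_fields_lincomb:
  assumes A: "compatible_atlas A" and "Y \<in> vector_fields A" "Z \<in> vector_fields A"
  shows "(\<lambda>p f. a * Y p f + b * Z p f) \<in> vector_fields A"
  using vector_fields_add[OF A vector_fields_scale[OF A smooth_funs_const assms(2)]
      vector_fields_scale[OF A smooth_funs_const assms(3)]] .

lemma d1_lincomb:
  fixes A :: "('a::t2_space, 'b::real_inner) atlas"
  assumes A: "compatible_atlas A" and w: "\<omega> \<in> forms A 1"
    and X: "X \<in> vector_fields A" and Y: "Y \<in> vector_fields A" and Z: "Z \<in> vector_fields A"
  shows "d1 \<omega> X (\<lambda>p f. a * Y p f + b * Z p f) p = a * d1 \<omega> X Y p + b * d1 \<omega> X Z p"
proof -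
  note t = vector_fieldsD(1) and s = form1_smooth[OF w]
  have "X p (\<lambda>q. \<omega> q [\<lambda>f. a * Y q f + b * Z q f]) = X p (\<lambda>q. a * \<omega> q [Y q] + b * \<omega> q [Z q])"
    using form1_lincomb[OF w t[OF Y] t[OF Z]] by simp
  also have "\<dots> = a * X p (\<lambda>q. \<omega> q [Y q]) + b * X p (\<lambda>q. \<omega> q [Z q])"
    using tangent_vector_add[OF A t[OF X] smooth_funs_mult[OF smooth_funs_const s[OF Y]] smooth_funs_mult[OF smooth_funs_const s[OF Z]]]
      tangent_vector_cmult[OF A t[OF X]] s[OF Y] s[OF Z] by simp
  finally show ?thesis
    using form1_lincomb[OF w t[OF lie_bracket_vector_fields[OF A X Y]] t[OF lie_bracket_vector_fields[OF A X Z]]]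
    by (simp add: d1_def lie_bracket_lincomb[OF A X Y Z] algebra_simps)
qed

lemma d1_antisym:
  fixes A :: "('a::t2_space, 'b::real_inner) atlas"
  assumes A: "compatible_atlas A" and w: "\<omega> \<in> forms A 1"
    and X: "X \<in> vector_fields A" and Y: "Y \<in> vector_fields A"
  shows "d1 \<omega> Y X p = - d1 \<omega> X Y p"
proof -
  note b = vector_fieldsD(1)[OF lie_bracket_vector_fields[OF A X Y]]
  have "lie_bracket Y X p = (\<lambda>f. (-1) * lie_bracket X Y p f + 0 * lie_bracket X Y p f)"
    by (auto simp: lie_bracket_def)
  then have "\<omega> p [lie_bracket Y X p] = - \<omega> p [lie_bracket X Y p]"
    using form1_lincomb[OF w b b, of p "-1" 0] by simp
  then show ?thesis by (simp add: d1_def)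
qed

text \<open>If \<open>X\<close> vanishes at \<open>p\<close>, then in a local frame both the
  derivative of \<open>\<omega>(X)\<close> along \<open>Y\<close> and
  \<open>\<omega>([X, Y])\<close> involve only the derivatives along \<open>Y\<close> of the
  coefficients of \<open>X\<close>, and the two contributions cancel.\<close>

lemma d1_tensorial:
  fixes A :: "('a::t2_space, 'b::real_inner) atlas"
  assumes A: "compatible_atlas A" and w: "\<omega> \<in> forms A 1"
    and X: "X \<in> vector_fields A" and Y: "Y \<in> vector_fields A" and X0: "X p = (\<lambda>f. 0)"
  shows "d1 \<omega> X Y p = 0"
proof -
  note t = vector_fieldsD(1) and s = form1_smooth[OF w] and v = vector_field_smooth
  obtain N and I :: "'b set" and y Z where N: "open N" "p \<in> N" "finite I"
    "\<And>i. i \<in> I \<Longrightarrow> y i \<in> smooth_funs A" "\<And>i. i \<in> I \<Longrightarrow> Z i \<in> vector_fields A"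
    "\<And>q v. q \<in> N \<Longrightarrow> v \<in> tangent_space A q \<Longrightarrow> v = (\<lambda>f. \<Sum>i\<in>I. v (y i) * Z i q f)"
    "\<And>q i j f. q \<in> N \<Longrightarrow> i \<in> I \<Longrightarrow> j \<in> I \<Longrightarrow> Z i q (\<lambda>r. Z j r f) = Z j q (\<lambda>r. Z i r f)"
    by (rule local_frame[OF A, where p=p]) blast
  \<comment> \<open>The coefficients \<open>X q (y i)\<close> vanish at \<open>p\<close>, so the
    product rule keeps only their derivatives. Stated for general \<open>G\<close> because it serves
    for \<open>\<omega> q [X q]\<close> and for \<open>X q f\<close>.\<close>
  have *: "Y p h = (\<Sum>i\<in>I. Y p (\<lambda>q. X q (y i)) * G i p)"
    if "h \<in> smooth_funs A" "\<And>i. i \<in> I \<Longrightarrow> G i \<in> smooth_funs A" "\<And>q. q \<in> N \<Longrightarrow> h q = (\<Sum>i\<in>I. X q (y i) * G i q)" for h G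
  proof -
    have "Y p h = Y p (\<lambda>q. \<Sum>i\<in>I. X q (y i) * G i q)"
      by (rule tangent_vector_local[OF A t[OF Y] that(1) _ N(1,2) that(3)])
         (intro smooth_funs_sum smooth_funs_mult v[OF X] that(2))
    also have "\<dots> = (\<Sum>i\<in>I. Y p (\<lambda>q. X q (y i) * G i q))"
      by (intro tangent_vector_sum[OF A t[OF Y]] smooth_funs_mult v[OF X] that(2))
    also have "\<dots> = (\<Sum>i\<in>I. Y p (\<lambda>q. X q (y i)) * G i p)"
      using tangent_vector_mult[OF A t[OF Y] v[OF X] that(2)] X0 by (intro sum.cong refl) simp
    finally show ?thesis .
  qed
  have 1: "Y p (\<lambda>q. \<omega> q [X q]) = (\<Sum>i\<in>I. Y p (\<lambda>q. X q (y i)) * \<omega> p [Z i p])"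
  proof (rule *[OF s[OF X]])
    show "(\<lambda>q. \<omega> q [Z i q]) \<in> smooth_funs A" if "i \<in> I" for i by (rule s[OF N(5)[OF that]])
    show "\<omega> q [X q] = (\<Sum>i\<in>I. X q (y i) * \<omega> q [Z i q])" if "q \<in> N" for q
      using form1_sum[OF A w, of I "\<lambda>i. Z i q" q "\<lambda>i. X q (y i)"] t[OF N(5)]
      by (subst N(6)[OF that t[OF X]]) simp
  qed
  have 2: "Y p (\<lambda>q. X q f) = (\<Sum>i\<in>I. Y p (\<lambda>q. X q (y i)) * Z i p f)" for f
    by (rule *[OF v[OF X] v[OF N(5)] fun_cong[OF N(6)[OF _ t[OF X]]]])
  have "lie_bracket X Y p = (\<lambda>f. \<Sum>i\<in>I. (- Y p (\<lambda>q. X q (y i))) * Z i p f)"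
  proof
    fix f
    have "lie_bracket X Y p f = - Y p (\<lambda>q. X q f)" by (simp add: lie_bracket_def X0)
    then show "lie_bracket X Y p f = (\<Sum>i\<in>I. (- Y p (\<lambda>q. X q (y i))) * Z i p f)"
      using 2[of f] by (simp add: sum_negf)
  qed
  then have "\<omega> p [lie_bracket X Y p] = (\<Sum>i\<in>I. (- Y p (\<lambda>q. X q (y i))) * \<omega> p [Z i p])"
    using form1_sum[OF A w, of I "\<lambda>i. Z i p" p "\<lambda>i. - Y p (\<lambda>q. X q (y i))"] t[OF N(5)] by (simp only:)
  then show ?thesis by (simp add: d1_def X0 1 sum_negf)
qed

lemma d1_tensorial_right:
  fixes A :: "('a::t2_space, 'b::real_inner) atlas"
  assumes "compatible_atlas A" "\<omega> \<in> forms A 1" "X \<in> vector_fields A" "Y \<in> vector_fields A" "Y p = (\<lambda>f. 0)"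
  shows "d1 \<omega> X Y p = 0"
  using d1_tensorial[OF assms(1,2,4,3,5)] d1_antisym[OF assms(1,2,4,3), of p] by simp

text \<open>Linearity turns the difference of the two values into the value on \<open>Z - W\<close>,
  a field that vanishes at \<open>p\<close>.\<close>

lemma pointwise_of_tensorial:
  assumes A: "compatible_atlas A"
    and lin: "\<And>Z W a b. Z \<in> vector_fields A \<Longrightarrow> W \<in> vector_fields A
        \<Longrightarrow> \<Phi> (\<lambda>p f. a * Z p f + b * W p f) p = a * \<Phi> Z p + b * (\<Phi> W p :: real)"
    and zero: "\<And>Z. Z \<in> vector_fields A \<Longrightarrow> Z p = (\<lambda>f. 0) \<Longrightarrow> \<Phi> Z p = 0"
    and Z: "Z \<in> vector_fields A" "W \<in> vector_fields A" "Z p = W p"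
  shows "\<Phi> Z p = \<Phi> W p"
proof -
  have "\<Phi> (\<lambda>p f. 1 * Z p f + (-1) * W p f) p = 0"
    by (intro zero vector_fields_lincomb[OF A] Z) (simp add: Z(3))
  then show ?thesis using lin[OF Z(1,2), of 1 "-1"] by simp
qed

text \<open>The chosen extensions are exchanged for the given fields one slot at a time.
  Antisymmetry moves the first slot into the second, where linearity and tensoriality are
  available.\<close>

lemma ext_deriv1_eq:
  fixes A :: "('a::t2_space, 'b::real_inner) atlas"
  assumes A: "compatible_atlas A" and w: "\<omega> \<in> forms A 1" and X: "X \<in> vector_fields A" and Y: "Y \<in> vector_fields A"
  shows "ext_deriv A 1 \<omega> p [X p, Y p] = d1 \<omega> X Y p"
proof -
  note t = vector_fieldsD(1) and e = extension_vector_field[OF A]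
  note x = e[OF t[OF X]] and y = e[OF t[OF Y]]
  have "ext_deriv A 1 \<omega> p [X p, Y p] = d1 \<omega> (extension A p (X p)) (extension A p (Y p)) p"
    using t[OF X, of p] t[OF Y, of p] by (simp add: ext_deriv_def tangent_lists_def d_formula_eq_d1)
  also have "\<dots> = d1 \<omega> (extension A p (X p)) Y p"
    by (rule pointwise_of_tensorial[OF A, where \<Phi>="d1 \<omega> (extension A p (X p))"])
      (auto intro!: d1_lincomb[OF A w] d1_tensorial_right[OF A w] x(1) y Y)
  also have "\<dots> = - d1 \<omega> Y (extension A p (X p)) p" by (rule d1_antisym[OF A w Y x(1)])
  also have "\<dots> = - d1 \<omega> Y X p"
    by (intro arg_cong[where f=uminus] pointwise_of_tensorial[OF A, where \<Phi>="d1 \<omega> Y"])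
      (auto intro!: d1_lincomb[OF A w] d1_tensorial_right[OF A w] x Y X)
  also have "\<dots> = d1 \<omega> X Y p" using d1_antisym[OF A w X Y, of p] by simp
  finally show ?thesis .
qed

lemma lie1_lincomb:
  fixes A :: "('a::t2_space, 'b::real_inner) atlas"
  assumes A: "compatible_atlas A" and w: "\<omega> \<in> forms A 1"
    and X: "X \<in> vector_fields A" and Y: "Y \<in> vector_fields A" and Z: "Z \<in> vector_fields A"
  shows "lie1 X \<omega> (\<lambda>p f. a * Y p f + b * Z p f) p = a * lie1 X \<omega> Y p + b * lie1 X \<omega> Z p"
  by (simp add: lie1_eq_d1 d1_lincomb[OF assms] algebra_simps)

lemma lie1_tensorial:
  fixes A :: "('a::t2_space, 'b::real_inner) atlas"
  assumes "compatible_atlas A" "\<omega> \<in> forms A 1" "X \<in> vector_fields A" "Y \<in> vector_fields A" "Y p = (\<lambda>f. 0)"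
  shows "lie1 X \<omega> Y p = 0"
  by (simp add: lie1_eq_d1 d1_tensorial_right[OF assms] assms(5))

lemma lie_deriv1_eq:
  fixes A :: "('a::t2_space, 'b::real_inner) atlas"
  assumes A: "compatible_atlas A" and w: "\<omega> \<in> forms A 1" and U: "U \<in> vector_fields A" and W: "W \<in> vector_fields A"
  shows "lie_deriv A 1 U \<omega> p [W p] = lie1 U \<omega> W p"
proof -
  note e = extension_vector_field[OF A vector_fieldsD(1)[OF W]]
  have "lie_deriv A 1 U \<omega> p [W p] = lie1 U \<omega> (extension A p (W p)) p"
    using vector_fieldsD(1)[OF W, of p] by (simp add: lie_deriv_def tangent_lists_def lie_formula_eq_lie1)
  also have "\<dots> = lie1 U \<omega> W p"
    by (rule pointwise_of_tensorial[OF A, where \<Phi>="lie1 U \<omega>"])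
      (auto intro!: lie1_lincomb[OF A w] lie1_tensorial[OF A w] e U W)
  finally show ?thesis .
qed

lemma lie1_smooth:
  fixes A :: "('a::t2_space, 'b::real_inner) atlas"
  assumes A: "compatible_atlas A" and w: "\<omega> \<in> forms A 1" and U: "U \<in> vector_fields A" and W: "W \<in> vector_fields A"
  shows "lie1 U \<omega> W \<in> smooth_funs A"
  unfolding lie1_def[abs_def]
  by (intro smooth_funs_diff vector_field_smooth[OF U] form1_smooth[OF w] lie_bracket_vector_fields[OF A] U W)

lemma d1_smooth:
  fixes A :: "('a::t2_space, 'b::real_inner) atlas"
  assumes A: "compatible_atlas A" and w: "\<omega> \<in> forms A 1" and U: "U \<in> vector_fields A" and W: "W \<in> vector_fields A"
  shows "d1 \<omega> U W \<in> smooth_funs A"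
  unfolding d1_def[abs_def]
  by (intro smooth_funs_diff vector_field_smooth[OF U] vector_field_smooth[OF W] form1_smooth[OF w]
      lie_bracket_vector_fields[OF A] U W)

section \<open>One-forms from tensorial functionals\<close>

lemma form1I:
  assumes off: "\<And>p vs. vs \<notin> tangent_lists A 1 p \<Longrightarrow> \<omega> p vs = 0"
    and lin: "\<And>p u w a b. u \<in> tangent_space A p \<Longrightarrow> w \<in> tangent_space A p
        \<Longrightarrow> \<omega> p [\<lambda>f. a * u f + b * w f] = a * \<omega> p [u] + b * \<omega> p [w]"
    and smooth: "\<And>X. X \<in> vector_fields A \<Longrightarrow> (\<lambda>p. \<omega> p [X p]) \<in> smooth_funs A"
  shows "\<omega> \<in> forms A 1"
proof -
  have "\<omega> p (vs[i := (\<lambda>f. a * u f + b * w f)]) = a * \<omega> p (vs[i := u]) + b * \<omega> p (vs[i := w])"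
    if "vs \<in> tangent_lists A 1 p" "i < 1" "u \<in> tangent_space A p" "w \<in> tangent_space A p" for p vs i u w a b
    using that lin[OF that(3,4)] by (auto simp: tangent_lists_def length_Suc_conv)
  moreover have "(\<lambda>p. \<omega> p (map (\<lambda>X. X p) Xs)) \<in> smooth_funs A"
    if Xs: "length Xs = 1" "set Xs \<subseteq> vector_fields A" for Xs
  proof -
    obtain X where X: "Xs = [X]" "X \<in> vector_fields A" using Xs by (auto simp: length_Suc_conv)
    then show ?thesis using smooth[OF X(2)] by simp
  qed
  ultimately show ?thesis using off unfolding forms_def by auto
qed

text \<open>The value on a tangent vector is read off an arbitrary extension. This is meaningful
  when \<open>\<Phi>\<close> is linear and vanishes on fields that are zero at the point, as the
  next lemma assumes.\<close>

definition form1_of ::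
  "('a::topological_space, 'b::real_inner) atlas \<Rightarrow> ('a vfield \<Rightarrow> 'a \<Rightarrow> real) \<Rightarrow> 'a form" where
  "form1_of A \<Phi> = (\<lambda>p vs. if vs \<in> tangent_lists A 1 p then \<Phi> (extension A p (hd vs)) p else 0)"

lemma form1_of:
  fixes A :: "('a::t2_space, 'b::real_inner) atlas"
  assumes A: "compatible_atlas A"
    and lin: "\<And>Z W a b p. Z \<in> vector_fields A \<Longrightarrow> W \<in> vector_fields A
        \<Longrightarrow> \<Phi> (\<lambda>p f. a * Z p f + b * W p f) p = a * \<Phi> Z p + b * \<Phi> W p"
    and zero: "\<And>Z p. Z \<in> vector_fields A \<Longrightarrow> Z p = (\<lambda>f. 0) \<Longrightarrow> \<Phi> Z p = 0"
    and smooth: "\<And>Z. Z \<in> vector_fields A \<Longrightarrow> \<Phi> Z \<in> smooth_funs A"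
  shows "form1_of A \<Phi> \<in> forms A 1" and "\<And>Z p. Z \<in> vector_fields A \<Longrightarrow> form1_of A \<Phi> p [Z p] = \<Phi> Z p"
proof -
  note e = extension_vector_field[OF A]
  have eval: "form1_of A \<Phi> p [Z p] = \<Phi> Z p" if "Z \<in> vector_fields A" for Z p
    using vector_fieldsD(1)[OF that, of p] e[OF vector_fieldsD(1)[OF that]]
      pointwise_of_tensorial[OF A, of \<Phi> p "extension A p (Z p)" Z] lin zero that
    by (simp add: form1_of_def tangent_lists_def)
  show "form1_of A \<Phi> p [Z p] = \<Phi> Z p" if "Z \<in> vector_fields A" for Z p by (rule eval[OF that])
  have linear: "form1_of A \<Phi> p [\<lambda>f. a * u f + b * w f] = a * form1_of A \<Phi> p [u] + b * form1_of A \<Phi> p [w]"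
    if u: "u \<in> tangent_space A p" and w: "w \<in> tangent_space A p" for p u w a b
  proof -
    note eu = e[OF u] and ew = e[OF w]
    \<comment> \<open>A combination of two tangent vectors is extended by the same combination of
      their extensions, so that \<open>lin\<close> applies.\<close>
    have "form1_of A \<Phi> p [\<lambda>f. a * extension A p u p f + b * extension A p w p f]
      = a * \<Phi> (extension A p u) p + b * \<Phi> (extension A p w) p"
      using eval[OF vector_fields_lincomb[OF A eu(1) ew(1)]] lin[OF eu(1) ew(1)] by simp
    then show ?thesis using eval[OF eu(1), of p] eval[OF ew(1), of p] eu(2) ew(2) by simp
  qed
  show "form1_of A \<Phi> \<in> forms A 1"
    using linear smooth eval by (intro form1I) (auto simp: form1_of_def)
qed

section \<open>The Dorfman bracket evaluated on vector fields\<close>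

lemma dorfman_form_eq:
  fixes A :: "('a::t2_space, 'b::real_inner) atlas"
  assumes A: "compatible_atlas A" and "\<xi> \<in> forms A 1" "\<zeta> \<in> forms A 1"
    and "U \<in> vector_fields A" "V \<in> vector_fields A" "W \<in> vector_fields A"
  shows "snd (dorfman A \<eta> (U, \<xi>) (V, \<zeta>)) p [W p] = lie1 U \<zeta> W p - d1 \<xi> V W p - \<eta> p [U p, V p, W p]"
  using lie_deriv1_eq[OF A assms(3,4,6)] ext_deriv1_eq[OF A assms(2,5,6)]
  by (simp add: dorfman_def interior_prod_def)

text \<open>Equality of forms covers all lists, including those where the zero convention applies.
  Prepending one vector to a list that is not a single tangent vector never produces a valid
  argument of a 2-form, and likewise for two vectors and a 3-form.\<close>

lemma dorfman_form_off:
  assumes "U \<in> vector_fields A" "V \<in> vector_fields A" "\<eta> \<in> forms A 3" "vs \<notin> tangent_lists A 1 p"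
  shows "snd (dorfman A \<eta> (U, \<xi>) (V, \<zeta>)) p vs = 0"
proof -
  have "V p # vs \<notin> tangent_lists A 2 p" "U p # V p # vs \<notin> tangent_lists A 3 p"
    using assms(4) by (auto simp: tangent_lists_def)
  then show ?thesis using assms(4) form_off_tangent_lists[OF assms(3)]
    by (simp add: dorfman_def interior_prod_def lie_deriv_def ext_deriv_def eval_nat_numeral)
qed

section \<open>Coordinates adapted to a principal circle bundle\<close>

definition arc :: "real \<Rightarrow> complex set" where
  "arc a = cis ` {a<..<a + 2 * pi}"

definition angle :: "real \<Rightarrow> complex \<Rightarrow> real" where
  "angle a = inv_into {a<..<a + 2 * pi} cis"

lemma circle_atlas_arc: "(arc a, angle a) \<in> circle_atlas"
  unfolding circle_atlas_def arc_def angle_def by blast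

lemma mem_circle: "z \<in> circle \<longleftrightarrow> norm z = 1"
  by (simp add: circle_def)

lemma cis_in_circle [simp]: "cis t \<in> circle"
  by (simp add: mem_circle)

lemma cis_eq_imp_diff:
  assumes "cis s = cis t" "\<bar>s - t\<bar> < 2 * pi"
  shows "s = t"
proof -
  have "cis (s - t) = 1" using assms(1) by (simp add: cis_divide[symmetric])
  then have "cos (s - t) = 1" by (simp add: complex_eq_iff)
  then obtain n :: int where n: "s - t = real_of_int n * 2 * pi" using cos_one_2pi_int by blast
  then have "\<bar>real_of_int n\<bar> * (2 * pi) < 1 * (2 * pi)" using assms(2) by (simp add: abs_mult)
  then have "\<bar>real_of_int n\<bar> < 1" by simp
  then have "n = 0" by linarith
  then show ?thesis using n by simp
qed

lemma inj_on_cis: "inj_on cis {a<..<a + 2 * pi}"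
  by (rule inj_onI, rule cis_eq_imp_diff) auto

lemma angle_cis: "t \<in> {a<..<a + 2 * pi} \<Longrightarrow> angle a (cis t) = t"
  unfolding angle_def by (rule inv_into_f_f[OF inj_on_cis])

lemma angle_arc:
  assumes "z \<in> arc a"
  shows "angle a z \<in> {a<..<a + 2 * pi}" "cis (angle a z) = z"
  using assms angle_cis unfolding arc_def by auto

text \<open>Exhibits arcs as relatively open in the circle, which their definition as an image
  hides.\<close>

lemma arc_eq: "arc a = circle - {cis a}"
proof
  show "arc a \<subseteq> circle - {cis a}"
  proof
    fix z assume "z \<in> arc a"
    then obtain t where t: "z = cis t" "t \<in> {a<..<a + 2 * pi}" unfolding arc_def by blast
    then have "z \<noteq> cis a" using cis_eq_imp_diff[of t a] by auto
    then show "z \<in> circle - {cis a}" using t by simp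
  qed
  show "circle - {cis a} \<subseteq> arc a"
  proof
    fix z assume z: "z \<in> circle - {cis a}"
    \<comment> \<open>Rotating by \<open>- a\<close> moves the excluded point to angle 0, where
      \<open>Arg2pi\<close> has its cut.\<close>
    define t where "t = a + Arg2pi (z * cis (- a))"
    have "norm (z * cis (- a)) = 1" using z by (simp add: mem_circle norm_mult)
    then have "cis (t - a) = z * cis (- a)"
      unfolding complex_norm_eq_1_exp by (simp add: t_def cis_conv_exp)
    then have "cis (t - a) * cis a = z" by (simp add: cis_mult mult.assoc)
    then have zt: "z = cis t" by (simp add: cis_mult)
    have "t \<noteq> a" using z zt by auto
    then have "t \<in> {a<..<a + 2 * pi}" using Arg2pi[of "z * cis (- a)"] by (auto simp: t_def)
    then show "z \<in> arc a" unfolding arc_def using zt by blast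
  qed
qed

lemma cis_in_arc: "t \<in> {a<..<a + 2 * pi} \<Longrightarrow> cis t \<in> arc a"
  by (simp add: arc_def)

text \<open>The arcs starting at the angles \<open>0\<close> and \<open>pi\<close> already cover the
  circle.\<close>

lemma in_arc_some:
  assumes "z \<in> circle"
  shows "\<exists>a. z \<in> arc a"
proof (cases "z = 1")
  case True
  then have "z \<in> arc pi" using assms by (simp add: arc_eq)
  then show ?thesis ..
next
  case False
  then have "z \<in> arc 0" using assms by (simp add: arc_eq)
  then show ?thesis ..
qed

lemma inv_into_chart_arc:
  assumes "inj_on \<phi> U" "x \<in> \<phi> ` U" "t \<in> {a<..<a + 2 * pi}"
  shows "inv_into (U \<times> arc a) (map_prod \<phi> (angle a)) (x, t) = (inv_into U \<phi> x, cis t)"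
proof -
  have "inj_on (angle a) (arc a)" by (rule inj_on_inverseI[of _ cis]) (rule angle_arc)
  then have "inj_on (map_prod \<phi> (angle a)) (U \<times> arc a)" using assms(1) by (simp add: map_prod_inj_on)
  moreover have "map_prod \<phi> (angle a) (inv_into U \<phi> x, cis t) = (x, t)"
    using assms by (simp add: f_inv_into_f angle_cis)
  moreover have "(inv_into U \<phi> x, cis t) \<in> U \<times> arc a"
    using assms by (simp add: inv_into_into cis_in_arc)
  ultimately show ?thesis by (metis inv_into_f_f)
qed

section \<open>Action and projection of a principal circle bundle\<close>

locale principal_bundle =
  fixes M :: "('m::{t2_space,second_countable_topology}, 'n::real_inner) atlas"
    and P :: "('e::{t2_space,second_countable_topology}, 'b::real_inner, 'm) circle_bundle"
  assumes principal: "principal_circle_bundle M P"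
begin

lemma M_atlas: "compatible_atlas M" and P_atlas: "compatible_atlas (tot P)"
  using principal smooth_manifold_compatible unfolding principal_circle_bundle_def by auto

lemma prj_smooth: "smooth_map_on (tot P) M UNIV (prj P)"
  and act_smooth_prod: "smooth_map_on (prod_atlas (tot P) circle_atlas) (tot P) (UNIV \<times> circle) (\<lambda>(e, z). act P e z)"
  and act_1: "act P e 1 = e"
  and prj_act: "z \<in> circle \<Longrightarrow> prj P (act P e z) = prj P e"
  using principal unfolding principal_circle_bundle_def by auto

lemma local_trivialization_at:
  obtains W \<Phi> where "open W" "p \<in> W" "local_trivialization M P W \<Phi>"
proof -
  have "\<forall>p. \<exists>W \<Phi>. open W \<and> p \<in> W \<and> local_trivialization M P W \<Phi>"
    using principal by (simp add: principal_circle_bundle_def)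
  then show ?thesis using that by blast
qed

lemma local_trivializationD:
  assumes "local_trivialization M P W \<Phi>"
  shows "bij_betw \<Phi> (prj P -` W) (W \<times> circle)" "\<And>e. e \<in> prj P -` W \<Longrightarrow> fst (\<Phi> e) = prj P e"
    "\<And>e z. e \<in> prj P -` W \<Longrightarrow> z \<in> circle \<Longrightarrow> \<Phi> (act P e z) = (prj P e, snd (\<Phi> e) * z)"
    "smooth_map_on (tot P) (prod_atlas M circle_atlas) (prj P -` W) \<Phi>"
    "smooth_map_on (prod_atlas M circle_atlas) (tot P) (W \<times> circle) (inv_into (prj P -` W) \<Phi>)"
    "\<And>e. e \<in> prj P -` W \<Longrightarrow> snd (\<Phi> e) \<in> circle"
proof -
  show b: "bij_betw \<Phi> (prj P -` W) (W \<times> circle)" and "\<And>e. e \<in> prj P -` W \<Longrightarrow> fst (\<Phi> e) = prj P e"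
    and "\<And>e z. e \<in> prj P -` W \<Longrightarrow> z \<in> circle \<Longrightarrow> \<Phi> (act P e z) = (prj P e, snd (\<Phi> e) * z)"
    and "smooth_map_on (tot P) (prod_atlas M circle_atlas) (prj P -` W) \<Phi>"
    and "smooth_map_on (prod_atlas M circle_atlas) (tot P) (W \<times> circle) (inv_into (prj P -` W) \<Phi>)"
    using assms by (simp_all add: local_trivialization_def diffeomorphism_on_def)
  show "snd (\<Phi> e) \<in> circle" if "e \<in> prj P -` W" for e
    using bij_betwE[OF b] that by (metis mem_Sigma_iff prod.collapse)
qed

lemma act_continuous: "continuous_on (UNIV \<times> circle) (\<lambda>(e, z). act P e z)"
  using act_smooth_prod by (rule smooth_map_on_continuous)

text \<open>The charts of \<open>prod_atlas (tot P) circle_atlas\<close> cover only part of their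
  type, so it is not a \<open>compatible_atlas\<close> and the composition lemma does not apply to
  it. Rewritten with a real angle, the action becomes an ordinary smooth function in which either
  variable can be frozen.\<close>

lemma act_smooth_in_chart:
  fixes a :: real
  assumes U: "(U, \<phi>) \<in> tot P" and V: "(V, \<psi>) \<in> tot P"
  defines "D \<equiv> {x \<in> \<phi> ` U \<times> {a<..<a + 2 * pi}. act P (inv_into U \<phi> (fst x)) (cis (snd x)) \<in> V}"
  shows "open D" "smooth_on (\<lambda>x. \<psi> (act P (inv_into U \<phi> (fst x)) (cis (snd x)))) D"
proof -
  note c = chartD[OF P_atlas U]
  let ?I = "\<phi> ` U \<times> {a<..<a + 2 * pi}"
  have oI: "open ?I" using c(2) by (intro open_Times) auto
  have "continuous_on ?I (\<lambda>x. (inv_into U \<phi> (fst x), cis (snd x)))"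
    by (intro continuous_intros continuous_on_compose2[OF c(5)]) auto
  then have "continuous_on ?I (\<lambda>x. case (inv_into U \<phi> (fst x), cis (snd x)) of (e, z) \<Rightarrow> act P e z)"
    by (rule continuous_on_compose2[OF act_continuous]) auto
  then have "continuous_on ?I (\<lambda>x. act P (inv_into U \<phi> (fst x)) (cis (snd x)))" by simp
  then have "open ((\<lambda>x. act P (inv_into U \<phi> (fst x)) (cis (snd x))) -` V \<inter> ?I)"
    using continuous_on_open_vimage[OF oI] chartD(1)[OF P_atlas V] by blast
  moreover have "D = (\<lambda>x. act P (inv_into U \<phi> (fst x)) (cis (snd x))) -` V \<inter> ?I"
    unfolding D_def by blast
  ultimately show oD: "open D" by simp
  have "(U \<times> arc a, map_prod \<phi> (angle a)) \<in> prod_atlas (tot P) circle_atlas"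
    using U circle_atlas_arc unfolding prod_atlas_def by blast
  then have s: "smooth_on (\<psi> \<circ> (\<lambda>(e, z). act P e z) \<circ> inv_into (U \<times> arc a) (map_prod \<phi> (angle a)))
      (map_prod \<phi> (angle a) ` ((U \<times> arc a) \<inter> (UNIV \<times> circle) \<inter> (\<lambda>(e, z). act P e z) -` V))" (is "smooth_on ?f ?S")
    using act_smooth_prod V unfolding smooth_map_on_def by blast
  have "D \<subseteq> ?S"
  proof
    fix x assume x: "x \<in> D"
    then obtain p t where pt: "x = (\<phi> p, t)" "p \<in> U" "t \<in> {a<..<a + 2 * pi}" "act P p (cis t) \<in> V"
      unfolding D_def using c(3) by (auto simp: inv_into_f_f)
    have "x = map_prod \<phi> (angle a) (p, cis t)" using pt by (simp add: angle_cis)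
    moreover have "(p, cis t) \<in> (U \<times> arc a) \<inter> (UNIV \<times> circle) \<inter> (\<lambda>(e, z). act P e z) -` V"
      using pt cis_in_arc[OF pt(3)] by simp
    ultimately show "x \<in> ?S" by (rule image_eqI)
  qed
  then have "smooth_on ?f D" using s smooth_on_subset by blast
  moreover have "?f x = \<psi> (act P (inv_into U \<phi> (fst x)) (cis (snd x)))" if "x \<in> D" for x
    using that inv_into_chart_arc[OF c(3), of "fst x" "snd x" a] unfolding D_def by auto
  ultimately show "smooth_on (\<lambda>x. \<psi> (act P (inv_into U \<phi> (fst x)) (cis (snd x)))) D"
    by (rule smooth_on_eq[OF oD])
qed

lemma tot_onb:
  obtains B :: "('b \<times> real) set" where "onb B"
  using onb_prod[OF _ onb_real] compatible_atlas_onb[OF P_atlas] by metis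

lemma act_smooth:
  assumes z: "z \<in> circle"
  shows "smooth_map_on (tot P) (tot P) UNIV (\<lambda>x. act P x z)"
proof -
  obtain a where a: "z \<in> arc a" using in_arc_some[OF z] by blast
  obtain B :: "('b \<times> real) set" where B: "onb B" by (rule tot_onb)
  have "continuous_on UNIV (\<lambda>x. case (x, z) of (e, z) \<Rightarrow> act P e z)"
    by (rule continuous_on_compose2[OF act_continuous]) (use z in \<open>auto intro!: continuous_intros\<close>)
  then have cont: "continuous_on UNIV (\<lambda>x. act P x z)" by simp
  moreover have "smooth_on (\<psi> \<circ> (\<lambda>x. act P x z) \<circ> inv_into U \<phi>) (\<phi> ` (U \<inter> UNIV \<inter> (\<lambda>x. act P x z) -` V))" (is "smooth_on _ ?S")
    if U: "(U, \<phi>) \<in> tot P" and V: "(V, \<psi>) \<in> tot P" for U \<phi> V \<psi>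
  proof -
    note s = act_smooth_in_chart[OF U V, of a] and c = chartD[OF P_atlas U]
    have oS: "open ?S" by (rule chart_overlap_open[OF P_atlas U open_UNIV cont chartD(1)[OF P_atlas V]])
    have "smooth_on (\<lambda>x. (x, angle a z)) ?S" by (intro smooth_on_Pair smooth_on_id smooth_on_const)
    then have "smooth_on (\<lambda>x. \<psi> (act P (inv_into U \<phi> (fst (x, angle a z))) (cis (snd (x, angle a z))))) ?S"
      by (rule smooth_on_compose[OF B oS s(2)]) (use angle_arc[OF a] c(3) in \<open>auto simp: inv_into_f_f\<close>)
    then show ?thesis using angle_arc(2)[OF a] by (simp add: comp_def)
  qed
  ultimately show ?thesis unfolding smooth_map_on_def by auto
qed

lemma orbit_smooth: "smooth_map_on vector_space_atlas (tot P) UNIV (\<lambda>t. act P e (cis t))"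
proof -
  obtain B :: "('b \<times> real) set" where B: "onb B" by (rule tot_onb)
  have i: "inv (\<lambda>x::real. x) = (\<lambda>x. x)" using inv_id unfolding id_def .
  have "continuous_on UNIV (\<lambda>t. case (e, cis t) of (e, z) \<Rightarrow> act P e z)"
    by (rule continuous_on_compose2[OF act_continuous]) (auto intro!: continuous_intros)
  then have cont: "continuous_on UNIV (\<lambda>t. act P e (cis t))" by simp
  moreover have "smooth_on (\<lambda>t. \<psi> (act P e (cis t))) ((\<lambda>t. act P e (cis t)) -` V)" (is "smooth_on _ ?S")
    if V: "(V, \<psi>) \<in> tot P" for V \<psi>
  proof (rule smooth_on_local)
    show oS: "open ?S"
      using continuous_on_open_vimage[OF open_UNIV] cont chartD(1)[OF P_atlas V] by (metis Int_UNIV_right)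
    fix s assume s: "s \<in> ?S"
    obtain U \<phi> where U: "(U, \<phi>) \<in> tot P" "e \<in> U" using chart_at[OF P_atlas] by blast
    \<comment> \<open>The angle interval is centred at \<open>s\<close>, which makes
      \<open>s\<close> an interior point.\<close>
    note sm = act_smooth_in_chart[OF U(1) V, of "s - pi"] and c = chartD[OF P_atlas U(1)]
    let ?T = "{s - pi<..<s - pi + 2 * pi} \<inter> ?S"
    have oT: "open ?T" using oS by auto
    have "smooth_on (\<lambda>t. (\<phi> e, t)) ?T" by (intro smooth_on_Pair smooth_on_id smooth_on_const)
    then have "smooth_on (\<lambda>t. \<psi> (act P (inv_into U \<phi> (fst (\<phi> e, t))) (cis (snd (\<phi> e, t))))) ?T"
      by (rule smooth_on_compose[OF B oT sm(2)]) (use U(2) c(3) in \<open>auto simp: inv_into_f_f\<close>)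
    then have "smooth_on (\<lambda>t. \<psi> (act P e (cis t))) ?T" using U(2) c(3) by (simp add: inv_into_f_f)
    then show "\<exists>T. open T \<and> s \<in> T \<and> T \<subseteq> ?S \<and> smooth_on (\<lambda>t. \<psi> (act P e (cis t))) T"
      using oT s by (intro exI[of _ ?T]) auto
  qed
  ultimately show ?thesis by (auto simp: smooth_map_on_def vector_space_atlas_def i comp_def)
qed

lemma prj_surj: "\<exists>e. prj P e = p"
proof -
  obtain W \<Phi> where W: "open W" "p \<in> W" "local_trivialization M P W \<Phi>"
    by (rule local_trivialization_at[where p=p])
  note t = local_trivializationD[OF W(3)]
  have "(p, 1) \<in> \<Phi> ` (prj P -` W)" using t(1) W by (simp add: bij_betw_def mem_circle)
  then obtain e where "(p, 1) = \<Phi> e" "e \<in> prj P -` W" by (rule imageE)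
  then show ?thesis using t(2)[of e] by (metis fst_conv)
qed

lemma prj_fibre_point [simp]: "prj P (fibre_point P p) = p"
  unfolding fibre_point_def using someI_ex[OF prj_surj] .

text \<open>In a trivialization the required element is the quotient of the two circle
  coordinates.\<close>

lemma fibre_transitive:
  assumes "prj P x = prj P y"
  shows "\<exists>z\<in>circle. y = act P x z"
proof -
  obtain W \<Phi> where W: "open W" "prj P x \<in> W" "local_trivialization M P W \<Phi>"
    by (rule local_trivialization_at[where p="prj P x"])
  note t = local_trivializationD[OF W(3)]
  note b = t(1) and f = t(2) and a = t(3) and c = t(6)
  have xy: "x \<in> prj P -` W" "y \<in> prj P -` W" using W assms by auto
  define z where "z = snd (\<Phi> y) / snd (\<Phi> x)"
  have z: "z \<in> circle" "snd (\<Phi> x) * z = snd (\<Phi> y)"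
    using c[OF xy(1)] c[OF xy(2)] by (auto simp: z_def mem_circle norm_divide)
  have "\<Phi> (act P x z) = \<Phi> y" using a[OF xy(1) z(1)] z(2) f[OF xy(2)] assms by (simp add: prod_eq_iff)
  moreover have "act P x z \<in> prj P -` W" using prj_act[OF z(1)] xy by simp
  ultimately have "act P x z = y" using b xy(2) unfolding bij_betw_def inj_on_def by blast
  then show ?thesis using z(1) by blast
qed

text \<open>The projection forgets the last coordinate and the action translates it. The translation
  is demanded for small angles only, because an angle cannot be a global coordinate on a
  circle.\<close>

definition adapted :: "'e set \<Rightarrow> ('e \<Rightarrow> 'n \<times> real) \<Rightarrow> 'm set \<Rightarrow> ('m \<Rightarrow> 'n) \<Rightarrow> bool" where
  "adapted U \<kappa> V \<phi> \<longleftrightarrow> coords (tot P) U \<kappa> \<and> coords M V \<phi> \<and>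
     (\<forall>x\<in>U. prj P x \<in> V \<and> fst (\<kappa> x) = \<phi> (prj P x)) \<and>
     (\<forall>x\<in>U. \<exists>\<epsilon>>0. \<forall>t. \<bar>t\<bar> < \<epsilon> \<longrightarrow> \<kappa> (act P x (cis t)) = \<kappa> x + (0, t))"

text \<open>A trivialization is composed with a chart of the base and an angle on the circle; charts
  in \<open>tot P\<close> need not respect the projection.\<close>

lemma adapted_coordinates:
  obtains U \<kappa> V \<phi> where "adapted U \<kappa> V \<phi>" "e \<in> U"
proof -
  obtain W \<Phi> where W: "open W" "prj P e \<in> W" "local_trivialization M P W \<Phi>"
    by (rule local_trivialization_at[where p="prj P e"])
  define E where "E = prj P -` W"
  note t = local_trivializationD[OF W(3), folded E_def]
  note b = t(1) and f = t(2) and act = t(3) and \<Phi>s = t(4) and \<Phi>i = t(5) and c = t(6)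
  have eE: "e \<in> E" using W by (simp add: E_def)
  obtain V \<phi> where V: "(V, \<phi>) \<in> M" "prj P e \<in> V" using chart_at[OF M_atlas] by blast
  note cV = chartD[OF M_atlas V(1)]
  obtain a where a: "snd (\<Phi> e) \<in> arc a" using in_arc_some[OF c[OF eE]] by blast
  define J where "J = {a<..<a + 2 * pi}"
  define U where "U = E \<inter> \<Phi> -` (V \<times> arc a)"
  define \<kappa> where "\<kappa> = map_prod \<phi> (angle a) \<circ> \<Phi>"
  have pr: "(V \<times> arc a, map_prod \<phi> (angle a)) \<in> prod_atlas M circle_atlas"
    using V(1) circle_atlas_arc unfolding prod_atlas_def by blast
  have oE: "open E" unfolding E_def using smooth_map_on_continuous[OF prj_smooth] W(1)
      continuous_on_open_vimage[OF open_UNIV] by (metis Int_UNIV_right)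
  have c\<Phi>: "continuous_on E \<Phi>" using \<Phi>s by (rule smooth_map_on_continuous)
  \<comment> \<open>An arc is not open in the complex plane. The complement of \<open>cis a\<close>
    is, and it gives the same set because \<open>\<Phi>\<close> takes its second component in the
    circle.\<close>
  have "U = \<Phi> -` (V \<times> (- {cis a})) \<inter> E"
  proof (rule set_eqI)
    show "x \<in> U \<longleftrightarrow> x \<in> \<Phi> -` (V \<times> (- {cis a})) \<inter> E" for x
      using c[of x] unfolding U_def arc_eq by (cases "\<Phi> x") auto
  qed
  moreover have "open (V \<times> (- {cis a}))" using cV(1) by (intro open_Times) auto
  ultimately have oU: "open U" using continuous_on_open_vimage[OF oE] c\<Phi> by metis
  have UD: "x \<in> E" "prj P x \<in> V" "prj P x \<in> W" "snd (\<Phi> x) \<in> arc a" "\<Phi> x = (prj P x, snd (\<Phi> x))" if "x \<in> U" for x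
    using that f unfolding U_def E_def by (auto simp: mem_Times_iff prod_eq_iff)
  have UI: "x \<in> U" if "prj P x \<in> V" "x \<in> E" "snd (\<Phi> x) \<in> arc a" for x
    using that f unfolding U_def by (simp add: mem_Times_iff)
  have \<kappa>: "\<kappa> x = (\<phi> (prj P x), angle a (snd (\<Phi> x)))" if "x \<in> U" for x
    using UD(5)[OF that] by (simp add: \<kappa>_def) (metis map_prod_simp)
  \<comment> \<open>The inverse of \<open>\<kappa>\<close> written through the inverse
    trivialization, from which it inherits continuity and smoothness.\<close>
  define j where "j = (\<lambda>x. inv_into E \<Phi> (inv_into V \<phi> (fst x), cis (snd x)))"
  have j\<kappa>: "j (\<kappa> x) = x" if "x \<in> U" for x
  proof -
    have "(inv_into V \<phi> (fst (\<kappa> x)), cis (snd (\<kappa> x))) = \<Phi> x"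
      using UD[OF that] \<kappa>[OF that] cV(3) angle_arc(2) by (simp add: inv_into_f_f prod_eq_iff)
    then show ?thesis using b UD(1)[OF that] by (simp add: j_def bij_betw_def inv_into_f_f)
  qed
  then have inj: "inj_on \<kappa> U" by (rule inj_on_inverseI)
  have img: "\<kappa> ` U = \<phi> ` (V \<inter> W) \<times> J"
  proof
    show "\<kappa> ` U \<subseteq> \<phi> ` (V \<inter> W) \<times> J" using \<kappa> UD angle_arc(1) unfolding J_def by auto
    show "\<phi> ` (V \<inter> W) \<times> J \<subseteq> \<kappa> ` U"
    proof clarify
      fix q t assume q: "q \<in> V" "q \<in> W" and t: "t \<in> J"
      then have "(q, cis t) \<in> \<Phi> ` E" using b by (simp add: bij_betw_def)
      then obtain x where x: "x \<in> E" "\<Phi> x = (q, cis t)" by (metis imageE)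
      then have "x \<in> U" using UI[of x] f[OF x(1)] q t cis_in_arc unfolding J_def by simp
      then show "(\<phi> q, t) \<in> \<kappa> ` U"
        using \<kappa>[of x] x f[OF x(1)] t angle_cis unfolding J_def by (metis fst_conv image_eqI snd_conv)
    qed
  qed
  have oimg: "open (\<kappa> ` U)" unfolding img J_def
    using chart_image_open[OF M_atlas V(1) W(1)] by (intro open_Times) auto
  have inv: "inv_into U \<kappa> y = j y" if "y \<in> \<kappa> ` U" for y
    using that j\<kappa> inj by (auto simp: inv_into_f_f)
  have ks: "smooth_fun_on (tot P) U \<kappa>"
  proof (rule smooth_fun_on_from_charts[OF P_atlas oU])
    fix U' \<omega> assume U': "(U', \<omega>) \<in> tot P"
    have "U' \<inter> U = U' \<inter> E \<inter> \<Phi> -` (V \<times> arc a)" unfolding U_def by auto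
    then show "smooth_on (\<lambda>x. \<kappa> (inv_into U' \<omega> x)) (\<omega> ` (U' \<inter> U))"
      using \<Phi>s U' pr unfolding smooth_map_on_def \<kappa>_def by (fastforce simp: comp_def)
  qed
  have cinv: "continuous_on (\<kappa> ` U) (inv_into U \<kappa>)"
  proof -
    have "continuous_on (\<kappa> ` U) (\<lambda>x. (inv_into V \<phi> (fst x), cis (snd x)))"
      by (intro continuous_intros continuous_on_compose2[OF cV(5)]) (auto simp: img)
    then have "continuous_on (\<kappa> ` U) j" unfolding j_def
      by (rule continuous_on_compose2[OF smooth_map_on_continuous[OF \<Phi>i]])
        (use cV(3) in \<open>auto simp: img inv_into_f_f\<close>)
    then show ?thesis using inv by (simp cong: continuous_on_cong)
  qed
  have kis: "smooth_map_on vector_space_atlas (tot P) (\<kappa> ` U) (inv_into U \<kappa>)"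
  proof -
    have i: "inv (\<lambda>x::'n \<times> real. x) = (\<lambda>x. x)" using inv_id unfolding id_def .
    have "smooth_on (\<lambda>x. \<omega> (inv_into U \<kappa> x)) (\<kappa> ` U \<inter> inv_into U \<kappa> -` U')" (is "smooth_on _ ?S")
      if U': "(U', \<omega>) \<in> tot P" for U' \<omega>
    proof -
      have oS: "open ?S" using continuous_on_open_vimage[OF oimg] cinv chartD(1)[OF P_atlas U'] by (metis Int_commute)
      have s: "smooth_on (\<omega> \<circ> inv_into E \<Phi> \<circ> inv_into (V \<times> arc a) (map_prod \<phi> (angle a)))
         (map_prod \<phi> (angle a) ` ((V \<times> arc a) \<inter> (W \<times> circle) \<inter> inv_into E \<Phi> -` U'))" (is "smooth_on ?f ?R")
        using \<Phi>i pr U' unfolding smooth_map_on_def by blast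
      have "?S \<subseteq> ?R"
      proof
        fix y assume "y \<in> ?S"
        then obtain x where x: "x \<in> U" "inv_into U \<kappa> (\<kappa> x) \<in> U'" and y: "y = \<kappa> x" by blast
        then have "x \<in> U'" using inj by (simp add: inv_into_f_f)
        moreover have "inv_into E \<Phi> (\<Phi> x) = x" using b UD(1)[OF x(1)] by (simp add: bij_betw_def inv_into_f_f)
        moreover have "\<Phi> x \<in> (V \<times> arc a) \<inter> (W \<times> circle)"
          using UD[OF x(1)] c by (metis IntI SigmaI)
        ultimately show "y \<in> ?R" unfolding y \<kappa>_def comp_def by (intro imageI) simp
      qed
      then have "smooth_on ?f ?S" using s smooth_on_subset by blast
      moreover have "?f y = \<omega> (inv_into U \<kappa> y)" if "y \<in> ?S" for y
      proof -
        have "y \<in> \<kappa> ` U" using that by blast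
        then have "fst y \<in> \<phi> ` V" "snd y \<in> {a<..<a + 2 * pi}" unfolding img J_def by auto
        then show ?thesis using inv_into_chart_arc[OF cV(3), of "fst y" "snd y" a] inv[OF \<open>y \<in> \<kappa> ` U\<close>] by (simp add: j_def)
      qed
      ultimately show ?thesis by (rule smooth_on_eq[OF oS])
    qed
    then show ?thesis using cinv by (auto simp: smooth_map_on_def vector_space_atlas_def i comp_def)
  qed
  obtain B :: "'n set" where B: "onb B" using compatible_atlas_onb[OF M_atlas] .
  have "coords (tot P) U \<kappa>" unfolding coords_def using onb_prod[OF B onb_real] oU oimg inj ks kis by blast
  moreover have "\<exists>\<epsilon>>0. \<forall>t. \<bar>t\<bar> < \<epsilon> \<longrightarrow> \<kappa> (act P x (cis t)) = \<kappa> x + (0, t)" if x: "x \<in> U" for x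
  proof -
    define s where "s = angle a (snd (\<Phi> x))"
    have s: "a < s" "s < a + 2 * pi" "cis s = snd (\<Phi> x)" using angle_arc[OF UD(4)[OF x]] by (auto simp: s_def)
    \<comment> \<open>The distance of the angle \<open>s\<close> from the nearer end of the
      interval.\<close>
    define \<epsilon> where "\<epsilon> = min (s - a) (a + 2 * pi - s)"
    have "\<kappa> (act P x (cis t)) = \<kappa> x + (0, t)" if "\<bar>t\<bar> < \<epsilon>" for t
    proof -
      have st: "s + t \<in> {a<..<a + 2 * pi}" using that by (auto simp: \<epsilon>_def)
      have \<Phi>t: "\<Phi> (act P x (cis t)) = (prj P x, cis (s + t))"
        using act[OF UD(1)[OF x], of "cis t"] by (simp add: cis_mult s(3)[symmetric])
      have "act P x (cis t) \<in> U"
        using UI[of "act P x (cis t)"] UD[OF x] prj_act \<Phi>t cis_in_arc[OF st] by (simp add: E_def)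
      then have "\<kappa> (act P x (cis t)) = (\<phi> (prj P x), s + t)"
        using \<kappa>[of "act P x (cis t)"] prj_act \<Phi>t angle_cis[OF st] by simp
      then show ?thesis using \<kappa>[OF x] by (simp add: s_def)
    qed
    moreover have "\<epsilon> > 0" using s by (simp add: \<epsilon>_def)
    ultimately show ?thesis by blast
  qed
  ultimately have "adapted U \<kappa> V \<phi>"
    unfolding adapted_def using chart_coords[OF M_atlas V(1)] UD(2) \<kappa> by simp
  moreover have "e \<in> U" using UI[of e] V(2) eE a by simp
  ultimately show ?thesis using that by blast
qed

end

section \<open>Horizontal lifts\<close>

text \<open>The coordinate function in direction \<open>a\<close> has derivative
  \<open>a \<bullet> a\<close> along this vector.\<close>

lemma coord_vec_eq_zero:
  fixes A :: "('a::t2_space, 'b::real_inner) atlas"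
  assumes A: "compatible_atlas A" and k: "coords A U \<kappa>" and p: "p \<in> U" and 0: "coord_vec A U \<kappa> p a = (\<lambda>f. 0)"
  shows "a = 0"
proof -
  obtain N y Y where N: "open N" "p \<in> N" "N \<subseteq> U"
    "\<And>b. y b \<in> smooth_funs A" "\<And>a. Y a \<in> vector_fields A"
    "\<And>q a. q \<in> N \<Longrightarrow> Y a q = coord_vec A U \<kappa> q a"
    "\<And>q a b. q \<in> N \<Longrightarrow> coord_vec A U \<kappa> q a (y b) = a \<bullet> b"
    by (rule coord_frame[OF A k p]) blast
  show ?thesis using N(7)[OF N(2), of a a] 0 by simp
qed

section \<open>The differential of the projection\<close>

context principal_bundle
begin

abbreviation dprj :: "'e tvec \<Rightarrow> 'm tvec" where
  "dprj \<equiv> differential M (prj P)"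

abbreviation vert :: "'e vfield" where
  "vert \<equiv> fundamental_field P"

lemma pull_fun_smooth: "h \<in> smooth_funs M \<Longrightarrow> (\<lambda>x. h (prj P x)) \<in> smooth_funs (tot P)"
  by (rule smooth_funs_compose[OF P_atlas M_atlas prj_smooth])

lemma dprj_apply: "h \<in> smooth_funs M \<Longrightarrow> dprj v h = v (\<lambda>x. h (prj P x))"
  by (simp add: differential_def comp_def)

lemma dprj_nonsmooth: "h \<notin> smooth_funs M \<Longrightarrow> dprj v h = 0"
  by (simp add: differential_def)

lemma dprj_lincomb: "dprj (\<lambda>f. a * v f + b * w f) = (\<lambda>h. a * dprj v h + b * dprj w h)"
  by (auto simp: differential_def)

lemma adaptedD:
  assumes "adapted U \<kappa> V \<phi>"
  shows "coords (tot P) U \<kappa>" "coords M V \<phi>" "x \<in> U \<Longrightarrow> prj P x \<in> V" "x \<in> U \<Longrightarrow> fst (\<kappa> x) = \<phi> (prj P x)"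
    "x \<in> U \<Longrightarrow> \<exists>\<epsilon>>0. \<forall>t. \<bar>t\<bar> < \<epsilon> \<longrightarrow> \<kappa> (act P x (cis t)) = \<kappa> x + (0, t)"
  using assms unfolding adapted_def by blast+

lemma dprj_coord_vec:
  assumes a: "adapted U \<kappa> V \<phi>" and x: "x \<in> U"
  shows "dprj (coord_vec (tot P) U \<kappa> x a) = coord_vec M V \<phi> (prj P x) (fst a)"
proof
  fix h
  note k = adaptedD[OF a]
  show "dprj (coord_vec (tot P) U \<kappa> x a) h = coord_vec M V \<phi> (prj P x) (fst a) h"
  proof (cases "h \<in> smooth_funs M")
    case True
    have d: "((\<lambda>y. h (inv_into V \<phi> (fst y))) has_derivative (\<lambda>a. coord_vec M V \<phi> (prj P x) (fst a) h)) (at (\<kappa> x))"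
      by (rule has_derivative_compose[OF has_derivative_fst[OF has_derivative_ident]])
        (use coord_vec_has_derivative[OF M_atlas k(2) k(3)[OF x] True] k(4)[OF x] in simp)
    have "coord_vec (tot P) U \<kappa> x a (\<lambda>x. h (prj P x)) = coord_vec M V \<phi> (prj P x) (fst a) h"
      by (rule coord_vec_eqI[OF P_atlas k(1) x pull_fun_smooth[OF True] open_UNIV UNIV_I _ d])
        (use k(3,4) coordsD(3)[OF k(2)] in \<open>simp add: inv_into_f_f\<close>)
    then show ?thesis by (simp add: dprj_apply[OF True])
  qed (simp add: dprj_nonsmooth coord_vec_nonsmooth)
qed

lemma vert_coord_vec:
  assumes a: "adapted U \<kappa> V \<phi>" and x: "x \<in> U"
  shows "vert x = coord_vec (tot P) U \<kappa> x (0, 1)"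
  unfolding fundamental_field_def
proof (rule velocity_eq_coord_vec[OF P_atlas adaptedD(1)[OF a] orbit_smooth _ x])
  show "act P x (cis 0) = x" by (simp add: act_1)
  obtain \<epsilon> where \<epsilon>: "\<epsilon> > 0" "\<And>t. \<bar>t\<bar> < \<epsilon> \<Longrightarrow> \<kappa> (act P x (cis t)) = \<kappa> x + (0, t)"
    using adaptedD(5)[OF a x] by blast
  have "((\<lambda>t. \<kappa> x + (0, t)) has_derivative (\<lambda>t. t *\<^sub>R (0, 1))) (at 0)"
    by (auto intro!: derivative_eq_intros)
  then show "((\<lambda>t. \<kappa> (act P x (cis t))) has_derivative (\<lambda>t. t *\<^sub>R (0, 1))) (at 0)"
    by (rule has_derivative_transform_within_open[where s="{-\<epsilon><..<\<epsilon>}"]) (use \<epsilon> in auto)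
qed

lemma dprj_tangent:
  assumes "v \<in> tangent_space (tot P) x"
  shows "dprj v \<in> tangent_space M (prj P x)"
proof -
  obtain U \<kappa> V \<phi> where a: "adapted U \<kappa> V \<phi>" "x \<in> U" using adapted_coordinates by blast
  note k = adaptedD[OF a(1)]
  show ?thesis using assms dprj_coord_vec[OF a] tangent_space_eq[OF P_atlas k(1) a(2)]
      tangent_space_eq[OF M_atlas k(2) k(3)[OF a(2)]] by auto
qed

lemma dprj_surj:
  assumes "u \<in> tangent_space M (prj P x)"
  shows "\<exists>v\<in>tangent_space (tot P) x. dprj v = u"
proof -
  obtain U \<kappa> V \<phi> where a: "adapted U \<kappa> V \<phi>" "x \<in> U" using adapted_coordinates by blast
  note k = adaptedD[OF a(1)]
  obtain b where b: "u = coord_vec M V \<phi> (prj P x) b"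
    using assms tangent_space_eq[OF M_atlas k(2) k(3)[OF a(2)]] by auto
  show ?thesis using b dprj_coord_vec[OF a, of "(b, 0)"] tangent_space_eq[OF P_atlas k(1) a(2)] by auto
qed

lemma vert_tangent: "vert x \<in> tangent_space (tot P) x"
proof -
  obtain U \<kappa> V \<phi> where a: "adapted U \<kappa> V \<phi>" "x \<in> U" using adapted_coordinates by blast
  then show ?thesis using tangent_space_eq[OF P_atlas adaptedD(1)[OF a(1)] a(2)] vert_coord_vec[OF a] by simp
qed

lemma dprj_vert: "dprj (vert x) = (\<lambda>h. 0)"
proof -
  obtain U \<kappa> V \<phi> where a: "adapted U \<kappa> V \<phi>" "x \<in> U" using adapted_coordinates by blast
  note k = adaptedD[OF a(1)]
  have "coord_vec M V \<phi> (prj P x) 0 = (\<lambda>h. 0)"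
    using coord_vec_lincomb[OF M_atlas k(2) k(3)[OF a(2)], of 0 0 0 0] by simp
  then show ?thesis using dprj_coord_vec[OF a] vert_coord_vec[OF a] by simp
qed

text \<open>In adapted coordinates such a vector has no base component, and \<open>vert\<close> is
  the unit vector of the remaining direction.\<close>

lemma dprj_kernel:
  assumes "v \<in> tangent_space (tot P) x" "dprj v = (\<lambda>h. 0)"
  shows "\<exists>c. v = (\<lambda>f. c * vert x f)"
proof -
  obtain U \<kappa> V \<phi> where a: "adapted U \<kappa> V \<phi>" "x \<in> U" using adapted_coordinates by blast
  note k = adaptedD[OF a(1)]
  obtain b where b: "v = coord_vec (tot P) U \<kappa> x b"
    using assms tangent_space_eq[OF P_atlas k(1) a(2)] by auto
  have "coord_vec M V \<phi> (prj P x) (fst b) = (\<lambda>h. 0)" using assms(2) dprj_coord_vec[OF a] b by simp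
  then have "fst b = 0" by (rule coord_vec_eq_zero[OF M_atlas k(2) k(3)[OF a(2)]])
  then have "b = snd b *\<^sub>R (0, 1) + 0 *\<^sub>R 0" by (simp add: prod_eq_iff)
  then have "v = (\<lambda>f. snd b * vert x f)"
    using coord_vec_lincomb[OF P_atlas k(1) a(2), of "snd b" "(0, 1)" 0 0] vert_coord_vec[OF a] b by simp
  then show ?thesis by blast
qed

text \<open>Smoothness is local, and near each point the field agrees with the global extension of
  an adapted coordinate field.\<close>

lemma vert_vector_field: "vert \<in> vector_fields (tot P)"
proof -
  have "(\<lambda>x. vert x f) \<in> smooth_funs (tot P)" for f
  proof (rule smooth_funs_local[OF P_atlas])
    fix e
    obtain U \<kappa> V \<phi> where a: "adapted U \<kappa> V \<phi>" "e \<in> U" using adapted_coordinates by blast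
    obtain N y Y where N: "open N" "e \<in> N" "N \<subseteq> U"
      "\<And>b. y b \<in> smooth_funs (tot P)" "\<And>a. Y a \<in> vector_fields (tot P)"
      "\<And>q a. q \<in> N \<Longrightarrow> Y a q = coord_vec (tot P) U \<kappa> q a"
      "\<And>q a b. q \<in> N \<Longrightarrow> coord_vec (tot P) U \<kappa> q a (y b) = a \<bullet> b"
      by (rule coord_frame[OF P_atlas adaptedD(1)[OF a(1)] a(2)]) blast
    have "smooth_fun_on (tot P) N (\<lambda>x. Y (0, 1) x f)"
      using vector_field_smooth[OF N(5)] smooth_map_on_subset unfolding smooth_funs_iff by blast
    moreover have "vert x f = Y (0, 1) x f" if "x \<in> N" for x
      using vert_coord_vec[OF a(1)] N(3,6) that by auto
    ultimately show "\<exists>T g. open T \<and> e \<in> T \<and> smooth_fun_on (tot P) T g \<and> (\<forall>q\<in>T. vert q f = g q)"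
      using N(1,2) by blast
  qed
  then show ?thesis using vert_tangent by (simp add: vector_fields_def)
qed

text \<open>Any smooth local lift will do here; \<open>horizontal_lift_vector_field\<close> removes
  its vertical part by means of the connection.\<close>

lemma local_lift:
  assumes X: "X \<in> vector_fields M"
  obtains N X' where "open N" "e \<in> N" "X' \<in> vector_fields (tot P)" "\<And>x. x \<in> N \<Longrightarrow> dprj (X' x) = X (prj P x)"
proof -
  obtain U \<kappa> V \<phi> where a: "adapted U \<kappa> V \<phi>" "e \<in> U" using adapted_coordinates by blast
  note k = adaptedD[OF a(1)]
  obtain N1 y1 Y1 where N1: "open N1" "e \<in> N1" "N1 \<subseteq> U"
      "\<And>b. y1 b \<in> smooth_funs (tot P)" "\<And>a. Y1 a \<in> vector_fields (tot P)"
      "\<And>q a. q \<in> N1 \<Longrightarrow> Y1 a q = coord_vec (tot P) U \<kappa> q a"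
      "\<And>q a b. q \<in> N1 \<Longrightarrow> coord_vec (tot P) U \<kappa> q a (y1 b) = a \<bullet> b"
    by (rule coord_frame[OF P_atlas k(1) a(2)]) blast
  obtain N2 y2 Y2 where N2: "open N2" "prj P e \<in> N2" "N2 \<subseteq> V"
      "\<And>b. y2 b \<in> smooth_funs M" "\<And>a. Y2 a \<in> vector_fields M"
      "\<And>q a. q \<in> N2 \<Longrightarrow> Y2 a q = coord_vec M V \<phi> q a"
      "\<And>q a b. q \<in> N2 \<Longrightarrow> coord_vec M V \<phi> q a (y2 b) = a \<bullet> b"
    by (rule coord_frame[OF M_atlas k(2) k(3)[OF a(2)]]) blast
  obtain B :: "'n set" where B: "onb B" using compatible_atlas_onb[OF M_atlas] .
  \<comment> \<open>The components of \<open>X\<close> in base coordinates become the coefficients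
    of the corresponding coordinate fields upstairs, which have zero angle component.\<close>
  define X' where "X' x f = (\<Sum>b\<in>B. X (prj P x) (y2 b) * Y1 (b, 0) x f)" for x f
  have "X' \<in> vector_fields (tot P)"
    using vector_fields_sum[OF P_atlas, of B "\<lambda>b x. X (prj P x) (y2 b)" "\<lambda>b. Y1 (b, 0)"]
      pull_fun_smooth[OF vector_field_smooth[OF X]] N1(5) by (simp add: X'_def[abs_def])
  moreover have "open (N1 \<inter> prj P -` N2)"
    using N1(1) N2(1) continuous_on_open_vimage[OF open_UNIV] smooth_map_on_continuous[OF prj_smooth]
    by (metis Int_UNIV_right open_Int)
  moreover have "dprj (X' x) = X (prj P x)" if x: "x \<in> N1 \<inter> prj P -` N2" for x
  proof
    fix h
    have xU: "x \<in> U" and x1: "x \<in> N1" and x2: "prj P x \<in> N2" using x N1(3) by auto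
    obtain c where c: "X (prj P x) = coord_vec M V \<phi> (prj P x) c"
      using vector_fieldsD(1)[OF X, of "prj P x"] tangent_space_eq[OF M_atlas k(2) k(3)[OF xU]] by auto
    show "dprj (X' x) h = X (prj P x) h"
    proof (cases "h \<in> smooth_funs M")
      case True
      have "dprj (X' x) h = (\<Sum>b\<in>B. (c \<bullet> b) * Y1 (b, 0) x (\<lambda>x. h (prj P x)))"
        by (simp add: dprj_apply[OF True] X'_def c N2(7)[OF x2])
      also have "\<dots> = (\<Sum>b\<in>B. (c \<bullet> b) *\<^sub>R coord_vec M V \<phi> (prj P x) b h)"
        using fun_cong[OF dprj_coord_vec[OF a(1) xU], of _ h] by (simp add: N1(6)[OF x1] dprj_apply[OF True])
      also have "\<dots> = X (prj P x) h"
        unfolding c by (rule onb_linear_expand[OF B has_derivative_linear[OF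
            coord_vec_has_derivative[OF M_atlas k(2) k(3)[OF xU] True]], symmetric])
      finally show ?thesis .
    next
      case False
      then show ?thesis using tangent_vector_nonsmooth[OF vector_fieldsD(1)[OF X]] by (simp add: dprj_nonsmooth)
    qed
  qed
  moreover have "e \<in> N1 \<inter> prj P -` N2" using N1(2) N2(2) by simp
  ultimately show ?thesis using that by blast
qed

text \<open>Fixing the angle in adapted coordinates gives a smooth local section of the bundle, and
  \<open>h\<close> is the pulled back function restricted to that section.\<close>

lemma smooth_funs_descend:
  assumes h: "(\<lambda>x. h (prj P x)) \<in> smooth_funs (tot P)"
  shows "h \<in> smooth_funs M"
proof (rule smooth_funs_local[OF M_atlas])
  fix p
  obtain e where e: "prj P e = p" using prj_surj by blast
  obtain U \<kappa> V \<phi> where a: "adapted U \<kappa> V \<phi>" "e \<in> U" using adapted_coordinates by blast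
  note k = adaptedD[OF a(1)]
  obtain B :: "'n set" where B: "onb B" using compatible_atlas_onb[OF M_atlas] .
  define s where "s = snd (\<kappa> e)"
  define D where "D = (\<lambda>x. (x, s)) -` (\<kappa> ` U)"
  have oD: "open D" unfolding D_def
    using continuous_on_open_vimage[OF open_UNIV, of "\<lambda>x. (x, s)"] coordsD(2)[OF k(1)]
    by (auto intro!: continuous_intros)
  define g where "g x = h (prj P (inv_into U \<kappa> (x, s)))" for x
  have "smooth_on (\<lambda>x. (x, s)) D" by (intro smooth_on_Pair smooth_on_id smooth_on_const)
  then have g: "smooth_on g D" unfolding g_def
    by (rule smooth_on_compose[OF onb_prod[OF B onb_real] oD smooth_funs_representative[OF P_atlas k(1) h]])
      (simp add: D_def)
  define N where "N = V \<inter> \<phi> -` D"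
  have oN: "open N" unfolding N_def by (rule coords_preimage_open[OF k(2) oD])
  have eq: "\<kappa> e = (\<phi> p, s)" using k(4)[OF a(2)] e by (simp add: s_def prod_eq_iff)
  then have "p \<in> N" using k(3)[OF a(2)] e a(2) unfolding N_def D_def by (metis IntI image_eqI vimageI2)
  moreover have "smooth_fun_on M N (\<lambda>q. g (\<phi> q))"
    by (rule smooth_map_on_compose[OF M_atlas coords_vector_space_compatible[OF k(2)] real_atlas_compatible oN oD
          smooth_map_on_subset[OF coordsD(4)[OF k(2)]]])
      (use g in \<open>auto simp: N_def smooth_map_on_vector_spaces_iff\<close>)
  moreover have "h q = g (\<phi> q)" if "q \<in> N" for q
  proof -
    have "(\<phi> q, s) \<in> \<kappa> ` U" using that by (simp add: N_def D_def)
    then obtain x where x: "x \<in> U" "\<kappa> x = (\<phi> q, s)" by (metis imageE)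
    then have "\<phi> (prj P x) = \<phi> q" using k(4)[OF x(1)] by simp
    then have "prj P x = q" using coordsD(3)[OF k(2)] k(3)[OF x(1)] that unfolding N_def by (auto dest: inj_onD)
    then show ?thesis using x coordsD(3)[OF k(1)] unfolding g_def by (metis inv_into_f_f)
  qed
  ultimately show "\<exists>T g. open T \<and> p \<in> T \<and> smooth_fun_on M T g \<and> (\<forall>q\<in>T. h q = g q)" using oN by blast
qed

section \<open>The action on tangent vectors\<close>

abbreviation dact :: "complex \<Rightarrow> 'e tvec \<Rightarrow> 'e tvec" where
  "dact z \<equiv> differential (tot P) (\<lambda>x. act P x z)"

lemma dact_tangent:
  assumes z: "z \<in> circle" and v: "v \<in> tangent_space (tot P) x"
  shows "dact z v \<in> tangent_space (tot P) (act P x z)"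
proof -
  obtain \<gamma> where g: "v = velocity (tot P) \<gamma>" "smooth_map_on vector_space_atlas (tot P) UNIV \<gamma>" "\<gamma> 0 = x"
    using v unfolding tangent_space_def by blast
  have "smooth_map_on vector_space_atlas (tot P) UNIV (\<lambda>t. act P (\<gamma> t) z)"
    by (rule smooth_map_on_compose[OF real_atlas_compatible P_atlas P_atlas open_UNIV open_UNIV g(2) act_smooth[OF z]]) simp
  moreover have "dact z v = velocity (tot P) (\<lambda>t. act P (\<gamma> t) z)"
    using smooth_funs_compose[OF P_atlas P_atlas act_smooth[OF z]]
    by (auto simp: differential_def velocity_def g(1) comp_def fun_eq_iff)
  ultimately show ?thesis using g(3) unfolding tangent_space_def by blast
qed

lemma dprj_dact:
  assumes z: "z \<in> circle"
  shows "dprj (dact z v) = dprj v"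
proof
  fix h
  show "dprj (dact z v) h = dprj v h"
    using pull_fun_smooth[of h] prj_act[OF z] by (simp add: differential_def comp_def)
qed

end

section \<open>Splitting of tangent spaces by a connection\<close>

locale connection = principal_bundle M P
  for M :: "('m::{t2_space,second_countable_topology}, 'n::real_inner) atlas"
    and P :: "('e::{t2_space,second_countable_topology}, 'b::real_inner, 'm) circle_bundle" +
  fixes \<theta> :: "'e form"
  assumes connection: "connection_form P \<theta>"
begin

lemma \<theta>_form: "\<theta> \<in> forms (tot P) 1" and \<theta>_vert: "\<theta> e [vert e] = 1"
  using connection by (simp_all add: connection_form_def)

lemma invariant_form1:
  assumes "invariant_form P 1 \<xi>" "z \<in> circle" "v \<in> tangent_space (tot P) e"
  shows "\<xi> (act P e z) [dact z v] = \<xi> e [v]"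
proof -
  have "pullback (tot P) (tot P) 1 (\<lambda>x. act P x z) \<xi> e [v] = \<xi> e [v]"
    using assms(1,2) by (simp add: invariant_form_def)
  then show ?thesis using assms(3) by (simp add: pullback_def tangent_lists_def)
qed

lemma \<theta>_invariant: "z \<in> circle \<Longrightarrow> v \<in> tangent_space (tot P) e \<Longrightarrow> \<theta> (act P e z) [dact z v] = \<theta> e [v]"
  using connection by (intro invariant_form1) (simp_all add: connection_form_def)

text \<open>The kernel of \<open>dprj\<close> is spanned by \<open>vert\<close>, on which \<theta>
  is 1, so the projection and \<theta> together determine a tangent vector. Identities between
  vector fields on the total space are verified through this pair.\<close>

lemma tangent_vector_eqI:
  assumes v: "v \<in> tangent_space (tot P) x" "w \<in> tangent_space (tot P) x" and d: "dprj v = dprj w" "\<theta> x [v] = \<theta> x [w]"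
  shows "v = w"
proof -
  let ?u = "\<lambda>f. 1 * v f + (-1) * w f"
  have u: "?u \<in> tangent_space (tot P) x" by (rule tangent_space_lincomb[OF P_atlas v])
  have "dprj ?u = (\<lambda>h. 0)" unfolding dprj_lincomb d by simp
  then obtain c where c: "?u = (\<lambda>f. c * vert x f)" using dprj_kernel[OF u] by blast
  have "\<theta> x [?u] = 0" using form1_lincomb[OF \<theta>_form v, of 1 "-1"] d by simp
  moreover have "\<theta> x [\<lambda>f. c * vert x f + 0 * vert x f] = c"
    using form1_lincomb[OF \<theta>_form vert_tangent vert_tangent, of x c 0] \<theta>_vert by simp
  ultimately have "c = 0" using c by simp
  then have "v f - w f = 0" for f using fun_cong[OF c, of f] by simp
  then show ?thesis by (auto simp: fun_eq_iff)
qed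

lemma tangent_vector_with:
  assumes "u \<in> tangent_space M (prj P x)"
  shows "\<exists>v\<in>tangent_space (tot P) x. dprj v = u \<and> \<theta> x [v] = c"
proof -
  obtain v where v: "v \<in> tangent_space (tot P) x" "dprj v = u" using dprj_surj[OF assms] by blast
  \<comment> \<open>The vertical part is adjusted until \<theta> takes the prescribed value; the
    projection does not notice.\<close>
  let ?w = "\<lambda>f. 1 * v f + (c - \<theta> x [v]) * vert x f"
  have "?w \<in> tangent_space (tot P) x" by (rule tangent_space_lincomb[OF P_atlas v(1) vert_tangent])
  moreover have "dprj ?w = u" unfolding dprj_lincomb v(2) dprj_vert by simp
  moreover have "\<theta> x [?w] = c" using form1_lincomb[OF \<theta>_form v(1) vert_tangent, of 1 "c - \<theta> x [v]"] \<theta>_vert by simp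
  ultimately show ?thesis by blast
qed

lemma horizontal_lift:
  assumes "X (prj P e) \<in> tangent_space M (prj P e)"
  shows "horizontal_lift M P \<theta> X e \<in> tangent_space (tot P) e"
    "dprj (horizontal_lift M P \<theta> X e) = X (prj P e)" "\<theta> e [horizontal_lift M P \<theta> X e] = 0"
proof -
  have "\<exists>!v. v \<in> tangent_space (tot P) e \<and> dprj v = X (prj P e) \<and> \<theta> e [v] = 0"
    using tangent_vector_with[OF assms, of 0] tangent_vector_eqI by (metis (no_types, lifting))
  from theI'[OF this]
  show "horizontal_lift M P \<theta> X e \<in> tangent_space (tot P) e"
    "dprj (horizontal_lift M P \<theta> X e) = X (prj P e)" "\<theta> e [horizontal_lift M P \<theta> X e] = 0"
    by (simp_all add: horizontal_lift_def)
qed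

text \<open>The vector field \<open>X + f \<partial>\<^sub>\<theta>\<close>, up to the regularity of \<open>X\<close> and \<open>f\<close>.\<close>

definition splits :: "'e vfield \<Rightarrow> 'm vfield \<Rightarrow> ('m \<Rightarrow> real) \<Rightarrow> bool" where
  "splits U X f \<longleftrightarrow> U \<in> vector_fields (tot P) \<and> (\<forall>e. dprj (U e) = X (prj P e)) \<and> (\<forall>e. \<theta> e [U e] = f (prj P e))"

lemma splitsD:
  assumes "splits U X f"
  shows "U \<in> vector_fields (tot P)" "dprj (U e) = X (prj P e)" "\<theta> e [U e] = f (prj P e)"
  using assms unfolding splits_def by auto

lemma horizontal_lift_vector_field:
  assumes X: "X \<in> vector_fields M"
  shows "horizontal_lift M P \<theta> X \<in> vector_fields (tot P)"
proof -
  note t = horizontal_lift[where X=X, OF vector_fieldsD(1)[OF X]]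
  have "(\<lambda>e. horizontal_lift M P \<theta> X e h) \<in> smooth_funs (tot P)" for h
  proof (rule smooth_funs_local[OF P_atlas])
    fix e
    obtain N X' where N: "open N" "e \<in> N" "X' \<in> vector_fields (tot P)" "\<And>x. x \<in> N \<Longrightarrow> dprj (X' x) = X (prj P x)"
      by (rule local_lift[OF X]) blast
    \<comment> \<open>The local lift without its vertical part; by uniqueness it is the horizontal
      lift on \<open>N\<close>.\<close>
    define Y where "Y x h = X' x h + (- \<theta> x [X' x]) * vert x h" for x h
    have "(\<lambda>x. 0 + (-1) * \<theta> x [X' x]) \<in> smooth_funs (tot P)"
      by (intro smooth_funs_add smooth_funs_mult smooth_funs_const form1_smooth[OF \<theta>_form N(3)])
    then have Y: "Y \<in> vector_fields (tot P)" unfolding Y_def[abs_def]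
      by (intro vector_fields_add[OF P_atlas N(3)] vector_fields_scale[OF P_atlas _ vert_vector_field]) simp
    have "horizontal_lift M P \<theta> X x = Y x" if "x \<in> N" for x
    proof (rule tangent_vector_eqI[OF t(1) vector_fieldsD(1)[OF Y]])
      note tt = vector_fieldsD(1)[OF N(3), of x] vert_tangent[of x]
      have Yx: "Y x = (\<lambda>h. 1 * X' x h + (- \<theta> x [X' x]) * vert x h)" by (simp add: Y_def[abs_def])
      show "dprj (horizontal_lift M P \<theta> X x) = dprj (Y x)"
        unfolding Yx dprj_lincomb t(2) N(4)[OF that] dprj_vert by simp
      show "\<theta> x [horizontal_lift M P \<theta> X x] = \<theta> x [Y x]"
        using form1_lincomb[OF \<theta>_form tt, of 1 "- \<theta> x [X' x]"] \<theta>_vert t(3) unfolding Yx by simp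
    qed
    moreover have "smooth_fun_on (tot P) N (\<lambda>x. Y x h)"
      using vector_field_smooth[OF Y] smooth_map_on_subset unfolding smooth_funs_iff by blast
    ultimately show "\<exists>T g. open T \<and> e \<in> T \<and> smooth_fun_on (tot P) T g \<and> (\<forall>q\<in>T. horizontal_lift M P \<theta> X q h = g q)"
      using N(1,2) by (metis (no_types, lifting))
  qed
  then show ?thesis using t(1) by (simp add: vector_fields_def)
qed

lemma splits_section:
  assumes X: "X \<in> vector_fields M" and f: "f \<in> smooth_funs M"
  shows "splits (fst (split_section M P \<theta> (X, f, C, g))) X f"
proof -
  note t = horizontal_lift[where X=X, OF vector_fieldsD(1)[OF X]]
  define U where "U = (\<lambda>e h. horizontal_lift M P \<theta> X e h + f (prj P e) * vert e h)"
  have U: "U \<in> vector_fields (tot P)" unfolding U_def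
    by (intro vector_fields_add[OF P_atlas] vector_fields_scale[OF P_atlas] pull_fun_smooth f
        vert_vector_field horizontal_lift_vector_field X)
  have Ue: "U e = (\<lambda>h. 1 * horizontal_lift M P \<theta> X e h + f (prj P e) * vert e h)" for e
    by (simp add: U_def)
  have "dprj (U e) = X (prj P e)" for e
    unfolding Ue dprj_lincomb t(2) dprj_vert by simp
  moreover have "\<theta> e [U e] = f (prj P e)" for e
    unfolding Ue using form1_lincomb[OF \<theta>_form t(1) vert_tangent, of e 1 "f (prj P e)"] t(3) \<theta>_vert by simp
  moreover have "fst (split_section M P \<theta> (X, f, C, g)) = U" by (simp add: split_section_def U_def)
  ultimately show ?thesis using U by (simp only: splits_def) blast
qed

lemma splits_unique:
  assumes "splits U X f" "splits V X f"
  shows "U = V"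
  using tangent_vector_eqI[OF vector_fieldsD(1) vector_fieldsD(1)] splitsD[OF assms(1)] splitsD[OF assms(2)]
  by (metis ext)

text \<open>The projection and \<theta> are invariant under the action, so the translated vector has
  the same two components as the value of \<open>U\<close> at the translated point.\<close>

lemma splits_invariant:
  assumes "splits U X f"
  shows "invariant_field P U"
  unfolding invariant_field_def
proof (intro ballI allI)
  fix z e assume z: "z \<in> circle"
  note s = splitsD[OF assms]
  show "dact z (U e) = U (act P e z)"
    by (rule tangent_vector_eqI[OF dact_tangent[OF z] vector_fieldsD(1)])
      (use s vector_fieldsD(1)[OF s(1)] z in \<open>simp_all add: dprj_dact prj_act \<theta>_invariant\<close>)
qed

end

section \<open>Invariant sections and their brackets\<close>

lemma wedge1_3:
  "wedge1 \<alpha> \<beta> p [u, v, w] = \<alpha> p [u] * \<beta> p [v, w] - \<alpha> p [v] * \<beta> p [u, w] + \<alpha> p [w] * \<beta> p [u, v]"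
  by (simp add: wedge1_def drop_nth_def lessThan_Suc)

declare One_nat_def [simp del]

lemma forms1_comb:
  assumes "\<omega> \<in> forms A 1" "\<omega>' \<in> forms A 1" "u \<in> smooth_funs A" "v \<in> smooth_funs A"
  shows "(\<lambda>p vs. u p * \<omega> p vs + v p * \<omega>' p vs) \<in> forms A 1"
  by (rule form1I)
    (simp_all add: form_off_tangent_lists[OF assms(1)] form_off_tangent_lists[OF assms(2)]
      form1_lincomb[OF assms(1)] form1_lincomb[OF assms(2)] smooth_funs_add smooth_funs_mult
      form1_smooth[OF assms(1)] form1_smooth[OF assms(2)] assms(3,4) algebra_simps)

lemma tangent_lists_1: "vs \<in> tangent_lists A 1 p \<longleftrightarrow> (\<exists>v\<in>tangent_space A p. vs = [v])"
  by (auto simp: tangent_lists_def length_Suc_conv One_nat_def)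

text \<open>The 1-form component of the bracket of two invariant sections, evaluated on the horizontal
  lift of \<open>Z\<close>.\<close>

definition bracket_form ::
  "'m form \<Rightarrow> 'm form \<Rightarrow> 'm form \<Rightarrow> 'm vfield \<times> ('m \<Rightarrow> real) \<times> 'm form \<times> ('m \<Rightarrow> real)
     \<Rightarrow> 'm vfield \<times> ('m \<Rightarrow> real) \<times> 'm form \<times> ('m \<Rightarrow> real) \<Rightarrow> 'm vfield \<Rightarrow> 'm \<Rightarrow> real" where
  "bracket_form F F' H = (\<lambda>(X, f, C, g) (Y, f', C', g') Z p.
     lie1 X C' Z p - d1 C Y Z p + (g' p * Z p f + f' p * Z p g)
     + (g' p * F p [X p, Z p] + f' p * F' p [X p, Z p])
     - (g p * F p [Y p, Z p] + f p * F' p [Y p, Z p]) - H p [X p, Y p, Z p])"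

definition base_bracket ::
  "('m::topological_space, 'n::real_inner) atlas \<Rightarrow> 'm form \<Rightarrow> 'm form \<Rightarrow> 'm form
     \<Rightarrow> 'm vfield \<times> ('m \<Rightarrow> real) \<times> 'm form \<times> ('m \<Rightarrow> real) \<Rightarrow> 'm vfield \<times> ('m \<Rightarrow> real) \<times> 'm form \<times> ('m \<Rightarrow> real)
     \<Rightarrow> 'm vfield \<times> ('m \<Rightarrow> real) \<times> 'm form \<times> ('m \<Rightarrow> real)" where
  "base_bracket M F F' H = (\<lambda>(X, f, C, g) (Y, f', C', g').
     (lie_bracket X Y,
      \<lambda>p. X p f' - Y p f - F p [X p, Y p],
      form1_of M (bracket_form F F' H (X, f, C, g) (Y, f', C', g')),
      \<lambda>p. X p g' - Y p g - F' p [X p, Y p]))"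

text \<open>One operation with two coefficient functions serves for both addition and
  scaling.\<close>

definition base_comb ::
  "('m \<Rightarrow> real) \<Rightarrow> ('m \<Rightarrow> real) \<Rightarrow> 'm vfield \<times> ('m \<Rightarrow> real) \<times> 'm form \<times> ('m \<Rightarrow> real)
     \<Rightarrow> 'm vfield \<times> ('m \<Rightarrow> real) \<times> 'm form \<times> ('m \<Rightarrow> real) \<Rightarrow> 'm vfield \<times> ('m \<Rightarrow> real) \<times> 'm form \<times> ('m \<Rightarrow> real)" where
  "base_comb u v = (\<lambda>(X, f, C, g) (Y, f', C', g').
     (\<lambda>p h. u p * X p h + v p * Y p h, \<lambda>p. u p * f p + v p * f' p,
      \<lambda>p vs. u p * C p vs + v p * C' p vs, \<lambda>p. u p * g p + v p * g' p))"

definition swap_data ::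
  "'m vfield \<times> ('m \<Rightarrow> real) \<times> 'm form \<times> ('m \<Rightarrow> real) \<Rightarrow> 'm vfield \<times> ('m \<Rightarrow> real) \<times> 'm form \<times> ('m \<Rightarrow> real)" where
  "swap_data = (\<lambda>(X, f, C, g). (X, g, C, f))"

text \<open>In \<open>bracket_form\<close> every term with \<open>F\<close>, \<open>F'\<close> or a
  derivative of a scalar component stands next to its mirror image, so the exchange only permutes
  summands.\<close>

lemma swap_base_bracket:
  "base_bracket M F' F H (swap_data a) (swap_data b) = swap_data (base_bracket M F F' H a b)"
proof -
  have "bracket_form F' F H (swap_data a) (swap_data b) = bracket_form F F' H a b"
    by (cases a, cases b) (auto simp: bracket_form_def swap_data_def fun_eq_iff)
  then show ?thesis by (cases a, cases b) (simp add: base_bracket_def swap_data_def)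
qed

lemma swap_base_comb: "base_comb u v (swap_data a) (swap_data b) = swap_data (base_comb u v a b)"
  by (cases a, cases b) (simp add: base_comb_def swap_data_def)

lemma swap_swap_data [simp]: "swap_data (swap_data a) = a"
  by (cases a) (simp add: swap_data_def)

lemma swap_data_mem_iff [simp]: "swap_data a \<in> base_data M \<longleftrightarrow> a \<in> base_data M"
  by (cases a) (auto simp: swap_data_def base_data_def)

lemma base_comb_mem:
  assumes "compatible_atlas M" "u \<in> smooth_funs M" "v \<in> smooth_funs M" "a \<in> base_data M" "b \<in> base_data M"
  shows "base_comb u v a b \<in> base_data M"
  using assms by (cases a, cases b)
    (simp add: base_comb_def base_data_def vector_fields_add vector_fields_scale smooth_funs_add
      smooth_funs_mult forms1_comb)

section \<open>The bracket on the base\<close>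

context
  fixes M :: "('m::t2_space, 'n::real_inner) atlas" and F F' H :: "'m form"
  assumes M_atlas: "compatible_atlas M" and F: "F \<in> forms M 2" "F' \<in> forms M 2" and H: "H \<in> forms M 3"
begin

text \<open>Tensoriality in \<open>Z\<close> is checked term by term: it is known for
  \<open>lie1\<close> and \<open>d1\<close>, and the other terms involve \<open>Z\<close> only
  through its value at the point.\<close>

lemma bracket_form_form1:
  assumes "a \<in> base_data M" "b \<in> base_data M"
  shows "form1_of M (bracket_form F F' H a b) \<in> forms M 1"
    "Z \<in> vector_fields M \<Longrightarrow> form1_of M (bracket_form F F' H a b) p [Z p] = bracket_form F F' H a b Z p"
proof -
  obtain X f C g where a: "a = (X, f, C, g)" by (cases a)
  obtain Y f' C' g' where b: "b = (Y, f', C', g')" by (cases b)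
  have X: "X \<in> vector_fields M" and f: "f \<in> smooth_funs M" and C: "C \<in> forms M 1" and g: "g \<in> smooth_funs M"
    and Y: "Y \<in> vector_fields M" and f': "f' \<in> smooth_funs M" and C': "C' \<in> forms M 1" and g': "g' \<in> smooth_funs M"
    using assms by (auto simp: a b base_data_def)
  note t = vector_fieldsD(1)
  let ?B = "bracket_form F F' H a b"
  have 1: "?B (\<lambda>p h. s * Z p h + r * W p h) p = s * ?B Z p + r * ?B W p"
    if Z: "Z \<in> vector_fields M" and W: "W \<in> vector_fields M" for Z W s r p
    unfolding bracket_form_def a b case_prod_conv lie1_lincomb[OF M_atlas C' X Z W] d1_lincomb[OF M_atlas C Y Z W]
        form2_lincomb[OF F(1) t[OF X] t[OF Z] t[OF W]] form2_lincomb[OF F(2) t[OF X] t[OF Z] t[OF W]]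
        form2_lincomb[OF F(1) t[OF Y] t[OF Z] t[OF W]] form2_lincomb[OF F(2) t[OF Y] t[OF Z] t[OF W]]
        form3_lincomb[OF H t[OF X] t[OF Y] t[OF Z] t[OF W]]
    by (simp add: algebra_simps)
  have 2: "?B Z p = 0" if Z: "Z \<in> vector_fields M" "Z p = (\<lambda>f. 0)" for Z p
    unfolding bracket_form_def a b
    by (simp add: lie1_tensorial[OF M_atlas C' X Z] d1_tensorial_right[OF M_atlas C Y Z] Z(2)
        form2_zero[OF M_atlas F(1) t[OF X]] form2_zero[OF M_atlas F(2) t[OF X]]
        form2_zero[OF M_atlas F(1) t[OF Y]] form2_zero[OF M_atlas F(2) t[OF Y]] form3_zero[OF M_atlas H t[OF X] t[OF Y]])
  have 3: "?B Z \<in> smooth_funs M" if Z: "Z \<in> vector_fields M" for Z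
    unfolding bracket_form_def a b case_prod_conv
    by (intro smooth_funs_diff smooth_funs_add smooth_funs_mult f g f' g' vector_field_smooth[OF Z]
        form2_smooth[OF F(1)] form2_smooth[OF F(2)] form3_smooth[OF H] lie1_smooth[OF M_atlas C' X Z]
        d1_smooth[OF M_atlas C Y Z] X Y Z)
  show "form1_of M ?B \<in> forms M 1" by (rule form1_of(1)[OF M_atlas 1 2 3])
  show "form1_of M ?B p [Z p] = ?B Z p" if "Z \<in> vector_fields M" by (rule form1_of(2)[OF M_atlas 1 2 3 that])
qed

lemma base_bracket_mem:
  assumes "a \<in> base_data M" "b \<in> base_data M"
  shows "base_bracket M F F' H a b \<in> base_data M"
proof -
  obtain X f C g where a: "a = (X, f, C, g)" by (cases a)
  obtain Y f' C' g' where b: "b = (Y, f', C', g')" by (cases b)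
  have m: "X \<in> vector_fields M" "Y \<in> vector_fields M"
    using assms by (auto simp: a b base_data_def)
  show ?thesis
    using bracket_form_form1(1)[OF assms] lie_bracket_vector_fields[OF M_atlas m]
    unfolding a b base_bracket_def base_data_def case_prod_conv mem_Times_iff fst_conv snd_conv
    by (intro conjI smooth_funs_diff vector_field_smooth[OF m(1)] vector_field_smooth[OF m(2)]
        form2_smooth[OF F(1) m] form2_smooth[OF F(2) m])
qed

end

section \<open>Sections and their components\<close>

context connection
begin

lemma pull1_apply: "v \<in> tangent_space (tot P) e \<Longrightarrow> pull M P 1 C e [v] = C (prj P e) [dprj v]"
  by (simp add: pull_def pullback_def tangent_lists_def)

lemma pull2_apply:
  "v \<in> tangent_space (tot P) e \<Longrightarrow> w \<in> tangent_space (tot P) e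
    \<Longrightarrow> pull M P 2 F e [v, w] = F (prj P e) [dprj v, dprj w]"
  by (simp add: pull_def pullback_def tangent_lists_def)

lemma pull3_apply:
  "u \<in> tangent_space (tot P) e \<Longrightarrow> v \<in> tangent_space (tot P) e \<Longrightarrow> w \<in> tangent_space (tot P) e
    \<Longrightarrow> pull M P 3 H e [u, v, w] = H (prj P e) [dprj u, dprj v, dprj w]"
  by (simp add: pull_def pullback_def tangent_lists_def)

lemma section_form_apply:
  "v \<in> tangent_space (tot P) e \<Longrightarrow>
    snd (split_section M P \<theta> (X, f, C, g)) e [v] = C (prj P e) [dprj v] + g (prj P e) * \<theta> e [v]"
  by (simp add: split_section_def pull1_apply)

lemma section_form_off:
  "vs \<notin> tangent_lists (tot P) 1 e \<Longrightarrow> snd (split_section M P \<theta> (X, f, C, g)) e vs = 0"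
  by (simp add: split_section_def pull_def pullback_def form_off_tangent_lists[OF \<theta>_form])

text \<open>Smoothness is the issue, since \<open>Z\<close> need not project to a field on the base.
  In a frame of the base, \<open>dprj (Z x)\<close> has as coefficients the derivatives along
  \<open>Z\<close> of pulled back coordinate functions, and these are smooth.\<close>

lemma pull_form1:
  assumes C: "C \<in> forms M 1"
  shows "pull M P 1 C \<in> forms (tot P) 1"
proof (rule form1I)
  show "pull M P 1 C p vs = 0" if "vs \<notin> tangent_lists (tot P) 1 p" for p vs
    using that by (simp add: pull_def pullback_def)
  show "pull M P 1 C p [\<lambda>f. a * u f + b * w f] = a * pull M P 1 C p [u] + b * pull M P 1 C p [w]"
    if v: "u \<in> tangent_space (tot P) p" "w \<in> tangent_space (tot P) p" for p u w a b
    using form1_lincomb[OF C dprj_tangent[OF v(1)] dprj_tangent[OF v(2)]]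
    by (simp add: pull1_apply v tangent_space_lincomb[OF P_atlas v] dprj_lincomb)
  show "(\<lambda>x. pull M P 1 C x [Z x]) \<in> smooth_funs (tot P)" if Z: "Z \<in> vector_fields (tot P)" for Z
  proof (rule smooth_funs_local[OF P_atlas])
    fix e
    note t = vector_fieldsD(1)
    obtain N and I :: "'n set" and y Y where N: "open N" "prj P e \<in> N" "finite I"
      "\<And>i. i \<in> I \<Longrightarrow> y i \<in> smooth_funs M" "\<And>i. i \<in> I \<Longrightarrow> Y i \<in> vector_fields M"
      "\<And>q v. q \<in> N \<Longrightarrow> v \<in> tangent_space M q \<Longrightarrow> v = (\<lambda>f. \<Sum>i\<in>I. v (y i) * Y i q f)"
      "\<And>q i j f. q \<in> N \<Longrightarrow> i \<in> I \<Longrightarrow> j \<in> I \<Longrightarrow> Y i q (\<lambda>r. Y j r f) = Y j q (\<lambda>r. Y i r f)"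
      by (rule local_frame[OF M_atlas, where p="prj P e"]) blast
    define G where "G x = (\<Sum>i\<in>I. Z x (\<lambda>q. y i (prj P q)) * C (prj P x) [Y i (prj P x)])" for x
    have "G \<in> smooth_funs (tot P)"
      unfolding G_def
      by (intro smooth_funs_sum smooth_funs_mult vector_field_smooth[OF Z] pull_fun_smooth[OF form1_smooth[OF C]] N(5))
    then have "smooth_fun_on (tot P) (prj P -` N) G"
      using smooth_map_on_subset unfolding smooth_funs_iff by blast
    moreover have "pull M P 1 C x [Z x] = G x" if "prj P x \<in> N" for x
    proof -
      have "pull M P 1 C x [Z x] = C (prj P x) [dprj (Z x)]" by (rule pull1_apply[OF t[OF Z]])
      also have "dprj (Z x) = (\<lambda>f. \<Sum>i\<in>I. dprj (Z x) (y i) * Y i (prj P x) f)"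
        by (rule N(6)[OF that dprj_tangent[OF t[OF Z]]])
      also have "C (prj P x) [\<lambda>f. \<Sum>i\<in>I. dprj (Z x) (y i) * Y i (prj P x) f]
          = (\<Sum>i\<in>I. dprj (Z x) (y i) * C (prj P x) [Y i (prj P x)])"
        by (rule form1_sum[OF M_atlas C t[OF N(5)]])
      also have "\<dots> = G x" unfolding G_def using N(4) by (intro sum.cong refl) (simp add: dprj_apply)
      finally show ?thesis .
    qed
    moreover have "open (prj P -` N)"
      using N(1) continuous_on_open_vimage[OF open_UNIV] smooth_map_on_continuous[OF prj_smooth]
      by (metis Int_UNIV_right)
    ultimately show "\<exists>S g. open S \<and> e \<in> S \<and> smooth_fun_on (tot P) S g \<and> (\<forall>x\<in>S. pull M P 1 C x [Z x] = g x)"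
      using N(2) by (intro exI[of _ "prj P -` N"] exI[of _ G]) simp
  qed
qed

lemma section_form_mem:
  assumes "C \<in> forms M 1" "g \<in> smooth_funs M"
  shows "snd (split_section M P \<theta> (X, f, C, g)) \<in> forms (tot P) 1"
  using forms1_comb[OF pull_form1[OF assms(1)] \<theta>_form smooth_funs_const[of 1] pull_fun_smooth[OF assms(2)]]
  by (simp add: split_section_def)

lemma section_form_invariant: "invariant_form P 1 (snd (split_section M P \<theta> (X, f, C, g)))" (is "invariant_form P 1 ?\<xi>")
  unfolding invariant_form_def
proof (intro ballI ext)
  fix z e vs assume z: "z \<in> circle"
  show "pullback (tot P) (tot P) 1 (\<lambda>x. act P x z) ?\<xi> e vs = ?\<xi> e vs"
  proof (cases "vs \<in> tangent_lists (tot P) 1 e")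
    case True
    then obtain v where v: "v \<in> tangent_space (tot P) e" "vs = [v]" by (auto simp: tangent_lists_1)
    have "?\<xi> (act P e z) [dact z v] = ?\<xi> e [v]"
      using section_form_apply[OF v(1)] section_form_apply[OF dact_tangent[OF z v(1)]]
        dprj_dact[OF z] prj_act[OF z] \<theta>_invariant[OF z v(1)] by simp
    then show ?thesis using True v(2) by (simp add: pullback_def)
  next
    case False
    then show ?thesis by (simp add: pullback_def section_form_off)
  qed
qed

lemma section_mem:
  assumes "d \<in> base_data M"
  shows "split_section M P \<theta> d \<in> invariant_sections P"
proof -
  obtain X f C g where d: "d = (X, f, C, g)" by (cases d)
  then have m: "X \<in> vector_fields M" "f \<in> smooth_funs M" "C \<in> forms M 1" "g \<in> smooth_funs M"
    using assms by (auto simp: base_data_def)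
  note s = splits_section[OF m(1,2), of C g]
  have "split_section M P \<theta> d = (fst (split_section M P \<theta> d), snd (split_section M P \<theta> d))" by simp
  then show ?thesis
    using splitsD(1)[OF s] splits_invariant[OF s] section_form_mem[OF m(3,4), of X f] section_form_invariant[of X f C g]
    unfolding d invariant_sections_def by (metis (mono_tags, lifting) case_prodI mem_Collect_eq)
qed

lemma splits_apply: "splits U X f \<Longrightarrow> h \<in> smooth_funs M \<Longrightarrow> U e (\<lambda>x. h (prj P x)) = X (prj P e) h"
  using splitsD(2) dprj_apply by metis

lemma splits_vert: "splits vert (\<lambda>p h. 0) (\<lambda>p. 1)"
  using vert_vector_field dprj_vert \<theta>_vert by (simp add: splits_def)

text \<open>The components are defined at a chosen point of each fibre. Invariance and transitivity
  on the fibres make them independent of that point, and smoothness descends from the total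
  space.\<close>

lemma splits_decompose:
  assumes U: "U \<in> vector_fields (tot P)" "invariant_field P U"
  shows "\<exists>X\<in>vector_fields M. \<exists>f\<in>smooth_funs M. splits U X f"
proof -
  have inv: "dact z (U e) = U (act P e z)" if "z \<in> circle" for z e
    using U(2) that by (simp add: invariant_field_def)
  note t = vector_fieldsD(1)[OF U(1)]
  define X where "X p = dprj (U (fibre_point P p))" for p
  define f where "f p = \<theta> (fibre_point P p) [U (fibre_point P p)]" for p
  have Xf: "X (prj P e) = dprj (U e)" "f (prj P e) = \<theta> e [U e]" for e
  proof -
    obtain z where z: "z \<in> circle" "fibre_point P (prj P e) = act P e z"
      using fibre_transitive[of e "fibre_point P (prj P e)"] by auto
    show "X (prj P e) = dprj (U e)" "f (prj P e) = \<theta> e [U e]"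
      using dprj_dact[OF z(1), of "U e"] \<theta>_invariant[OF z(1) t[of e]] inv[OF z(1), of e]
      by (simp_all add: X_def f_def z(2))
  qed
  have "f \<in> smooth_funs M"
    by (rule smooth_funs_descend) (simp add: Xf form1_smooth[OF \<theta>_form U(1)])
  moreover have "X \<in> vector_fields M"
  proof -
    have "X p \<in> tangent_space M p" for p
      using dprj_tangent[OF t[of "fibre_point P p"]] by (simp add: X_def)
    moreover have "(\<lambda>p. X p h) \<in> smooth_funs M" if "h \<in> smooth_funs M" for h
      by (rule smooth_funs_descend) (simp add: Xf dprj_apply[OF that] vector_field_smooth[OF U(1)])
    ultimately show ?thesis by (simp add: vector_fields_def)
  qed
  moreover have "splits U X f" using U(1) Xf by (simp add: splits_def)
  ultimately show ?thesis by blast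
qed

lemma invariant_pairing_descends:
  assumes \<xi>: "\<xi> \<in> forms (tot P) 1" "invariant_form P 1 \<xi>" and U: "splits U X f"
  shows "(\<lambda>p. \<xi> (fibre_point P p) [U (fibre_point P p)]) \<in> smooth_funs M"
    and "\<xi> (fibre_point P (prj P e)) [U (fibre_point P (prj P e))] = \<xi> e [U e]"
proof -
  have *: "\<xi> (fibre_point P (prj P e)) [U (fibre_point P (prj P e))] = \<xi> e [U e]" for e
  proof -
    obtain z where z: "z \<in> circle" "fibre_point P (prj P e) = act P e z"
      using fibre_transitive[of e "fibre_point P (prj P e)"] by auto
    have "dact z (U e) = U (act P e z)" using splits_invariant[OF U] z(1) by (simp add: invariant_field_def)
    then show ?thesis
      using invariant_form1[OF \<xi>(2) z(1) vector_fieldsD(1)[OF splitsD(1)[OF U], of e]] by (simp add: z(2))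
  qed
  then show "\<xi> (fibre_point P (prj P e)) [U (fibre_point P (prj P e))] = \<xi> e [U e]" .
  show "(\<lambda>p. \<xi> (fibre_point P p) [U (fibre_point P p)]) \<in> smooth_funs M"
    by (rule smooth_funs_descend) (simp add: * form1_smooth[OF \<xi>(1) splitsD(1)[OF U]])
qed

lemma splits_horizontal_lift:
  assumes "X \<in> vector_fields M"
  shows "splits (horizontal_lift M P \<theta> X) X (\<lambda>p. 0)"
  using horizontal_lift[where X=X, OF vector_fieldsD(1)[OF assms]] horizontal_lift_vector_field[OF assms]
  by (simp add: splits_def)

text \<open>The components are forced: \<open>g\<close> is the value of \<open>\<xi>\<close> on the
  vertical field and \<open>C\<close> its value on horizontal lifts. The latter is given on vector
  fields of the base, hence the passage through \<open>form1_of\<close>.\<close>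

lemma form_decompose:
  assumes \<xi>: "\<xi> \<in> forms (tot P) 1" "invariant_form P 1 \<xi>"
  shows "\<exists>C\<in>forms M 1. \<exists>g\<in>smooth_funs M. \<forall>X f. \<xi> = snd (split_section M P \<theta> (X, f, C, g))"
proof -
  define fp where "fp = fibre_point P"
  have fp: "prj P (fp p) = p" for p by (simp add: fp_def)
  define g where "g p = \<xi> (fp p) [vert (fp p)]" for p
  define \<Phi> where "\<Phi> Z p = \<xi> (fp p) [horizontal_lift M P \<theta> Z (fp p)]" for Z p
  note des = invariant_pairing_descends[OF \<xi>, folded fp_def]
  note h = splits_horizontal_lift
  have ht: "horizontal_lift M P \<theta> Z e \<in> tangent_space (tot P) e"
     "dprj (horizontal_lift M P \<theta> Z e) = Z (prj P e)" "\<theta> e [horizontal_lift M P \<theta> Z e] = 0"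
    if "Z \<in> vector_fields M" for Z e
    using splitsD(2,3)[OF h[OF that], of e] vector_fieldsD(1)[OF horizontal_lift_vector_field[OF that]] by auto
  have 1: "\<Phi> (\<lambda>p f. a * Z p f + b * W p f) p = a * \<Phi> Z p + b * \<Phi> W p"
    if Z: "Z \<in> vector_fields M" and W: "W \<in> vector_fields M" for Z W a b p
  proof -
    note zw = ht[OF Z, of "fp p"] ht[OF W, of "fp p"]
    let ?V = "\<lambda>p f. a * Z p f + b * W p f"
    have V: "?V \<in> vector_fields M" by (rule vector_fields_lincomb[OF M_atlas Z W])
    have "horizontal_lift M P \<theta> ?V (fp p)
        = (\<lambda>f. a * horizontal_lift M P \<theta> Z (fp p) f + b * horizontal_lift M P \<theta> W (fp p) f)"
    proof (rule tangent_vector_eqI[OF ht(1)[OF V] tangent_space_lincomb[OF P_atlas zw(1,4)]])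
      show "dprj (horizontal_lift M P \<theta> ?V (fp p))
        = dprj (\<lambda>f. a * horizontal_lift M P \<theta> Z (fp p) f + b * horizontal_lift M P \<theta> W (fp p) f)"
        unfolding dprj_lincomb ht(2)[OF V] zw by simp
      show "\<theta> (fp p) [horizontal_lift M P \<theta> ?V (fp p)]
        = \<theta> (fp p) [\<lambda>f. a * horizontal_lift M P \<theta> Z (fp p) f + b * horizontal_lift M P \<theta> W (fp p) f]"
        unfolding form1_lincomb[OF \<theta>_form zw(1,4)] ht(3)[OF V] zw by simp
    qed
    then show ?thesis using form1_lincomb[OF \<xi>(1) zw(1,4), of a b] by (simp add: \<Phi>_def)
  qed
  have 2: "\<Phi> Z p = 0" if Z: "Z \<in> vector_fields M" "Z p = (\<lambda>f. 0)" for Z p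
  proof -
    have 0: "dprj (\<lambda>f. 0) = (\<lambda>h. 0)" by (simp add: differential_def fun_eq_iff)
    have "horizontal_lift M P \<theta> Z (fp p) = (\<lambda>f. 0)"
      by (rule tangent_vector_eqI[OF ht(1)[OF Z(1)] tangent_space_zero[OF P_atlas]])
        (simp_all add: ht[OF Z(1)] fp Z(2) form1_zero[OF P_atlas \<theta>_form] 0)
    then show ?thesis by (simp add: \<Phi>_def form1_zero[OF P_atlas \<xi>(1)])
  qed
  have 3: "\<Phi> Z \<in> smooth_funs M" if Z: "Z \<in> vector_fields M" for Z
    unfolding \<Phi>_def[abs_def] by (rule des(1)[OF h[OF Z]])
  define C where "C = form1_of M \<Phi>"
  have C: "C \<in> forms M 1" "\<And>Z p. Z \<in> vector_fields M \<Longrightarrow> C p [Z p] = \<Phi> Z p"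
    unfolding C_def by (rule form1_of(1)[OF M_atlas 1 2 3], assumption+) (rule form1_of(2)[OF M_atlas 1 2 3], assumption+)
  have g: "g \<in> smooth_funs M" unfolding g_def[abs_def] by (rule des(1)[OF splits_vert])
  have "\<xi> e vs = snd (split_section M P \<theta> (X, f, C, g)) e vs" for X f e vs
  proof (cases "vs \<in> tangent_lists (tot P) 1 e")
    case True
    then obtain v where v: "v \<in> tangent_space (tot P) e" "vs = [v]" by (auto simp: tangent_lists_1)
    \<comment> \<open>A base field extending \<open>dprj v\<close>, whose horizontal lift is the
      horizontal part of \<open>v\<close>.\<close>
    define Z where "Z = extension M (prj P e) (dprj v)"
    note Z = extension_vector_field[OF M_atlas dprj_tangent[OF v(1)], folded Z_def]
    note hz = ht[OF Z(1), of e]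
    have "v = (\<lambda>f. 1 * horizontal_lift M P \<theta> Z e f + \<theta> e [v] * vert e f)"
    proof (rule tangent_vector_eqI[OF v(1) tangent_space_lincomb[OF P_atlas hz(1) vert_tangent]])
      show "dprj v = dprj (\<lambda>f. 1 * horizontal_lift M P \<theta> Z e f + \<theta> e [v] * vert e f)"
        unfolding dprj_lincomb hz(2) Z(2) dprj_vert by simp
      show "\<theta> e [v] = \<theta> e [\<lambda>f. 1 * horizontal_lift M P \<theta> Z e f + \<theta> e [v] * vert e f]"
        unfolding form1_lincomb[OF \<theta>_form hz(1) vert_tangent] hz(3) \<theta>_vert by simp
    qed
    then have "\<xi> e [v] = \<xi> e [\<lambda>f. 1 * horizontal_lift M P \<theta> Z e f + \<theta> e [v] * vert e f]" by simp
    also have "\<dots> = \<xi> e [horizontal_lift M P \<theta> Z e] + \<theta> e [v] * \<xi> e [vert e]"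
      using form1_lincomb[OF \<xi>(1) hz(1) vert_tangent, of 1 "\<theta> e [v]"] by simp
    also have "\<xi> e [horizontal_lift M P \<theta> Z e] = C (prj P e) [dprj v]"
      using C(2)[OF Z(1), of "prj P e"] des(2)[OF h[OF Z(1)], of e] Z(2) by (simp add: \<Phi>_def)
    also have "\<xi> e [vert e] = g (prj P e)" using des(2)[OF splits_vert, of e] by (simp add: g_def)
    finally show ?thesis using section_form_apply[OF v(1)] v(2) by simp
  next
    case False
    then show ?thesis by (simp add: section_form_off form_off_tangent_lists[OF \<xi>(1)])
  qed
  then have "\<forall>X f. \<xi> = snd (split_section M P \<theta> (X, f, C, g))" by blast
  then show ?thesis using C(1) g by blast
qed

section \<open>Bijection between sections and components\<close>

lemma section_surj:
  assumes "s \<in> invariant_sections P"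
  shows "\<exists>d\<in>base_data M. split_section M P \<theta> d = s"
proof -
  obtain U \<xi> where s: "s = (U, \<xi>)" by (cases s)
  then have m: "U \<in> vector_fields (tot P)" "\<xi> \<in> forms (tot P) 1" "invariant_field P U" "invariant_form P 1 \<xi>"
    using assms by (auto simp: invariant_sections_def)
  obtain X f where X: "X \<in> vector_fields M" "f \<in> smooth_funs M" "splits U X f"
    using splits_decompose[OF m(1,3)] by blast
  obtain C g where C: "C \<in> forms M 1" "g \<in> smooth_funs M" "\<xi> = snd (split_section M P \<theta> (X, f, C, g))"
    using form_decompose[OF m(2,4)] by blast
  have "fst (split_section M P \<theta> (X, f, C, g)) = U"
    by (rule splits_unique[OF splits_section[OF X(1,2)] X(3)])
  then have "split_section M P \<theta> (X, f, C, g) = s" using C(3) s by (simp add: prod_eq_iff)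
  then show ?thesis using X C by (intro bexI[of _ "(X, f, C, g)"]) (auto simp: base_data_def)
qed

lemma section_inj: "inj_on (split_section M P \<theta>) (base_data M)"
proof (rule inj_onI)
  fix d d' assume d: "d \<in> base_data M" and d': "d' \<in> base_data M"
    and eq: "split_section M P \<theta> d = split_section M P \<theta> d'"
  obtain X f C g where dd: "d = (X, f, C, g)" by (cases d)
  obtain X' f' C' g' where dd': "d' = (X', f', C', g')" by (cases d')
  have m: "X \<in> vector_fields M" "f \<in> smooth_funs M" "C \<in> forms M 1" "g \<in> smooth_funs M"
    and m': "X' \<in> vector_fields M" "f' \<in> smooth_funs M" "C' \<in> forms M 1" "g' \<in> smooth_funs M"
    using d d' by (auto simp: base_data_def dd dd')
  note s = splitsD[OF splits_section[OF m(1,2), of C g]]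
  note s' = splitsD[OF splits_section[OF m'(1,2), of C' g']]
  have *: "C p [dprj v] + g p * \<theta> (fibre_point P p) [v] = C' p [dprj v] + g' p * \<theta> (fibre_point P p) [v]"
    if "v \<in> tangent_space (tot P) (fibre_point P p)" for p v
    using section_form_apply[OF that, of X f C g] section_form_apply[OF that, of X' f' C' g'] eq
    by (simp add: dd dd')
  have "X p = X' p" "f p = f' p" for p
    using s(2,3)[of "fibre_point P p"] s'(2,3)[of "fibre_point P p"] eq by (simp_all add: dd dd')
  \<comment> \<open>The vertical vector isolates \<open>g\<close>, since \<open>C\<close> only sees
    the projection.\<close>
  moreover have gg: "g p = g' p" for p
    using *[OF vert_tangent, of p] by (simp add: \<theta>_vert dprj_vert form1_zero[OF M_atlas m(3)] form1_zero[OF M_atlas m'(3)])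
  moreover have "C p vs = C' p vs" for p vs
  proof (cases "vs \<in> tangent_lists M 1 p")
    case True
    then obtain u where u: "u \<in> tangent_space M p" "vs = [u]" by (auto simp: tangent_lists_1)
    then obtain v where v: "v \<in> tangent_space (tot P) (fibre_point P p)" "dprj v = u"
      using dprj_surj[of u "fibre_point P p"] by auto
    show ?thesis using *[OF v(1)] v(2) u(2) gg by simp
  next
    case False
    then show ?thesis using form_off_tangent_lists[OF m(3)] form_off_tangent_lists[OF m'(3)] by simp
  qed
  ultimately show "d = d'" by (simp add: dd dd' fun_eq_iff)
qed

lemma section_bij: "bij_betw (split_section M P \<theta>) (base_data M) (invariant_sections P)"
  unfolding bij_betw_def using section_inj section_mem section_surj by blast

lemma section_eqI:
  assumes "a \<in> base_data M" and s: "splits (fst s) (fst a) (fst (snd a))"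
    and form: "\<And>e v. v \<in> tangent_space (tot P) e \<Longrightarrow>
      snd s e [v] = fst (snd (snd a)) (prj P e) [dprj v] + snd (snd (snd a)) (prj P e) * \<theta> e [v]"
    and off: "\<And>e vs. vs \<notin> tangent_lists (tot P) 1 e \<Longrightarrow> snd s e vs = 0"
  shows "s = split_section M P \<theta> a"
proof -
  obtain X f C g where a: "a = (X, f, C, g)" by (cases a)
  have m: "X \<in> vector_fields M" "f \<in> smooth_funs M" using assms(1) by (auto simp: a base_data_def)
  have "fst s = fst (split_section M P \<theta> a)"
    using splits_unique[OF s] splits_section[OF m] by (simp add: a)
  moreover have "snd s e vs = snd (split_section M P \<theta> a) e vs" for e vs
  proof (cases "vs \<in> tangent_lists (tot P) 1 e")
    case True
    then obtain v where v: "v \<in> tangent_space (tot P) e" "vs = [v]" by (auto simp: tangent_lists_1)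
    then show ?thesis using form[OF v(1)] section_form_apply[OF v(1)] by (simp add: a)
  qed (simp add: a off section_form_off)
  ultimately show ?thesis by (simp add: prod_eq_iff fun_eq_iff)
qed

lemma section_comb:
  assumes a: "a \<in> base_data M" and b: "b \<in> base_data M" and uv: "u \<in> smooth_funs M" "v \<in> smooth_funs M"
    and U: "split_section M P \<theta> a = (U, \<xi>)" and V: "split_section M P \<theta> b = (V, \<zeta>)"
  shows "(\<lambda>e f. u (prj P e) * U e f + v (prj P e) * V e f, \<lambda>e vs. u (prj P e) * \<xi> e vs + v (prj P e) * \<zeta> e vs)
     = split_section M P \<theta> (base_comb u v a b)" (is "(?W, _) = _")
proof (rule section_eqI[OF base_comb_mem[OF M_atlas uv a b]], unfold fst_conv snd_conv)
  obtain X f C g where aa: "a = (X, f, C, g)" by (cases a)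
  obtain Y f' C' g' where bb: "b = (Y, f', C', g')" by (cases b)
  have m: "X \<in> vector_fields M" "f \<in> smooth_funs M" "Y \<in> vector_fields M" "f' \<in> smooth_funs M"
    using a b by (auto simp: base_data_def aa bb)
  have sU: "splits U X f" and sV: "splits V Y f'"
    using splits_section[OF m(1,2), of C g] splits_section[OF m(3,4), of C' g'] U V by (simp_all add: aa bb)
  have \<xi>: "\<xi> = snd (split_section M P \<theta> (X, f, C, g))" "\<zeta> = snd (split_section M P \<theta> (Y, f', C', g'))"
    using U V by (simp_all add: aa bb)
  note s = splitsD[OF sU] splitsD[OF sV]
  have "?W \<in> vector_fields (tot P)"
    by (intro vector_fields_add[OF P_atlas] vector_fields_scale[OF P_atlas] pull_fun_smooth uv s)
  then show "splits ?W (fst (base_comb u v a b)) (fst (snd (base_comb u v a b)))"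
    using form1_lincomb[OF \<theta>_form vector_fieldsD(1)[OF s(1)] vector_fieldsD(1)[OF s(4)]]
    by (simp add: splits_def base_comb_def aa bb dprj_lincomb s)
  show "u (prj P e) * \<xi> e [w] + v (prj P e) * \<zeta> e [w] = fst (snd (snd (base_comb u v a b))) (prj P e) [dprj w]
      + snd (snd (snd (base_comb u v a b))) (prj P e) * \<theta> e [w]" if "w \<in> tangent_space (tot P) e" for e w
    using section_form_apply[OF that] by (simp add: \<xi> base_comb_def aa bb algebra_simps)
  show "u (prj P e) * \<xi> e vs + v (prj P e) * \<zeta> e vs = 0" if "vs \<notin> tangent_lists (tot P) 1 e" for e vs
    using section_form_off[OF that] by (simp add: \<xi>)
qed

lemma section_add:
  assumes "a \<in> base_data M" "b \<in> base_data M"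
  shows "cadd (invariant_courant M P \<eta>) (split_section M P \<theta> a) (split_section M P \<theta> b)
     = split_section M P \<theta> (base_comb (\<lambda>p. 1) (\<lambda>p. 1) a b)"
  using section_comb[OF assms smooth_funs_const smooth_funs_const prod.collapse[symmetric] prod.collapse[symmetric], of 1 1]
  by (simp add: invariant_courant_def case_prod_unfold)

text \<open>Scaling is a combination whose second summand has coefficient zero.\<close>

lemma section_scale:
  assumes "u \<in> smooth_funs M" "a \<in> base_data M"
  shows "cscale (invariant_courant M P \<eta>) u (split_section M P \<theta> a)
     = split_section M P \<theta> (base_comb u (\<lambda>p. 0) a a)"
  using section_comb[OF assms(2,2,1) smooth_funs_const prod.collapse[symmetric] prod.collapse[symmetric], of 0]
  by (simp add: invariant_courant_def case_prod_unfold)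

text \<open>The scalar components enter through an expression that is unchanged when
  \<open>f\<close> and \<open>g\<close> are exchanged in both arguments.\<close>

lemma section_pairing:
  assumes "(X, f, C, g) \<in> base_data M" "(Y, f', C', g') \<in> base_data M"
  shows "cpairing (invariant_courant M P \<eta>) (split_section M P \<theta> (X, f, C, g)) (split_section M P \<theta> (Y, f', C', g')) p
     = C' p [X p] + C p [Y p] + (g' p * f p + g p * f' p)"
proof -
  have m: "X \<in> vector_fields M" "f \<in> smooth_funs M" "Y \<in> vector_fields M" "f' \<in> smooth_funs M"
    using assms by (auto simp: base_data_def)
  note s = splits_section[OF m(1,2), of C g] splits_section[OF m(3,4), of C' g']
  note t = vector_fieldsD(1)[OF splitsD(1)[OF s(1)]] vector_fieldsD(1)[OF splitsD(1)[OF s(2)]]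
  show ?thesis
    using section_form_apply[OF t(1)[of "fibre_point P p"], of Y f' C' g']
      section_form_apply[OF t(2)[of "fibre_point P p"], of X f C g]
      splitsD(2,3)[OF s(1), of "fibre_point P p"] splitsD(2,3)[OF s(2), of "fibre_point P p"]
    by (simp add: invariant_courant_def case_prod_unfold Let_def)
qed

lemma section_anchor:
  assumes "(X, f, C, g) \<in> base_data M"
  shows "canchor (invariant_courant M P \<eta>) (split_section M P \<theta> (X, f, C, g)) = X"
proof
  fix p
  have m: "X \<in> vector_fields M" "f \<in> smooth_funs M" using assms by (auto simp: base_data_def)
  show "canchor (invariant_courant M P \<eta>) (split_section M P \<theta> (X, f, C, g)) p = X p"
    using splitsD(2)[OF splits_section[OF m, of C g], of "fibre_point P p"]
    by (simp add: invariant_courant_def case_prod_unfold)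
qed

end

section \<open>Curvature and the bracket of sections\<close>

locale curved_connection = connection M P \<theta>
  for M :: "('m::{t2_space,second_countable_topology}, 'n::real_inner) atlas"
    and P :: "('e::{t2_space,second_countable_topology}, 'b::real_inner, 'm) circle_bundle"
    and \<theta> :: "'e form" +
  fixes F :: "'m form"
  assumes curvature: "curvature_form M P \<theta> F"
begin

lemma F_form: "F \<in> forms M 2"
  using curvature by (simp add: curvature_form_def closed_forms_def)

text \<open>The vertical component is found by solving the invariant formula for
  \<open>d\<theta>(U, V)\<close>, which equals \<open>F(X, Y)\<close>, for
  \<open>\<theta>([U, V])\<close>.\<close>

lemma splits_lie_bracket:
  assumes U: "splits U X f" and V: "splits V Y f'" and m: "X \<in> vector_fields M" "Y \<in> vector_fields M"
    and f: "f \<in> smooth_funs M" "f' \<in> smooth_funs M"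
  shows "splits (lie_bracket U V) (lie_bracket X Y) (\<lambda>p. X p f' - Y p f - F p [X p, Y p])"
proof -
  note u = splitsD[OF U] and v = splitsD[OF V]
  have L: "lie_bracket U V \<in> vector_fields (tot P)" by (rule lie_bracket_vector_fields[OF P_atlas u(1) v(1)])
  have "dprj (lie_bracket U V e) h = lie_bracket X Y (prj P e) h" for e h
  proof (cases "h \<in> smooth_funs M")
    case True
    then show ?thesis
      using splits_apply[OF U, of "\<lambda>p. Y p h" e] splits_apply[OF V, of "\<lambda>p. X p h" e]
        vector_field_smooth[OF m(1)] vector_field_smooth[OF m(2)]
      by (simp add: dprj_apply lie_bracket_def splits_apply[OF U True] splits_apply[OF V True])
  next
    case False
    then show ?thesis
      using tangent_vector_nonsmooth[OF vector_fieldsD(1)[OF lie_bracket_vector_fields[OF M_atlas m]]]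
      by (simp add: dprj_nonsmooth)
  qed
  moreover have "\<theta> e [lie_bracket U V e] = X (prj P e) f' - Y (prj P e) f - F (prj P e) [X (prj P e), Y (prj P e)]" for e
  proof -
    have "d1 \<theta> U V e = ext_deriv (tot P) 1 \<theta> e [U e, V e]" by (rule ext_deriv1_eq[OF P_atlas \<theta>_form u(1) v(1), symmetric])
    also have "\<dots> = F (prj P e) [X (prj P e), Y (prj P e)]"
      using curvature pull2_apply[OF vector_fieldsD(1)[OF u(1)] vector_fieldsD(1)[OF v(1)]]
      by (simp add: curvature_form_def u v)
    finally show ?thesis
      by (simp add: d1_def u(3) v(3) splits_apply[OF U f(2)] splits_apply[OF V f(1)])
  qed
  ultimately show ?thesis using L by (simp add: splits_def fun_eq_iff)
qed

text \<open>The vector field part is \<open>splits_lie_bracket\<close>. For the form part, the Lie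
  derivative, the exterior derivative and the twist are computed on a projectable extension of a
  tangent vector \<open>w\<close>, and the sum is sorted by the constant \<open>c\<close>, the value
  of \<theta> on \<open>w\<close>: its coefficient is the new component along \<theta>, and the
  remainder is \<open>bracket_form\<close>.\<close>

lemma section_bracket:
  assumes F': "F' \<in> forms M 2" and H: "H \<in> forms M 3" and \<eta>: "\<eta> \<in> forms (tot P) 3"
    and \<eta>_eq: "\<eta> = (\<lambda>e vs. pull M P 3 H e vs + wedge1 \<theta> (pull M P 2 F') e vs)"
    and a: "a \<in> base_data M" and b: "b \<in> base_data M"
  shows "cbracket (invariant_courant M P \<eta>) (split_section M P \<theta> a) (split_section M P \<theta> b)
     = split_section M P \<theta> (base_bracket M F F' H a b)"
proof (rule section_eqI[OF base_bracket_mem[OF M_atlas F_form F' H a b]])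
  obtain X f C g where aa: "a = (X, f, C, g)" by (cases a)
  obtain Y f' C' g' where bb: "b = (Y, f', C', g')" by (cases b)
  have m: "X \<in> vector_fields M" "f \<in> smooth_funs M" "C \<in> forms M 1" "g \<in> smooth_funs M"
    and m': "Y \<in> vector_fields M" "f' \<in> smooth_funs M" "C' \<in> forms M 1" "g' \<in> smooth_funs M"
    using a b by (auto simp: base_data_def aa bb)
  obtain U \<xi> where Ue: "split_section M P \<theta> a = (U, \<xi>)" by fastforce
  obtain V \<zeta> where Ve: "split_section M P \<theta> b = (V, \<zeta>)" by fastforce
  have U: "splits U X f" and V: "splits V Y f'"
    using splits_section[OF m(1,2), of C g] splits_section[OF m'(1,2), of C' g'] Ue Ve by (simp_all add: aa bb)
  have \<xi>e: "\<xi> = snd (split_section M P \<theta> (X, f, C, g))" and \<zeta>e: "\<zeta> = snd (split_section M P \<theta> (Y, f', C', g'))"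
    using Ue Ve by (simp_all add: aa bb)
  have \<xi>: "\<xi> \<in> forms (tot P) 1" and \<zeta>: "\<zeta> \<in> forms (tot P) 1"
    unfolding \<xi>e \<zeta>e by (intro section_form_mem m m')+
  note u = splitsD[OF U] and v = splitsD[OF V]
  have br: "cbracket (invariant_courant M P \<eta>) (split_section M P \<theta> a) (split_section M P \<theta> b)
      = dorfman (tot P) \<eta> (U, \<xi>) (V, \<zeta>)"
    by (simp add: invariant_courant_def Ue Ve)
  show "splits (fst (cbracket (invariant_courant M P \<eta>) (split_section M P \<theta> a) (split_section M P \<theta> b)))
     (fst (base_bracket M F F' H a b)) (fst (snd (base_bracket M F F' H a b)))"
    unfolding br using splits_lie_bracket[OF U V m(1) m'(1) m(2) m'(2)]
    by (simp add: dorfman_def base_bracket_def aa bb)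
  show "snd (cbracket (invariant_courant M P \<eta>) (split_section M P \<theta> a) (split_section M P \<theta> b)) e vs = 0"
    if "vs \<notin> tangent_lists (tot P) 1 e" for e vs
    unfolding br by (rule dorfman_form_off[OF u(1) v(1) \<eta> that])
  fix e w assume w: "w \<in> tangent_space (tot P) e"
  define Z where "Z = extension M (prj P e) (dprj w)"
  define c where "c = \<theta> e [w]"
  note Z = extension_vector_field[OF M_atlas dprj_tangent[OF w], folded Z_def]
  \<comment> \<open>An extension of \<open>w\<close> with constant vertical component, so that
    derivatives of \<open>c\<close> vanish. The entries \<open>C\<close> and \<open>g\<close> are
    placeholders, as only the vector field is taken.\<close>
  define W where "W = fst (split_section M P \<theta> (Z, \<lambda>p. c, C, g))"
  have W: "splits W Z (\<lambda>p. c)" unfolding W_def by (rule splits_section[OF Z(1) smooth_funs_const])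
  note ww = splitsD[OF W]
  note t = vector_fieldsD(1)
  have We: "W e = w"
    by (rule tangent_vector_eqI[OF t[OF ww(1)] w]) (simp_all add: ww Z(2) c_def)
  let ?p = "prj P e"
  have \<xi>_apply: "\<xi> x [S x] = C (prj P x) [A (prj P x)] + g (prj P x) * h (prj P x)"
    and \<zeta>_apply: "\<zeta> x [S x] = C' (prj P x) [A (prj P x)] + g' (prj P x) * h (prj P x)"
    if "splits S A h" for S A h x
    unfolding \<xi>e \<zeta>e using section_form_apply[OF t[OF splitsD(1)[OF that], of x]] splitsD[OF that] by auto
  have sm: "(\<lambda>p. C p [Z p]) \<in> smooth_funs M" "(\<lambda>p. C p [Y p]) \<in> smooth_funs M" "(\<lambda>p. C' p [Z p]) \<in> smooth_funs M"
    by (rule form1_smooth[OF m(3) Z(1)] form1_smooth[OF m(3) m'(1)] form1_smooth[OF m'(3) Z(1)])+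
  have dX: "X ?p (\<lambda>p. C' p [Z p] + g' p * c) = X ?p (\<lambda>p. C' p [Z p]) + c * X ?p g'"
    using tangent_vector_add[OF M_atlas t[OF m(1)] sm(3) smooth_funs_mult[OF m'(4) smooth_funs_const]]
      tangent_vector_mult[OF M_atlas t[OF m(1)] m'(4) smooth_funs_const, of ?p c] tangent_vector_const[OF M_atlas t[OF m(1)]]
    by (simp add: mult.commute)
  have dY: "Y ?p (\<lambda>p. C p [Z p] + g p * c) = Y ?p (\<lambda>p. C p [Z p]) + c * Y ?p g"
    using tangent_vector_add[OF M_atlas t[OF m'(1)] sm(1) smooth_funs_mult[OF m(4) smooth_funs_const]]
      tangent_vector_mult[OF M_atlas t[OF m'(1)] m(4) smooth_funs_const, of ?p c] tangent_vector_const[OF M_atlas t[OF m'(1)]]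
    by (simp add: mult.commute)
  have dZ: "Z ?p (\<lambda>p. C p [Y p] + g p * f' p) = Z ?p (\<lambda>p. C p [Y p]) + (g ?p * Z ?p f' + Z ?p g * f' ?p)"
    using tangent_vector_add[OF M_atlas t[OF Z(1)] sm(2) smooth_funs_mult[OF m(4) m'(2)]]
      tangent_vector_mult[OF M_atlas t[OF Z(1)] m(4) m'(2), of ?p] by simp
  have s1: "(\<lambda>p. C' p [Z p] + g' p * c) \<in> smooth_funs M" "(\<lambda>p. C p [Z p] + g p * c) \<in> smooth_funs M"
     "(\<lambda>p. C p [Y p] + g p * f' p) \<in> smooth_funs M"
    by (intro smooth_funs_add smooth_funs_mult smooth_funs_const sm m m')+
  \<comment> \<open>The last summand is \<open>- g'\<close> times the vertical component
    \<open>- Z f - F(X, Z)\<close> of \<open>[U, W]\<close>.\<close>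
  have L: "lie1 U \<zeta> W e = lie1 X C' Z ?p + c * X ?p g' + g' ?p * (Z ?p f + F ?p [X ?p, Z ?p])"
    unfolding lie1_def
    using \<zeta>_apply[OF W] splits_apply[OF U s1(1), of e] dX
      \<zeta>_apply[OF splits_lie_bracket[OF U W m(1) Z(1) m(2) smooth_funs_const], of e] tangent_vector_const[OF M_atlas t[OF m(1)]]
    by (simp add: algebra_simps)
  \<comment> \<open>The term with \<open>Z f'\<close> cancels between the derivative of
    \<open>\<xi>(V)\<close> along \<open>W\<close> and \<open>\<xi>([V, W])\<close>, while the one
    with \<open>Z g\<close> survives.\<close>
  have D: "d1 \<xi> V W e = d1 C Y Z ?p + c * Y ?p g - f' ?p * Z ?p g + g ?p * F ?p [Y ?p, Z ?p]"
    unfolding d1_def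
    using \<xi>_apply[OF W] \<xi>_apply[OF V] splits_apply[OF V s1(2), of e] splits_apply[OF W s1(3), of e] dY dZ
      \<xi>_apply[OF splits_lie_bracket[OF V W m'(1) Z(1) m'(2) smooth_funs_const], of e] tangent_vector_const[OF M_atlas t[OF m'(1)]]
    by (simp add: algebra_simps)
  \<comment> \<open>The wedge product pairs \<open>F'\<close> with the vertical components
    \<open>f\<close>, \<open>f'\<close> and \<open>c\<close> of the three fields.\<close>
  have E: "\<eta> e [U e, V e, W e] = H ?p [X ?p, Y ?p, Z ?p]
      + (f ?p * F' ?p [Y ?p, Z ?p] - f' ?p * F' ?p [X ?p, Z ?p] + c * F' ?p [X ?p, Y ?p])"
    using t[OF u(1), of e] t[OF v(1), of e] t[OF ww(1), of e]
    by (simp add: \<eta>_eq wedge1_3 pull2_apply pull3_apply u v ww)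
  have "snd (dorfman (tot P) \<eta> (U, \<xi>) (V, \<zeta>)) e [W e]
      = bracket_form F F' H a b Z ?p + c * (X ?p g' - Y ?p g - F' ?p [X ?p, Y ?p])"
    unfolding dorfman_form_eq[OF P_atlas \<xi> \<zeta> u(1) v(1) ww(1)] L D E
    by (simp add: bracket_form_def aa bb algebra_simps)
  then show "snd (cbracket (invariant_courant M P \<eta>) (split_section M P \<theta> a) (split_section M P \<theta> b)) e [w]
     = fst (snd (snd (base_bracket M F F' H a b))) (prj P e) [dprj w]
       + snd (snd (snd (base_bracket M F F' H a b))) (prj P e) * \<theta> e [w]"
    unfolding br
    using bracket_form_form1(2)[OF M_atlas F_form F' H a b Z(1), of ?p] Z(2)
    by (simp add: We base_bracket_def aa bb c_def[symmetric] mult.commute)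
qed

end

text \<open>Through \<open>split_section\<close> both structures are expressed on
  \<open>base_data\<close>, where the duality map is \<open>swap_data\<close>. Each clause of the
  isomorphism then becomes an invariance of a formula in the components.\<close>

theorem corollary4p5:
  fixes M :: "('m::{t2_space,second_countable_topology}, 'n::real_inner) atlas"
    and E :: "('e::{t2_space,second_countable_topology}, 'b::real_inner, 'm) circle_bundle"
    and E' :: "('k::{t2_space,second_countable_topology}, 'c::real_inner, 'm) circle_bundle"
    and \<theta> :: "'e form" and \<theta>' :: "'k form"
    and F F' H :: "'m form"
    and \<eta> :: "'e form" and \<eta>' :: "'k form"
  assumes "principal_circle_bundle M E" and "principal_circle_bundle M E'"
    and "connection_form E \<theta>" and "connection_form E' \<theta>'"
    and "curvature_form M E \<theta> F" and "curvature_form M E' \<theta>' F'"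
    and "\<eta> \<in> closed_forms (tot E) 3" and "invariant_form E 3 \<eta>"
    and "\<eta>' \<in> closed_forms (tot E') 3" and "invariant_form E' 3 \<eta>'"
    and "H \<in> forms M 3"
    and "\<eta> = (\<lambda>e vs. pull M E 3 H e vs + wedge1 \<theta> (pull M E 2 F') e vs)"
    and "\<eta>' = (\<lambda>e vs. pull M E' 3 H e vs + wedge1 \<theta>' (pull M E' 2 F) e vs)"
  shows "(\<forall>X\<in>vector_fields M. \<forall>f\<in>smooth_funs M. \<forall>C\<in>forms M 1. \<forall>g\<in>smooth_funs M.
            t_duality_map M E \<theta> E' \<theta>' (split_section M E \<theta> (X, f, C, g)) =
            split_section M E' \<theta>' (X, g, C, f)) \<and>
         courant_isomorphism M (invariant_courant M E \<eta>) (invariant_courant M E' \<eta>')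
           (t_duality_map M E \<theta> E' \<theta>')"
proof -
  interpret E: curved_connection M E \<theta> F
    using assms(1,3,5) by unfold_locales
  interpret E': curved_connection M E' \<theta>' F'
    using assms(2,4,6) by unfold_locales
  let ?s = "split_section M E \<theta>" and ?s' = "split_section M E' \<theta>'" and ?t = "t_duality_map M E \<theta> E' \<theta>'"
  let ?A = "invariant_courant M E \<eta>" and ?B = "invariant_courant M E' \<eta>'"
  \<comment> \<open>Injectivity of \<open>split_section\<close> lets the decomposition in
    \<open>t_duality_map\<close> recover the components \<open>d\<close>.\<close>
  have t: "?t (?s d) = ?s' (swap_data d)" if "d \<in> base_data M" for d
    unfolding t_duality_map_def inv_into_f_f[OF E.section_inj that] by (cases d) (simp add: swap_data_def)
  have inv: "\<exists>d\<in>base_data M. s = ?s d" if "s \<in> invariant_sections E" for s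
    using E.section_surj[OF that] by blast
  have \<eta>: "\<eta> \<in> forms (tot E) 3" "\<eta>' \<in> forms (tot E') 3"
    using assms(7,9) by (simp_all add: closed_forms_def)
  have "bij_betw swap_data (base_data M) (base_data M)"
    by (rule bij_betw_byWitness[where f'=swap_data]) auto
  then have "bij_betw (?s' \<circ> swap_data \<circ> inv_into (base_data M) ?s) (invariant_sections E) (invariant_sections E')"
    using E.section_bij E'.section_bij by (intro bij_betw_trans[OF bij_betw_inv_into] bij_betw_trans)
  moreover have "(?s' \<circ> swap_data \<circ> inv_into (base_data M) ?s) s = ?t s" for s
    by (simp add: t_duality_map_def swap_data_def case_prod_unfold)
  ultimately have bij: "bij_betw ?t (invariant_sections E) (invariant_sections E')"
    by (metis (mono_tags, lifting) bij_betw_cong)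
  have add: "?t (cadd ?A (?s a) (?s b)) = cadd ?B (?t (?s a)) (?t (?s b))"
    if "a \<in> base_data M" "b \<in> base_data M" for a b
    using that by (simp add: E.section_add E'.section_add t base_comb_mem[OF E.M_atlas] swap_base_comb)
  have scale: "?t (cscale ?A h (?s a)) = cscale ?B h (?t (?s a))"
    if "h \<in> smooth_funs M" "a \<in> base_data M" for h a
    using that by (simp add: E.section_scale E'.section_scale t base_comb_mem[OF E.M_atlas] swap_base_comb)
  \<comment> \<open>\<open>F\<close> is the curvature on \<open>E\<close> and part of the twist on
    \<open>E'\<close>, and \<open>F'\<close> conversely. The two instances of
    \<open>section_bracket\<close> thus differ by the exchange in
    \<open>swap_base_bracket\<close>.\<close>
  have bracket: "?t (cbracket ?A (?s a) (?s b)) = cbracket ?B (?t (?s a)) (?t (?s b))"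
    if "a \<in> base_data M" "b \<in> base_data M" for a b
    using that E.section_bracket[OF E'.F_form assms(11) \<eta>(1) assms(12)] E'.section_bracket[OF E.F_form assms(11) \<eta>(2) assms(13)]
    by (simp add: t base_bracket_mem[OF E.M_atlas E.F_form E'.F_form assms(11)] swap_base_bracket)
  have pairing: "cpairing ?B (?t (?s a)) (?t (?s b)) = cpairing ?A (?s a) (?s b)"
    if "a \<in> base_data M" "b \<in> base_data M" for a b
  proof -
    obtain X f C g Y f' C' g' where ab: "a = (X, f, C, g)" "b = (Y, f', C', g')" by (cases a, cases b)
    have "(X, g, C, f) \<in> base_data M" "(Y, g', C', f') \<in> base_data M" using that by (auto simp: ab base_data_def)
    then show ?thesis
      using that by (auto simp: t ab swap_data_def fun_eq_iff E.section_pairing E'.section_pairing)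
  qed
  have anchor: "canchor ?B (?t (?s a)) = canchor ?A (?s a)" if "a \<in> base_data M" for a
  proof -
    obtain X f C g where aa: "a = (X, f, C, g)" by (cases a)
    have "(X, g, C, f) \<in> base_data M" using that by (auto simp: aa base_data_def)
    then show ?thesis using that by (simp add: t aa swap_data_def E.section_anchor E'.section_anchor)
  qed
  have sec: "csections ?A = invariant_sections E" "csections ?B = invariant_sections E'"
    by (simp_all add: invariant_courant_def)
  have "courant_isomorphism M ?A ?B ?t"
    unfolding courant_isomorphism_def sec
    using bij by (intro conjI ballI) (auto dest!: inv simp: add scale bracket pairing anchor)
  moreover have "?t (?s (X, f, C, g)) = ?s' (X, g, C, f)"
    if "X \<in> vector_fields M" "f \<in> smooth_funs M" "C \<in> forms M 1" "g \<in> smooth_funs M" for X f C g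
    using t[of "(X, f, C, g)"] that by (simp add: base_data_def swap_data_def)
  ultimately show ?thesis by blast
qed

end
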